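(* There is a computable function $f$ and an algorithm that, given digraphs $\vec H$ and $\vec G$, computes the number of subgraphs of $\vec G$ isomorphic to $\vec H$ in time $f(|\vec H|,d(\vec G))\cdot|\vec G|^{\rho^*(\vec H)+O(1)}$. Likewise, there is a computable $f$ and an algorithm computing the number of vertex sets $S\subseteq V(\vec G)$ with $\vec G[S]\cong\vec H$ in time $f(|\vec H|,d(\vec G))\cdot|\vec G|^{\alpha_s(\vec H)+O(1)}$.
   Context: Digraphs are finite, have no multiple arcs, may contain loops and may contain both $(u,v)$ and $(v,u)$. $|\vec G|$ is the length of the adjacency-list encoding of $\vec G$ and $d(\vec G)$ its maximum outdegree. For a digraph $\vec H$, let $\vec H/\!\sim$ be the DAG obtained by contracting each strongly connected component (SCC) of $\vec H$ to a single vertex and deleting loops; its sources are the SCCs of indegree $0$ there; let them be $S_1,\dots,S_k$ with chosen $s_i\in S_i$. $R(v)$ denotes the set of vertices reachable from $v$ (including $v$). The reachability hypergraph $\mathcal R(\vec H)$ has vertex set $V(\vec H)$ and hyperedges $R(s_i)$, $i\in[k]$; the contour $\Gamma(\vec H)$ is obtained from $\mathcal R(\vec H)$ by deleting the vertices of $S_1\cup\dots\cup S_k$. For a hypergraph, $\rho^*$ is the minimum total weight of $\gamma:E\to[0,\infty)$ with $\sum_{e\ni v}\gamma(e)\ge1$ for all vertices $v$. $\rho^*(\vec H):=\rho^*(\Gamma(\vec H))$, and $\alpha_s(\vec H)$ is the number of sources of $\vec H/\!\sim$. *)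

theory Defs
  imports Complex_Main "HOL-Library.Log_Nat" "Graph_Theory.Digraph_Isomorphism"
begin

section \<open>Digraphs\<close>

text \<open>
  Finite digraphs without multiple arcs, with loops and antiparallel arcs allowed, are the
  digraphs satisfying \<^locale>\<open>pair_fin_digraph\<close>.
\<close>

definition max_outdegree :: "'a pair_pre_digraph \<Rightarrow> nat" where
  "max_outdegree G = Max (insert 0 (out_degree (with_proj G) ` pverts G))"

text \<open>
  Vertices are numbered \<open>0, \<dots>, n - 1\<close>.  An adjacency-list encoding is the list consisting of \<open>n\<close>
  and, for each vertex in turn, its outdegree followed by its outneighbours in any order.
  Its length is one plus the number of vertices plus the number of arcs.
\<close>

definition adjacency_encoding :: "nat pair_pre_digraph \<Rightarrow> nat list \<Rightarrow> bool" where
  "adjacency_encoding G xs \<longleftrightarrow> pair_fin_digraph G \<and>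
    (\<exists>n ns. pverts G = {..<n} \<and> length ns = n \<and>
      (\<forall>v<n. distinct (ns ! v) \<and> set (ns ! v) = {w. (v, w) \<in> parcs G}) \<and>
      xs = n # concat (map (\<lambda>l. length l # l) ns))"

definition subgraph_copies :: "'a pair_pre_digraph \<Rightarrow> 'b pair_pre_digraph \<Rightarrow> 'b pair_pre_digraph set" where
  "subgraph_copies H G =
    {K. subgraph (with_proj K) (with_proj G) \<and> digraph_iso (with_proj K) (with_proj H)}"

definition induced_copies :: "'a pair_pre_digraph \<Rightarrow> 'b pair_pre_digraph \<Rightarrow> 'b set set" where
  "induced_copies H G = {S. S \<subseteq> pverts G \<and> digraph_iso (with_proj G \<restriction> S) (with_proj H)}"

text \<open>The DAG obtained by contracting each strongly connected component and deleting loops.\<close>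

definition condensation :: "'a pair_pre_digraph \<Rightarrow> 'a set pair_pre_digraph" where
  "condensation H =
    \<lparr> pverts = pre_digraph.sccs_verts (with_proj H),
      parcs = {(S, T). S \<in> pre_digraph.sccs_verts (with_proj H) \<and>
                       T \<in> pre_digraph.sccs_verts (with_proj H) \<and> S \<noteq> T \<and>
                       (\<exists>u\<in>S. \<exists>v\<in>T. (u, v) \<in> parcs H)} \<rparr>"

definition sources :: "'a pair_pre_digraph \<Rightarrow> 'a set set" where
  "sources H = {S \<in> pverts (condensation H). in_degree (with_proj (condensation H)) S = 0}"

definition alpha_s :: "'a pair_pre_digraph \<Rightarrow> nat" where
  "alpha_s H = card (sources H)"


section \<open>Reachability hypergraph, contour, fractional covers\<close>

type_synonym 'a hypergraph = "'a set \<times> 'a set set"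

definition reachable_from :: "'a pair_pre_digraph \<Rightarrow> 'a \<Rightarrow> 'a set" where
  "reachable_from H v = {w. v \<rightarrow>\<^sup>*\<^bsub>with_proj H\<^esub> w}"

definition reachability_hypergraph :: "'a pair_pre_digraph \<Rightarrow> 'a hypergraph" where
  "reachability_hypergraph H =
    (pverts H, (\<lambda>S. reachable_from H (SOME s. s \<in> S)) ` sources H)"

definition delete_vertices :: "'a set \<Rightarrow> 'a hypergraph \<Rightarrow> 'a hypergraph" where
  "delete_vertices U = (\<lambda>(V, E). (V - U, (\<lambda>e. e - U) ` E))"

definition contour :: "'a pair_pre_digraph \<Rightarrow> 'a hypergraph" where
  "contour H = delete_vertices (\<Union>S\<in>sources H. S) (reachability_hypergraph H)"

definition fractional_cover :: "'a hypergraph \<Rightarrow> ('a set \<Rightarrow> real) \<Rightarrow> bool" where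
  "fractional_cover = (\<lambda>(V, E) \<gamma>.
    (\<forall>e\<in>E. 0 \<le> \<gamma> e) \<and> (\<forall>v\<in>V. 1 \<le> (\<Sum>e | e \<in> E \<and> v \<in> e. \<gamma> e)))"

text \<open>
  For a finite hypergraph without isolated vertices, such as a contour, the feasible region is a
  nonempty polyhedron and the weight is bounded below on it, so this infimum is a minimum.
\<close>

definition fractional_cover_number :: "'a hypergraph \<Rightarrow> real" where
  "fractional_cover_number X = Inf {\<Sum>e\<in>snd X. \<gamma> e | \<gamma>. fractional_cover X \<gamma>}"

definition rho_star :: "'a pair_pre_digraph \<Rightarrow> real" where
  "rho_star H = fractional_cover_number (contour H)"


section \<open>Model of computation\<close>

text \<open>
  A random access machine over the natural numbers with the logarithmic cost criterion, programmed
  in structured form.  Memory consists of arrays \<open>0, 1, \<dots>\<close>, each unbounded; a program mentions only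
  finitely many of them, so they can be interleaved in the single memory of a conventional RAM at
  the cost of a constant factor.  A scalar variable is an array used only at index \<open>0\<close>.
  Multiplication and division are charged the product of the operand lengths (schoolbook method),
  so that the unit of cost corresponds to a bit operation; all other operations and
  memory accesses are charged the lengths of the numbers (addresses included) involved.
\<close>

type_synonym memory = "nat \<Rightarrow> nat \<Rightarrow> nat"

datatype exp =
    Const nat
  | Cell nat exp
  | Plus exp exp
  | Minus exp exp
  | Times exp exp
  | Div exp exp

datatype com =
    Skip
  | Store nat exp exp
  | Seq com com
  | Cond exp com com
  | While exp com

text \<open>The bit length, increased by one so that it is positive also for \<open>0\<close>.\<close>

definition len :: "nat \<Rightarrow> nat" where
  "len n = floorlog 2 n + 1"

primrec val :: "exp \<Rightarrow> memory \<Rightarrow> nat" where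
  "val (Const n) m = n"
| "val (Cell a i) m = m a (val i m)"
| "val (Plus x y) m = val x m + val y m"
| "val (Minus x y) m = val x m - val y m"
| "val (Times x y) m = val x m * val y m"
| "val (Div x y) m = val x m div val y m"

primrec cost :: "exp \<Rightarrow> memory \<Rightarrow> nat" where
  "cost (Const n) m = len n"
| "cost (Cell a i) m = cost i m + len (val i m) + len (m a (val i m))"
| "cost (Plus x y) m = cost x m + cost y m + len (val x m) + len (val y m)"
| "cost (Minus x y) m = cost x m + cost y m + len (val x m) + len (val y m)"
| "cost (Times x y) m = cost x m + cost y m + len (val x m) * len (val y m)"
| "cost (Div x y) m = cost x m + cost y m + len (val x m) * len (val y m)"

text \<open>
  \<open>exec c m t m'\<close>: started in memory \<open>m\<close>, the program \<open>c\<close> halts with cost \<open>t\<close> in memory \<open>m'\<close>.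
  A guard holds iff its value is nonzero.
\<close>

inductive exec :: "com \<Rightarrow> memory \<Rightarrow> nat \<Rightarrow> memory \<Rightarrow> bool" where
  Skip: "exec Skip m 1 m"
| Store: "exec (Store a i x) m
    (cost i m + cost x m + len (val i m) + len (val x m))
    (m(a := (m a)(val i m := val x m)))"
| Seq: "exec c m t m' \<Longrightarrow> exec d m' u m'' \<Longrightarrow> exec (Seq c d) m (t + u) m''"
| Cond_True: "val b m \<noteq> 0 \<Longrightarrow> exec c m t m' \<Longrightarrow>
    exec (Cond b c d) m (cost b m + len (val b m) + t) m'"
| Cond_False: "val b m = 0 \<Longrightarrow> exec d m t m' \<Longrightarrow>
    exec (Cond b c d) m (cost b m + len (val b m) + t) m'"
| While_False: "val b m = 0 \<Longrightarrow> exec (While b c) m (cost b m + len (val b m)) m"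
| While_True: "val b m \<noteq> 0 \<Longrightarrow> exec c m t m' \<Longrightarrow> exec (While b c) m' u m'' \<Longrightarrow>
    exec (While b c) m (cost b m + len (val b m) + t + u) m''"

lemma exec_deterministic:
  assumes "exec c m t m'" "exec c m u m''"
  shows "u = t \<and> m'' = m'"
  using assms
proof (induction arbitrary: u m'' rule: exec.induct)
  case (Skip m)
  from Skip.prems show ?case by cases simp_all
next
  case (Store a i x m)
  from Store.prems show ?case by cases simp_all
next
  case (Seq c m t m' d v m2)
  from Seq.prems show ?case
  proof cases
    case *: (Seq t' n u')
    have "t' = t \<and> n = m'" by (rule Seq.IH(1)) (rule *)
    moreover from this * have "u' = v \<and> m'' = m2" by (intro Seq.IH(2)) simp
    ultimately show ?thesis using * by simp
  qed
next
  case (Cond_True b m c t m' d)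
  from Cond_True.prems show ?case
  proof cases
    case *: (Cond_True t')
    have "t' = t \<and> m'' = m'" by (rule Cond_True.IH) (rule *)
    with * show ?thesis by simp
  next
    case *: (Cond_False t')
    with * Cond_True.hyps(1) show ?thesis by simp
  qed
next
  case (Cond_False b m d t m' c)
  from Cond_False.prems show ?case
  proof cases
    case *: (Cond_True t')
    with * Cond_False.hyps(1) show ?thesis by simp
  next
    case *: (Cond_False t')
    have "t' = t \<and> m'' = m'" by (rule Cond_False.IH) (rule *)
    with * show ?thesis by simp
  qed
next
  case (While_False b m c)
  from While_False.prems show ?case
  proof cases
    case *: While_False
    then show ?thesis by simp
  next
    case *: (While_True t' n u')
    with While_False.hyps show ?thesis by simp
  qed
next
  case (While_True b m c t m' v m2)
  from While_True.prems show ?case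
  proof cases
    case *: While_False
    with While_True.hyps(1) show ?thesis by simp
  next
    case *: (While_True t' n u')
    have "t' = t \<and> n = m'" by (rule While_True.IH(1)) (rule *)
    moreover from this * have "u' = v \<and> m'' = m2" by (intro While_True.IH(2)) simp
    ultimately show ?thesis using * by simp
  qed
qed

text \<open>The \<open>i\<close>-th input list is stored in array \<open>i\<close>; the result is read from index \<open>0\<close> of array \<open>0\<close>.\<close>

definition input_memory :: "nat list list \<Rightarrow> memory" where
  "input_memory xss = (\<lambda>a i. if a < length xss \<and> i < length (xss ! a) then xss ! a ! i else 0)"

definition computes :: "com \<Rightarrow> nat list list \<Rightarrow> nat \<Rightarrow> bool" where
  "computes p xss y \<longleftrightarrow> (\<exists>t m. exec p (input_memory xss) t m \<and> m 0 0 = y)"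

definition computes_in_time :: "com \<Rightarrow> nat list list \<Rightarrow> nat \<Rightarrow> real \<Rightarrow> bool" where
  "computes_in_time p xss y T \<longleftrightarrow>
    (\<exists>t m. exec p (input_memory xss) t m \<and> m 0 0 = y \<and> real t \<le> T)"

definition computable2 :: "(nat \<Rightarrow> nat \<Rightarrow> nat) \<Rightarrow> bool" where
  "computable2 f \<longleftrightarrow> (\<exists>p. \<forall>a b. computes p [[a], [b]] (f a b))"

end

theory Submission
  imports Defs "HOL-Library.FuncSet" "HOL-Library.Disjoint_Sets"
begin

text \<open>
  Let \<open>C\<close> be the set of vertices of \<open>H\<close> outside the source components.  A homomorphism maps every
  vertex reachable from \<open>s\<close> into the ball of bounded radius around the image of \<open>s\<close>, and such a ball has
  bounded size.  So the partial maps on \<open>C\<close> that send each \<open>C \<inter> R(s)\<close> into a single ball, and all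
  their restrictions to initial segments of \<open>C\<close>, number at most \<open>(n b)^\<rho>\<close> for every
  fractional cover of the contour of weight \<open>\<rho>\<close>, by the inequality of Friedgut and Kahn.  Coding maps
  by numbers in base \<open>n\<close> and skipping every block of codes with a bad prefix, one visits about
  that many codes, with no need to know the cover.

  For a fixed map on \<open>C\<close>, the injective extensions to the source components are counted by
  inclusion-exclusion over the sets of pairs that are forced to be equal.  Each such set glues source
  components together; a glued component has at most \<open>n\<close> times a bounded number of images, and the numbers of
  images of different components multiply.  Dividing by the number of automorphisms turns embeddings into copies.
  For induced copies the same search is run with \<open>C\<close> the set of all vertices, covered by the sets
  \<open>R(s)\<close> with weight 1.

  The numbers involved are nested sums, products and iterations whose lengths are polynomial in
  \<open>n\<close> times a function of the parameters.  Such expressions are closed under composition, and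
  each of them has a program whose running time is polynomial in that quantity.
\<close>

section \<open>Computing with polynomial resources\<close>

text \<open>Enumerating the images of the source components would cost a factor n for each of them,
  hence n to the power of their number, which can exceed n to the power \<open>rho_star\<close>. No
  arc enters a source component from outside, so once the map on \<open>C\<close> is fixed,
  different source components interact through injectivity alone. Inclusion-exclusion trades this
  one coupling for a number of terms that depends on H only. In the induced case the required
  non-arcs couple all components as well, and the search pays for it with the exponent
  \<open>alpha_s\<close>. The radius of the balls is h * h, with h the number of vertices of H: a
  relation on h vertices has at most that many pairs, so its closure is reached after that many
  steps. Only the outermost loop may run more than polynomially often. It is therefore kept apart
  from the expressions, and its program never refers to the number of rounds.\<close>

lemma len_le: "v \<le> 2 ^ k \<Longrightarrow> len v \<le> k + 2"
  using floorlog_mono[of v "2 ^ k" 2] floorlog_power[of 1 2 k] by (simp add: len_def floorlog_def)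

text \<open>A total-correctness triple with cost bound \<open>T\<close>; by
  \<open>exec_deterministic\<close> the run it provides is the only one.\<close>

definition runs :: "com \<Rightarrow> memory \<Rightarrow> nat \<Rightarrow> (memory \<Rightarrow> bool) \<Rightarrow> bool" where
  "runs p m T P \<longleftrightarrow> (\<exists>t m'. exec p m t m' \<and> t \<le> T \<and> P m')"

lemma runs_mono: "runs p m T P \<Longrightarrow> T \<le> T' \<Longrightarrow> (\<And>m'. P m' \<Longrightarrow> Q m') \<Longrightarrow> runs p m T' Q"
  unfolding runs_def by (meson le_trans)

lemma runs_Seq:
  assumes "runs c m T P" "\<And>m'. P m' \<Longrightarrow> runs d m' T' Q" "T + T' \<le> T''"
  shows "runs (Seq c d) m T'' Q"
proof -
  obtain t m' where 1: "exec c m t m'" "t \<le> T" "P m'" using assms(1) by (auto simp: runs_def)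
  obtain t' m'' where 2: "exec d m' t' m''" "t' \<le> T'" "Q m''"
    using assms(2)[OF 1(3)] by (auto simp: runs_def)
  have "exec (Seq c d) m (t + t') m''" by (rule exec.Seq[OF 1(1) 2(1)])
  then show ?thesis unfolding runs_def using 1 2 assms(3)
    by (intro exI[of _ "t + t'"] exI[of _ m'']) auto
qed

lemma runs_Store:
  assumes "cost i m + cost x m + len (val i m) + len (val x m) \<le> T"
    and "P (m(a := (m a)(val i m := val x m)))"
  shows "runs (Store a i x) m T P"
  unfolding runs_def using exec.Store assms by blast

text \<open>Indexing the invariant by the number of completed rounds makes that number exact, in
  place of a decreasing variant. The final failing test of the guard accounts for the
  \<open>+ 1\<close>.\<close>

lemma runs_While:
  assumes "\<And>i m. i < k \<Longrightarrow> Inv i m \<Longrightarrow> val b m \<noteq> 0 \<and> runs c m T (Inv (Suc i))"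
    and "\<And>i m. i \<le> k \<Longrightarrow> Inv i m \<Longrightarrow> cost b m + len (val b m) \<le> G"
    and "\<And>m. Inv k m \<Longrightarrow> val b m = 0"
    and "Inv i m" "i \<le> k"
  shows "runs (While b c) m ((k - i + 1) * (G + T)) (Inv k)"
  using assms(4,5)
proof (induction "k - i" arbitrary: i m)
  case 0
  then have i: "i = k" by simp
  have "exec (While b c) m (cost b m + len (val b m)) m"
    using 0 assms(3) i by (intro exec.While_False) simp
  moreover have "cost b m + len (val b m) \<le> G" using 0 assms(2)[of i m] by simp
  ultimately show ?case unfolding runs_def using 0 i by (intro exI conjI) (assumption | simp)+
next
  case (Suc d)
  then have i: "i < k" by simp
  obtain t m' where 1: "exec c m t m'" "t \<le> T" "Inv (Suc i) m'"
    using assms(1)[OF i Suc.prems(1)] by (auto simp: runs_def)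
  have "runs (While b c) m' ((k - Suc i + 1) * (G + T)) (Inv k)"
    using Suc i 1 by (intro Suc.hyps) auto
  then obtain u m'' where 2: "exec (While b c) m' u m''" "u \<le> (k - Suc i + 1) * (G + T)" "Inv k m''"
    by (auto simp: runs_def)
  have "exec (While b c) m (cost b m + len (val b m) + t + u) m''"
    using assms(1)[OF i Suc.prems(1)] 1 2 by (intro exec.While_True) auto
  moreover have "cost b m + len (val b m) \<le> G" using Suc.prems assms(2)[of i m] by simp
  moreover have "k - i + 1 = Suc (k - Suc i + 1)" using i by simp
  ultimately show ?case unfolding runs_def using 1 2
    by (intro exI[of _ "cost b m + len (val b m) + t + u"] exI[of _ m'']) auto
qed

section \<open>Absorbing constants into powers of X\<close>

lemma le_power_self: "2 \<le> X \<Longrightarrow> c \<le> (X::nat) ^ c"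
  by (meson le_trans less_exp less_imp_le power_mono zero_le)

text \<open>One extra factor X absorbs the factor 2. Costs can thus be stated as pure powers of X,
  and no coefficients have to be tracked.\<close>

lemma poly_add:
  assumes "2 \<le> X" "p \<le> X ^ a" "q \<le> X ^ b"
  shows "p + q \<le> (X::nat) ^ (a + b + 1)"
proof -
  have "X ^ a \<le> X ^ (a + b)" "X ^ b \<le> X ^ (a + b)" using assms(1) by (auto intro: power_increasing)
  then have "p + q \<le> 2 * X ^ (a + b)" using assms by linarith
  also have "\<dots> \<le> X * X ^ (a + b)" using assms(1) by (intro mult_right_mono) auto
  finally show ?thesis by simp
qed

lemma poly_mult:
  "p \<le> X ^ a \<Longrightarrow> q \<le> X ^ b \<Longrightarrow> p * q \<le> (X::nat) ^ (a + b)"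
  by (simp add: power_add mult_mono)

lemma poly_pow2: "2 \<le> X \<Longrightarrow> p \<le> X ^ a \<Longrightarrow> p \<le> 2 ^ (X ^ a)" for p X :: nat
  by (meson le_trans less_exp less_imp_le)

lemma runs_copy:
  assumes "2 \<le> X" "m a 0 \<le> 2 ^ (X ^ E)" "P (m(b := (m b)(0 := m a 0)))"
  shows "runs (Store b (Const 0) (Cell a (Const 0))) m (X ^ (E + 4)) P"
proof (rule runs_Store)
  have "len (m a 0) \<le> X ^ E + 2" using assms(2) by (rule len_le)
  moreover have "1 \<le> X ^ E" using assms(1) by simp
  \<comment> \<open>Four lengths of 0 and two of the moved value cost at most
    \<open>8 + 2 * X ^ E\<close>, which is at most \<open>16 * X ^ E\<close>; and 16 is at most
    \<open>X ^ 4\<close>.\<close>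
  ultimately have "4 + len (m a 0) * 2 \<le> 16 * X ^ E" by linarith
  also have "\<dots> \<le> X ^ 4 * X ^ E" using power_mono[OF assms(1), of 4] by (intro mult_right_mono) auto
  finally show "cost (Const 0) m + cost (Cell a (Const 0)) m + len (val (Const 0) m) + len (val (Cell a (Const 0)) m) \<le> X ^ (E + 4)"
    by (simp add: len_def floorlog_def power_add mult.commute)
qed (use assms(3) in simp)

text \<open>\<open>V I X\<close> says that X is an admissible size for the input I. It stays
  abstract because the same closure properties are used twice: for the counting programs, where X is
  the length of the encoding of G times a function of the parameters, and for the computability of
  that function.\<close>

locale ram =
  fixes V :: "nat list list \<Rightarrow> nat \<Rightarrow> bool"
  assumes V_ge2: "V I X \<Longrightarrow> 2 \<le> X"
    and V_input: "V I X \<Longrightarrow> input_memory I a i \<le> X"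
begin

definition bnd :: "(nat list list \<Rightarrow> nat list \<Rightarrow> nat) \<Rightarrow> bool" where
  "bnd f \<longleftrightarrow> (\<forall>j. \<exists>D. \<forall>I X s. V I X \<longrightarrow> (\<forall>v\<in>set s. v \<le> 2 ^ (X ^ j)) \<longrightarrow> f I s \<le> 2 ^ (X ^ D))"

text \<open>The bound must hold for every environment s. Entries of s may be as large as
  \<open>2 ^ (X ^ j)\<close>, so an iteration count bounded only in terms of them could be
  exponential.\<close>

definition loopb :: "(nat list list \<Rightarrow> nat list \<Rightarrow> nat) \<Rightarrow> bool" where
  "loopb k \<longleftrightarrow> (\<exists>c. \<forall>I X s. V I X \<longrightarrow> k I s \<le> X ^ c)"

definition inp :: "nat list list \<Rightarrow> memory \<Rightarrow> bool" where
  "inp I m \<longleftrightarrow> (\<forall>a<2. m a = input_memory I a)"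

text \<open>
  The environment \<open>s\<close> of \<open>f\<close> is held at index 0 of the arrays \<open>locs\<close>, most recent variable first.
  The program leaves the value in array \<open>r\<close> and may overwrite only the arrays from \<open>r\<close> on, so that programs
  nest like a stack.  \<open>X\<close> is the quantity in which all running times and bit lengths are polynomial.
\<close>

definition cpt :: "(nat list list \<Rightarrow> nat list \<Rightarrow> nat) \<Rightarrow> nat list \<Rightarrow> nat \<Rightarrow> nat \<Rightarrow> com \<Rightarrow> nat \<Rightarrow> bool" where
  "cpt f locs r j p D \<longleftrightarrow> (\<forall>I X m. V I X \<longrightarrow> inp I m \<longrightarrow> (\<forall>a\<in>set locs. m a 0 \<le> 2 ^ (X ^ j)) \<longrightarrow>
     runs p m (X ^ D) (\<lambda>m'. m' r 0 = f I (map (\<lambda>a. m a 0) locs) \<and> (\<forall>a<r. m' a = m a)))"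

text \<open>The program and the exponent are chosen before the input, but may depend on the exponent
  j that bounds the environment. \<open>bnd\<close> is what makes composition possible: a computed
  value becomes an environment entry of the next program, with a new exponent in place of j.\<close>

definition impl :: "(nat list list \<Rightarrow> nat list \<Rightarrow> nat) \<Rightarrow> bool" where
  "impl f \<longleftrightarrow> bnd f \<and> (\<forall>locs r j. 2 \<le> r \<longrightarrow> (\<forall>a\<in>set locs. a < r) \<longrightarrow> (\<exists>p D. cpt f locs r j p D))"

lemma bndE:
  assumes "bnd f"
  obtains D where "\<And>I X s. V I X \<Longrightarrow> (\<And>v. v \<in> set s \<Longrightarrow> v \<le> 2 ^ (X ^ j)) \<Longrightarrow> f I s \<le> 2 ^ (X ^ D)"
  using assms unfolding bnd_def by metis

lemma bndI:
  assumes "\<And>j. \<exists>D. \<forall>I X s. V I X \<longrightarrow> (\<forall>v\<in>set s. v \<le> 2 ^ (X ^ j)) \<longrightarrow> f I s \<le> 2 ^ (X ^ D)"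
  shows "bnd f"
  using assms by (auto simp: bnd_def)

lemma pow2_exp_mono:
  assumes "V I X" "a \<le> b" "v \<le> 2 ^ (X ^ a)" shows "v \<le> (2::nat) ^ (X ^ b)"
proof -
  have "X ^ a \<le> X ^ b" using V_ge2[OF assms(1)] assms(2) by (intro power_increasing) auto
  then have "(2::nat) ^ (X ^ a) \<le> 2 ^ (X ^ b)" by (rule power_increasing) auto
  then show ?thesis using assms(3) by linarith
qed

lemma implI:
  assumes "bnd f"
    and "\<And>locs r j. 2 \<le> r \<Longrightarrow> (\<And>a. a \<in> set locs \<Longrightarrow> a < r) \<Longrightarrow> \<exists>p D. cpt f locs r j p D"
  shows "impl f"
  using assms by (auto simp: impl_def)

lemma implE:
  assumes "impl f" "2 \<le> r" "\<And>a. a \<in> set locs \<Longrightarrow> a < r"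
  obtains p D where "cpt f locs r j p D"
  using assms unfolding impl_def by metis

lemma impl_bnd: "impl f \<Longrightarrow> bnd f"
  by (simp add: impl_def)

lemma cptD:
  "cpt f locs r j p D \<Longrightarrow> V I X \<Longrightarrow> inp I m \<Longrightarrow> (\<And>a. a \<in> set locs \<Longrightarrow> m a 0 \<le> 2 ^ (X ^ j)) \<Longrightarrow>
     runs p m (X ^ D) (\<lambda>m'. m' r 0 = f I (map (\<lambda>a. m a 0) locs) \<and> (\<forall>a<r. m' a = m a))"
  by (auto simp: cpt_def)

lemma inp_cong: "inp I m \<Longrightarrow> 2 \<le> r \<Longrightarrow> \<forall>a<r. m' a = m a \<Longrightarrow> inp I m'"
  by (auto simp: inp_def)

lemma impl_const: "impl (\<lambda>I s. c)"
proof (rule implI)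
  show "bnd (\<lambda>I s. c)"
  proof (rule bndI, intro exI[of _ c] allI impI)
    fix I X assume "V I X"
    then show "c \<le> 2 ^ X ^ c" by (intro poly_pow2 le_power_self V_ge2)
  qed
next
  fix locs :: "nat list" and r j :: nat
  have "runs (Store r (Const 0) (Const c)) m (X ^ (2 * len c + 2)) (\<lambda>m'. m' r 0 = c \<and> (\<forall>a<r. m' a = m a))"
    if "V I X" for I X m
  proof (rule runs_Store)
    show "cost (Const 0) m + cost (Const c) m + len (val (Const 0) m) + len (val (Const c) m) \<le> X ^ (2 * len c + 2)"
      using le_power_self[OF V_ge2[OF that], of "2 * len c + 2"] by (simp add: len_def floorlog_def)
  qed auto
  then show "\<exists>p D. cpt (\<lambda>I s. c) locs r j p D" unfolding cpt_def by blast
qed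

text \<open>The environment is a stack of variables. An expression that ignores the innermost one
  keeps the program compiled for \<open>tl locs\<close>, since variables are found by
  address.\<close>

lemma impl_weaken:
  assumes "impl f" shows "impl (\<lambda>I s. f I (tl s))"
proof (rule implI)
  show "bnd (\<lambda>I s. f I (tl s))"
  proof (rule bndI)
    fix j
    obtain D where "\<And>I X s. V I X \<Longrightarrow> (\<And>v. v \<in> set s \<Longrightarrow> v \<le> 2 ^ (X ^ j)) \<Longrightarrow> f I s \<le> 2 ^ (X ^ D)"
      by (rule bndE[OF impl_bnd[OF assms]]) blast
    then show "\<exists>D. \<forall>I X s. V I X \<longrightarrow> (\<forall>v\<in>set s. v \<le> 2 ^ X ^ j) \<longrightarrow> f I (tl s) \<le> 2 ^ X ^ D"
      by (metis list.sel(2) list.set_sel(2))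
  qed
next
  fix locs :: "nat list" and r j :: nat
  assume "2 \<le> r" "\<And>a. a \<in> set locs \<Longrightarrow> a < r"
  moreover have "a \<in> set (tl locs) \<Longrightarrow> a \<in> set locs" for a by (cases locs) auto
  ultimately obtain p D where "cpt f (tl locs) r j p D" using implE[OF assms, of r "tl locs"] by metis
  moreover have "map (\<lambda>a. m a 0) (tl locs) = tl (map (\<lambda>a. m a 0) locs)" for m :: memory
    by (cases locs) auto
  ultimately have "cpt (\<lambda>I s. f I (tl s)) locs r j p D"
    using \<open>\<And>a. a \<in> set (tl locs) \<Longrightarrow> a \<in> set locs\<close> by (auto simp: cpt_def)
  then show "\<exists>p D. cpt (\<lambda>I s. f I (tl s)) locs r j p D" by blast
qed

text \<open>In the empty environment \<open>hd []\<close> is an unspecified but fixed number, hence a constant.\<close>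

lemma impl_hd: "impl (\<lambda>I s. hd s)"
proof (rule implI)
  show "bnd (\<lambda>I s. hd s)"
  proof (rule bndI, intro exI allI impI)
    fix j I X and s :: "nat list"
    assume V: "V I X" and s: "\<forall>v\<in>set s. v \<le> 2 ^ X ^ j"
    show "hd s \<le> 2 ^ X ^ (max j (hd []))"
    proof (cases s)
      case Nil
      have "(hd [] :: nat) \<le> 2 ^ X ^ (hd [])"
        by (rule poly_pow2[OF V_ge2[OF V] le_power_self[OF V_ge2[OF V]]])
      then show ?thesis using pow2_exp_mono[OF V max.cobounded2] Nil by simp
    next
      case (Cons a l)
      then show ?thesis using pow2_exp_mono[OF V max.cobounded1] s by simp
    qed
  qed
next
  fix locs :: "nat list" and r j :: nat
  assume r: "2 \<le> r" and locs: "\<And>a. a \<in> set locs \<Longrightarrow> a < r"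
  show "\<exists>p D. cpt (\<lambda>I s. hd s) locs r j p D"
  proof (cases locs)
    case Nil
    obtain p D where "cpt (\<lambda>I s. hd []) locs r j p D" using implE[OF impl_const r] locs by blast
    then show ?thesis unfolding cpt_def Nil by auto
  next
    case (Cons a l)
    have "runs (Store r (Const 0) (Cell a (Const 0))) m (X ^ (j + 4)) (\<lambda>m'. m' r 0 = m a 0 \<and> (\<forall>a<r. m' a = m a))"
      if "V I X" "m a 0 \<le> 2 ^ (X ^ j)" for I X m
      by (rule runs_copy[where E = j, OF V_ge2[OF that(1)]]) (use that(2) in auto)
    then have "cpt (\<lambda>I s. hd s) locs r j (Store r (Const 0) (Cell a (Const 0))) (j + 4)"
      unfolding cpt_def Cons by simp
    then show ?thesis by blast
  qed
qed

text \<open>The four operations share the majorant x + y + x * y, which is (x + 1) * (y + 1) - 1,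
  and the sum of the linear and the quadratic charge. One proof then serves all of them.\<close>

lemma impl_op:
  assumes val: "\<And>x y m. val (opr x y) m = F (val x m) (val y m)"
    and cost: "\<And>x y m. cost (opr x y) m \<le> cost x m + cost y m + (len (val x m) + len (val y m)) + len (val x m) * len (val y m)"
    and F: "\<And>x y. F x y \<le> x + y + x * y"
    and f: "impl f" and g: "impl g"
  shows "impl (\<lambda>I s. F (f I s) (g I s))"
proof -
  have F2: "F x y \<le> 2 ^ (X ^ (a + b + 2))" if "V I X" "x \<le> 2 ^ (X ^ a)" "y \<le> 2 ^ (X ^ b)" for I X x y a b
  proof -
    have X: "2 \<le> X" by (rule V_ge2[OF that(1)])
    have "x + y + x * y + 1 = (x + 1) * (y + 1)" by simp
    also have "\<dots> \<le> (2 * 2 ^ (X ^ a)) * (2 * 2 ^ (X ^ b))"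
    proof (rule mult_mono)
      show "x + 1 \<le> 2 * 2 ^ X ^ a" using that(2) one_le_power[of "2::nat" "X ^ a"] by linarith
      show "y + 1 \<le> 2 * 2 ^ X ^ b" using that(3) one_le_power[of "2::nat" "X ^ b"] by linarith
    qed auto
    also have "\<dots> = 2 ^ (X ^ a + X ^ b + 2)" by (simp add: power_add)
    also have "\<dots> \<le> 2 ^ (X ^ (a + b + 2))"
    proof (rule power_increasing)
      have 1: "X ^ a + X ^ b \<le> X ^ (a + b + 1)" by (intro poly_add X) auto
      have "2 \<le> X ^ 1" using X by simp
      moreover have "X ^ 1 \<le> X ^ (a + b + 1)" using X by (intro power_increasing) auto
      ultimately have "2 \<le> X ^ (a + b + 1)" by linarith
      then have "X ^ a + X ^ b + 2 \<le> 2 * X ^ (a + b + 1)" using 1 by linarith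
      also have "\<dots> \<le> X * X ^ (a + b + 1)" using X by (intro mult_right_mono) auto
      finally show "X ^ a + X ^ b + 2 \<le> X ^ (a + b + 2)" by simp
    qed auto
    finally show ?thesis using F[of x y] by linarith
  qed
  have "bnd (\<lambda>I s. F (f I s) (g I s))"
  proof (rule bndI)
    fix j
    obtain D where D: "\<And>I X s. V I X \<Longrightarrow> (\<And>v. v \<in> set s \<Longrightarrow> v \<le> 2 ^ (X ^ j)) \<Longrightarrow> f I s \<le> 2 ^ (X ^ D)"
      by (rule bndE[OF impl_bnd[OF f]]) blast
    obtain D' where D': "\<And>I X s. V I X \<Longrightarrow> (\<And>v. v \<in> set s \<Longrightarrow> v \<le> 2 ^ (X ^ j)) \<Longrightarrow> g I s \<le> 2 ^ (X ^ D')"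
      by (rule bndE[OF impl_bnd[OF g]]) blast
    have "\<forall>I X s. V I X \<longrightarrow> (\<forall>v\<in>set s. v \<le> 2 ^ X ^ j) \<longrightarrow> F (f I s) (g I s) \<le> 2 ^ X ^ (D + D' + 2)"
      by (intro allI impI F2 D D') auto
    then show "\<exists>D. \<forall>I X s. V I X \<longrightarrow> (\<forall>v\<in>set s. v \<le> 2 ^ X ^ j) \<longrightarrow> F (f I s) (g I s) \<le> 2 ^ X ^ D"
      by blast
  qed
  moreover have "\<exists>p D. cpt (\<lambda>I s. F (f I s) (g I s)) locs r j p D"
    if r: "2 \<le> r" and locs: "\<And>a. a \<in> set locs \<Longrightarrow> a < r" for locs :: "nat list" and r j :: nat
  proof -
  obtain p Dp where p: "cpt f locs r j p Dp" by (rule implE[OF f r locs])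
  obtain q Dq where q: "cpt g locs (Suc r) j q Dq"
    by (rule implE[OF g, of "Suc r" locs]) (use r in \<open>auto dest!: locs\<close>)
  obtain D where D: "\<And>I X s. V I X \<Longrightarrow> (\<And>v. v \<in> set s \<Longrightarrow> v \<le> 2 ^ (X ^ j)) \<Longrightarrow> f I s \<le> 2 ^ (X ^ D)"
    by (rule bndE[OF impl_bnd[OF f]]) blast
  obtain D' where D': "\<And>I X s. V I X \<Longrightarrow> (\<And>v. v \<in> set s \<Longrightarrow> v \<le> 2 ^ (X ^ j)) \<Longrightarrow> g I s \<le> 2 ^ (X ^ D')"
    by (rule bndE[OF impl_bnd[OF g]]) blast
  define E where "E = D + D' + 2"
  define C where "C = Seq p (Seq q (Store r (Const 0) (opr (Cell r (Const 0)) (Cell (Suc r) (Const 0)))))"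
  have "cpt (\<lambda>I s. F (f I s) (g I s)) locs r j C (Dp + (Dq + (2 * E + 6) + 1) + 1)"
    unfolding cpt_def
  proof (intro allI impI)
    fix I X and m :: memory
    assume V: "V I X" and inp: "inp I m" and m: "\<forall>a\<in>set locs. m a 0 \<le> 2 ^ X ^ j"
    let ?s = "map (\<lambda>a. m a 0) locs"
    have X: "2 \<le> X" by (rule V_ge2[OF V])
    show "runs C m (X ^ (Dp + (Dq + (2 * E + 6) + 1) + 1)) (\<lambda>m'. m' r 0 = F (f I ?s) (g I ?s) \<and> (\<forall>a<r. m' a = m a))"
      unfolding C_def
    proof (rule runs_Seq[OF cptD[OF p V inp]])
      show "m a 0 \<le> 2 ^ X ^ j" if "a \<in> set locs" for a using m that by auto
      show "X ^ Dp + X ^ (Dq + (2 * E + 6) + 1) \<le> X ^ (Dp + (Dq + (2 * E + 6) + 1) + 1)"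
        by (rule poly_add[OF X]) auto
      fix m1 assume m1: "m1 r 0 = f I ?s \<and> (\<forall>a<r. m1 a = m a)"
      have s1: "map (\<lambda>a. m1 a 0) locs = ?s" using m1 locs by auto
      show "runs (Seq q (Store r (Const 0) (opr (Cell r (Const 0)) (Cell (Suc r) (Const 0))))) m1 (X ^ (Dq + (2 * E + 6) + 1))
          (\<lambda>m'. m' r 0 = F (f I ?s) (g I ?s) \<and> (\<forall>a<r. m' a = m a))"
      proof (rule runs_Seq[OF cptD[OF q V]])
        show "inp I m1" using inp_cong[OF inp r] m1 by blast
        show "m1 a 0 \<le> 2 ^ X ^ j" if "a \<in> set locs" for a using m m1 locs that by auto
        show "X ^ Dq + X ^ (2 * E + 6) \<le> X ^ (Dq + (2 * E + 6) + 1)"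
          by (rule poly_add[OF X]) auto
        fix m2 assume "m2 (Suc r) 0 = g I (map (\<lambda>a. m1 a 0) locs) \<and> (\<forall>a<Suc r. m2 a = m1 a)"
        then have m2: "m2 (Suc r) 0 = g I ?s" "m2 r 0 = f I ?s" "\<forall>a<r. m2 a = m a"
          using m1 s1 by auto
        let ?x = "f I ?s" and ?y = "g I ?s"
        have b: "?x \<le> 2 ^ (X ^ D)" "?y \<le> 2 ^ (X ^ D')" using D[OF V, of ?s] D'[OF V, of ?s] m by auto
        have b': "?x \<le> 2 ^ (X ^ E)" "?y \<le> 2 ^ (X ^ E)" "F ?x ?y \<le> 2 ^ (X ^ E)"
          using F2[OF V b] pow2_exp_mono[OF V _ b(1), of E] pow2_exp_mono[OF V _ b(2), of E] by (auto simp: E_def)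
        show "runs (Store r (Const 0) (opr (Cell r (Const 0)) (Cell (Suc r) (Const 0)))) m2 (X ^ (2 * E + 6))
          (\<lambda>m'. m' r 0 = F (f I ?s) (g I ?s) \<and> (\<forall>a<r. m' a = m a))"
        proof (rule runs_Store)
          define L where "L = X ^ E + 2"
          have l: "len ?x \<le> L" "len ?y \<le> L" "len (F ?x ?y) \<le> L" using b' len_le unfolding L_def by auto
          have L1: "3 \<le> L" using X by (simp add: L_def)
          have c1: "cost (opr (Cell r (Const 0)) (Cell (Suc r) (Const 0))) m2
            \<le> (2 + len ?x) + (2 + len ?y) + (len ?x + len ?y) + len ?x * len ?y"
            by (rule order_trans[OF cost]) (simp add: m2 len_def floorlog_def)
          have "len ?x * len ?y \<le> L * L" using l by (intro mult_mono) auto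
          with c1 have "cost (opr (Cell r (Const 0)) (Cell (Suc r) (Const 0))) m2 \<le> 4 + 4 * L + L * L"
            using l by linarith
          then have "cost (Const 0) m2 + cost (opr (Cell r (Const 0)) (Cell (Suc r) (Const 0))) m2 + len (val (Const 0) m2)
             + len (val (opr (Cell r (Const 0)) (Cell (Suc r) (Const 0))) m2) \<le> 6 + 5 * L + L * L"
            using l by (simp add: val m2 len_def floorlog_def)
          also have "\<dots> \<le> 7 * (L * L)"
          proof -
            have "3 * L \<le> L * L" using L1 by simp
            moreover have "3 * 3 \<le> L * L" using L1 by (intro mult_mono) auto
            ultimately have "3 * L \<le> L * L" "9 \<le> L * L" by auto
            then show ?thesis by linarith
          qed
          \<comment> \<open>L is at most \<open>3 * X ^ E\<close>, so \<open>7 * (L * L)\<close> is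
            at most 63 times \<open>X ^ (2 * E)\<close>; the exponent 6 comes from 64 being at most
            \<open>X ^ 6\<close>.\<close>
          also have "\<dots> \<le> 64 * (X ^ E * X ^ E)"
          proof -
            have "1 \<le> X ^ E" using X by simp
            then have "L \<le> 3 * X ^ E" unfolding L_def by linarith
            then have "L * L \<le> (3 * X ^ E) * (3 * X ^ E)" by (intro mult_mono) auto
            also have "\<dots> = 9 * (X ^ E * X ^ E)" by simp
            finally show ?thesis by linarith
          qed
          also have "\<dots> \<le> X ^ 6 * (X ^ E * X ^ E)" using power_mono[OF X, of 6] by (intro mult_right_mono) auto
          also have "\<dots> = X ^ (2 * E + 6)" by (metis mult_2 mult.commute power_add)
          finally show "cost (Const 0) m2 + cost (opr (Cell r (Const 0)) (Cell (Suc r) (Const 0))) m2 + len (val (Const 0) m2)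
             + len (val (opr (Cell r (Const 0)) (Cell (Suc r) (Const 0))) m2) \<le> X ^ (2 * E + 6)" .
        qed (auto simp: m2 val)
      qed
    qed
  qed
  then show ?thesis by blast
  qed
  ultimately show ?thesis by (intro implI) auto
qed

lemma impl_plus: "impl f \<Longrightarrow> impl g \<Longrightarrow> impl (\<lambda>I s. f I s + g I s)"
  by (rule impl_op[where opr = Plus and F = "(+)"]) auto

lemma impl_minus: "impl f \<Longrightarrow> impl g \<Longrightarrow> impl (\<lambda>I s. f I s - g I s)"
  by (rule impl_op[where opr = Minus and F = "(-)"]) auto

lemma impl_times: "impl f \<Longrightarrow> impl g \<Longrightarrow> impl (\<lambda>I s. f I s * g I s)"
  by (rule impl_op[where opr = Times and F = "(*)"]) auto

lemma impl_div: "impl f \<Longrightarrow> impl g \<Longrightarrow> impl (\<lambda>I s. f I s div g I s)"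
  by (rule impl_op[where opr = Div and F = "(div)"]) (auto intro: order_trans[OF div_le_dividend])


lemma bnd_let:
  assumes "bnd a" "bnd g" shows "bnd (\<lambda>I s. g I (a I s # s))"
proof (rule bndI)
  fix j
  obtain D where D: "\<And>I X s. V I X \<Longrightarrow> (\<And>v. v \<in> set s \<Longrightarrow> v \<le> 2 ^ (X ^ j)) \<Longrightarrow> a I s \<le> 2 ^ (X ^ D)"
    by (rule bndE[OF assms(1)]) blast
  obtain D' where D': "\<And>I X s. V I X \<Longrightarrow> (\<And>v. v \<in> set s \<Longrightarrow> v \<le> 2 ^ (X ^ (D + j))) \<Longrightarrow> g I s \<le> 2 ^ (X ^ D')"
    by (rule bndE[OF assms(2)]) blast
  have "g I (a I s # s) \<le> 2 ^ X ^ D'" if "V I X" "\<forall>v\<in>set s. v \<le> 2 ^ X ^ j" for I X s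
  proof (rule D'[OF that(1)])
    fix v assume "v \<in> set (a I s # s)"
    then consider "v = a I s" | "v \<in> set s" by auto
    then show "v \<le> 2 ^ X ^ (D + j)"
      using D[OF that(1), of s] that(2) pow2_exp_mono[OF that(1) le_add1, of _ D j]
        pow2_exp_mono[OF that(1) le_add2, of _ j D] by cases auto
  qed
  then show "\<exists>D. \<forall>I X s. V I X \<longrightarrow> (\<forall>v\<in>set s. v \<le> 2 ^ X ^ j) \<longrightarrow> g I (a I s # s) \<le> 2 ^ X ^ D" by blast
qed

text \<open>A let-binding. It is the source of all substitutions: a definition compiled for
  variables becomes usable at arbitrary arguments.\<close>

lemma impl_cons:
  assumes a: "impl a" and g: "impl g"
  shows "impl (\<lambda>I s. g I (a I s # s))"
proof (rule implI)
  show "bnd (\<lambda>I s. g I (a I s # s))" by (rule bnd_let[OF impl_bnd[OF a] impl_bnd[OF g]])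
next
  fix locs :: "nat list" and r j :: nat
  assume r: "2 \<le> r" and locs: "\<And>a. a \<in> set locs \<Longrightarrow> a < r"
  obtain D where D: "\<And>I X s. V I X \<Longrightarrow> (\<And>v. v \<in> set s \<Longrightarrow> v \<le> 2 ^ (X ^ j)) \<Longrightarrow> a I s \<le> 2 ^ (X ^ D)"
    by (rule bndE[OF impl_bnd[OF a]]) blast
  obtain D' where D': "\<And>I X s. V I X \<Longrightarrow> (\<And>v. v \<in> set s \<Longrightarrow> v \<le> 2 ^ (X ^ j)) \<Longrightarrow> g I (a I s # s) \<le> 2 ^ (X ^ D')"
    by (rule bndE[OF bnd_let[OF impl_bnd[OF a] impl_bnd[OF g]]]) blast
  obtain p Dp where p: "cpt a locs r j p Dp" by (rule implE[OF a r locs])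
  obtain q Dq where q: "cpt g (r # locs) (Suc r) (D + j) q Dq"
    by (rule implE[OF g, of "Suc r" "r # locs"]) (use r in \<open>auto dest!: locs\<close>)
  let ?f = "\<lambda>I s. g I (a I s # s)"
  \<comment> \<open>Array r holds the bound variable while q works at base \<open>Suc r\<close>, so
    the result has to be copied down at the end.\<close>
  have "cpt ?f locs r j (Seq p (Seq q (Store r (Const 0) (Cell (Suc r) (Const 0))))) (Dp + (Dq + (D' + 4) + 1) + 1)"
    unfolding cpt_def
  proof (intro allI impI)
    fix I X and m :: memory
    assume V: "V I X" and inp: "inp I m" and m: "\<forall>a\<in>set locs. m a 0 \<le> 2 ^ X ^ j"
    let ?s = "map (\<lambda>a. m a 0) locs"
    have X: "2 \<le> X" by (rule V_ge2[OF V])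
    show "runs (Seq p (Seq q (Store r (Const 0) (Cell (Suc r) (Const 0))))) m (X ^ (Dp + (Dq + (D' + 4) + 1) + 1))
       (\<lambda>m'. m' r 0 = ?f I ?s \<and> (\<forall>a<r. m' a = m a))"
    proof (rule runs_Seq[OF cptD[OF p V inp]])
      show "m a 0 \<le> 2 ^ X ^ j" if "a \<in> set locs" for a using m that by auto
      show "X ^ Dp + X ^ (Dq + (D' + 4) + 1) \<le> X ^ (Dp + (Dq + (D' + 4) + 1) + 1)"
        by (rule poly_add[OF X]) auto
      fix m1 assume m1: "m1 r 0 = a I ?s \<and> (\<forall>a<r. m1 a = m a)"
      have s1: "map (\<lambda>a. m1 a 0) (r # locs) = a I ?s # ?s" using m1 locs by auto
      show "runs (Seq q (Store r (Const 0) (Cell (Suc r) (Const 0)))) m1 (X ^ (Dq + (D' + 4) + 1))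
          (\<lambda>m'. m' r 0 = ?f I ?s \<and> (\<forall>a<r. m' a = m a))"
      proof (rule runs_Seq[OF cptD[OF q V]])
        show "inp I m1" using inp_cong[OF inp r] m1 by blast
        show "m1 b 0 \<le> 2 ^ X ^ (D + j)" if "b \<in> set (r # locs)" for b
        proof (cases "b = r")
          case True
          then show ?thesis using m1 D[OF V, of ?s] m pow2_exp_mono[OF V, of D "D + j"] by auto
        next
          case False
          then show ?thesis using that m1 m locs pow2_exp_mono[OF V, of j "D + j"] by auto
        qed
        show "X ^ Dq + X ^ (D' + 4) \<le> X ^ (Dq + (D' + 4) + 1)" by (rule poly_add[OF X]) auto
        fix m2 assume "m2 (Suc r) 0 = g I (map (\<lambda>a. m1 a 0) (r # locs)) \<and> (\<forall>a<Suc r. m2 a = m1 a)"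
        then have m2: "m2 (Suc r) 0 = ?f I ?s" "\<forall>a<r. m2 a = m a"
          unfolding s1 using m1 by auto
        have "?f I ?s \<le> 2 ^ X ^ D'" by (rule D'[OF V]) (use m in auto)
        then show "runs (Store r (Const 0) (Cell (Suc r) (Const 0))) m2 (X ^ (D' + 4))
          (\<lambda>m'. m' r 0 = ?f I ?s \<and> (\<forall>a<r. m' a = m a))"
          using m2 by (intro runs_copy[OF X]) auto
      qed
    qed
  qed
  then show "\<exists>p D. cpt ?f locs r j p D" by blast
qed

text \<open>A polynomial number of rounds does not suffice: the exponent in the length of the
  accumulator could grow in each round. The last hypothesis therefore asks for one exponent that
  covers all intermediate values.\<close>

lemma impl_rec:
  assumes k: "impl k" and kb: "loopb k" and z: "impl z"
    and g: "impl (\<lambda>I s. g I (tl (tl s)) (hd (tl s)) (hd s))"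
    and R: "\<And>j. \<exists>c. \<forall>I X s i. V I X \<longrightarrow> (\<forall>v\<in>set s. v \<le> 2 ^ (X ^ j)) \<longrightarrow> i \<le> k I s \<longrightarrow>
      rec_nat (z I s) (g I s) i \<le> 2 ^ (X ^ c)"
  shows "impl (\<lambda>I s. rec_nat (z I s) (g I s) (k I s))"
proof (rule implI)
  let ?R = "\<lambda>I s i. rec_nat (z I s) (g I s) i"
  show "bnd (\<lambda>I s. ?R I s (k I s))" using R by (intro bndI) blast
next
  fix locs :: "nat list" and r j :: nat
  let ?R = "\<lambda>I s i. rec_nat (z I s) (g I s) i"
  assume r: "2 \<le> r" and locs: "\<And>a. a \<in> set locs \<Longrightarrow> a < r"
  obtain c0 where c0: "\<And>I X s. V I X \<Longrightarrow> k I s \<le> X ^ c0" using kb by (auto simp: loopb_def)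
  obtain c1 where c1: "\<And>I X s i. V I X \<Longrightarrow> (\<And>v. v \<in> set s \<Longrightarrow> v \<le> 2 ^ (X ^ j)) \<Longrightarrow> i \<le> k I s \<Longrightarrow> ?R I s i \<le> 2 ^ (X ^ c1)"
    using R[of j] by metis
  \<comment> \<open>A common exponent for the counter, the accumulator and the old environment, so
    that the body can be compiled once for all rounds.\<close>
  define c where "c = c0 + c1 + j"
  have k_le: "i \<le> 2 ^ (X ^ c)" if "V I X" "i \<le> k I s" for I X s i
  proof -
    have "i \<le> X ^ c0" using c0[OF that(1), of s] that(2) by simp
    then have "i \<le> 2 ^ (X ^ c0)" by (rule poly_pow2[OF V_ge2[OF that(1)]])
    then show ?thesis by (rule pow2_exp_mono[OF that(1), rotated]) (simp add: c_def)
  qed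
  have R_le: "?R I s i \<le> 2 ^ (X ^ c)" if "V I X" "\<And>v. v \<in> set s \<Longrightarrow> v \<le> 2 ^ (X ^ j)" "i \<le> k I s" for I X s i
    using pow2_exp_mono[OF that(1) _ c1[OF that], of c] by (simp add: c_def)
  let ?idx = "Suc r" and ?bd = "Suc (Suc r)" and ?rs = "Suc (Suc (Suc r))"
  obtain pz Dz where pz: "cpt z locs r j pz Dz" by (rule implE[OF z r locs])
  obtain pk Dk where pk: "cpt k locs ?bd j pk Dk"
    by (rule implE[OF k, of ?bd locs]) (use r in \<open>auto dest!: locs\<close>)
  \<comment> \<open>Array r is the accumulator and the next one the counter; inside the body they
    are the two innermost variables.\<close>
  obtain pg Dg where pg: "cpt (\<lambda>I s. g I (tl (tl s)) (hd (tl s)) (hd s)) (r # ?idx # locs) ?rs c pg Dg"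
    by (rule implE[OF g, of ?rs "r # ?idx # locs"]) (use r in \<open>auto dest!: locs\<close>)
  define step where "step = Store ?idx (Const 0) (Plus (Cell ?idx (Const 0)) (Const 1))"
  define body where "body = Seq pg (Seq (Store r (Const 0) (Cell ?rs (Const 0))) step)"
  define C where "C = Seq pz (Seq pk (Seq (Store ?idx (Const 0) (Const 0))
     (While (Minus (Cell ?bd (Const 0)) (Cell ?idx (Const 0))) body)))"
  define Tb where "Tb = Dg + ((c + 4) + (c + 5) + 1) + 1"
  define Tw where "Tw = c0 + 1 + ((c + 6) + Tb + 1)"
  let ?f = "\<lambda>I s. ?R I s (k I s)"
  have "cpt ?f locs r j C (Dz + (Dk + (4 + Tw + 1) + 1) + 1)"
    unfolding cpt_def
  proof (intro allI impI)
    fix I X and m :: memory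
    assume V: "V I X" and inp: "inp I m" and m: "\<forall>a\<in>set locs. m a 0 \<le> 2 ^ X ^ j"
    let ?s = "map (\<lambda>a. m a 0) locs"
    have X: "2 \<le> X" by (rule V_ge2[OF V])
    have X16: "16 \<le> X ^ 4" "32 \<le> X ^ 5" "64 \<le> X ^ 6"
      using power_mono[OF X, of 4] power_mono[OF X, of 5] power_mono[OF X, of 6] by simp_all
    have Xc: "1 \<le> X ^ c" using X by simp
    have s_le: "v \<le> 2 ^ X ^ j" if "v \<in> set ?s" for v using that m by auto
    define Inv where "Inv i m' \<longleftrightarrow> (\<forall>a<r. m' a = m a) \<and> m' r 0 = ?R I ?s i \<and> m' ?idx 0 = i \<and> m' ?bd 0 = k I ?s" for i m'
    show "runs C m (X ^ (Dz + (Dk + (4 + Tw + 1) + 1) + 1)) (\<lambda>m'. m' r 0 = ?f I ?s \<and> (\<forall>a<r. m' a = m a))"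
      unfolding C_def
    proof (rule runs_Seq[OF cptD[OF pz V inp]])
      show "m a 0 \<le> 2 ^ X ^ j" if "a \<in> set locs" for a using m that by auto
      show "X ^ Dz + X ^ (Dk + (4 + Tw + 1) + 1) \<le> X ^ (Dz + (Dk + (4 + Tw + 1) + 1) + 1)"
        by (rule poly_add[OF X]) auto
      fix m1 assume m1: "m1 r 0 = z I ?s \<and> (\<forall>a<r. m1 a = m a)"
      show "runs (Seq pk (Seq (Store ?idx (Const 0) (Const 0))
           (While (Minus (Cell ?bd (Const 0)) (Cell ?idx (Const 0))) body))) m1 (X ^ (Dk + (4 + Tw + 1) + 1))
           (\<lambda>m'. m' r 0 = ?f I ?s \<and> (\<forall>a<r. m' a = m a))"
      proof (rule runs_Seq[OF cptD[OF pk V]])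
        show "inp I m1" using inp_cong[OF inp r] m1 by blast
        show "m1 a 0 \<le> 2 ^ X ^ j" if "a \<in> set locs" for a using m m1 locs that by auto
        show "X ^ Dk + X ^ (4 + Tw + 1) \<le> X ^ (Dk + (4 + Tw + 1) + 1)"
          by (rule poly_add[OF X]) auto
        fix m2 assume m2: "m2 ?bd 0 = k I (map (\<lambda>a. m1 a 0) locs) \<and> (\<forall>a<?bd. m2 a = m1 a)"
        have s1: "map (\<lambda>a. m1 a 0) locs = ?s" using m1 locs by auto
        show "runs (Seq (Store ?idx (Const 0) (Const 0)) (While (Minus (Cell ?bd (Const 0)) (Cell ?idx (Const 0))) body))
           m2 (X ^ (4 + Tw + 1)) (\<lambda>m'. m' r 0 = ?f I ?s \<and> (\<forall>a<r. m' a = m a))"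
        proof (rule runs_Seq[OF runs_Store[where P = "Inv 0"]])
          show "cost (Const 0) m2 + cost (Const 0) m2 + len (val (Const 0) m2) + len (val (Const 0) m2) \<le> X ^ 4"
            using X16 by (simp add: len_def floorlog_def)
          show "Inv 0 (m2(?idx := (m2 ?idx)(val (Const 0) m2 := val (Const 0) m2)))"
            using m1 m2 s1 by (auto simp: Inv_def)
          show "X ^ 4 + X ^ Tw \<le> X ^ (4 + Tw + 1)" by (rule poly_add[OF X]) auto
          fix m3 assume m3: "Inv 0 m3"
          have "runs (While (Minus (Cell ?bd (Const 0)) (Cell ?idx (Const 0))) body) m3
             ((k I ?s - 0 + 1) * (X ^ (c + 6) + X ^ Tb)) (Inv (k I ?s))"
          proof (rule runs_While[where Inv = Inv and i = 0 and k = "k I ?s", OF _ _ _ m3])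
            fix i m' assume i: "i \<le> k I ?s" and inv: "Inv i m'"
            let ?b = "Minus (Cell ?bd (Const 0)) (Cell ?idx (Const 0))"
            have "len i \<le> X ^ c + 2" "len (k I ?s) \<le> X ^ c + 2" "len (k I ?s - i) \<le> X ^ c + 2"
              by (rule len_le; rule k_le[OF V, of _ ?s]; use i in simp)+
            moreover have "64 * X ^ c \<le> X ^ (c + 6)"
              using mult_right_mono[OF X16(3), of "X ^ c"] by (simp add: power_add mult.commute)
            ultimately show "cost ?b m' + len (val ?b m') \<le> X ^ (c + 6)"
              using inv Xc by (simp add: Inv_def len_def[of 0] floorlog_def[of _ 0])
          next
            fix i m' assume i: "i < k I ?s" and inv: "Inv i m'"
            have 1: "map (\<lambda>a. m' a 0) (r # ?idx # locs) = ?R I ?s i # i # ?s"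
              using inv locs by (auto simp: Inv_def)
            have "runs body m' (X ^ Tb) (Inv (Suc i))"
              unfolding body_def Tb_def
            proof (rule runs_Seq[OF cptD[OF pg V]])
              show "inp I m'" using inp_cong[OF inp r] inv by (auto simp: Inv_def)
              show "X ^ Dg + X ^ ((c + 4) + (c + 5) + 1) \<le> X ^ (Dg + ((c + 4) + (c + 5) + 1) + 1)"
                by (rule poly_add[OF X]) auto
              show "m' b 0 \<le> 2 ^ X ^ c" if "b \<in> set (r # ?idx # locs)" for b
              proof -
                consider "b = r" | "b = ?idx" | "b \<in> set locs" using \<open>b \<in> _\<close> by auto
                then show ?thesis
                proof cases
                  case 1
                  then show ?thesis using inv R_le[OF V, of ?s i] s_le i by (auto simp: Inv_def)
                next
                  case 2
                  then show ?thesis using inv k_le[OF V, of i ?s] i by (auto simp: Inv_def)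
                next
                  case 3
                  then have "m' b 0 \<le> 2 ^ X ^ j" using inv m locs by (auto simp: Inv_def)
                  then show ?thesis by (rule pow2_exp_mono[OF V, rotated]) (simp add: c_def)
                qed
              qed
              fix m4 assume m4: "m4 ?rs 0 = g I (tl (tl (map (\<lambda>a. m' a 0) (r # ?idx # locs)))) (hd (tl (map (\<lambda>a. m' a 0) (r # ?idx # locs)))) (hd (map (\<lambda>a. m' a 0) (r # ?idx # locs)))
                \<and> (\<forall>a<?rs. m4 a = m' a)"
              have m4': "m4 ?rs 0 = ?R I ?s (Suc i)" "\<forall>a<r. m4 a = m a" "m4 ?idx 0 = i" "m4 ?bd 0 = k I ?s"
                using m4 inv unfolding 1 by (auto simp: Inv_def)
              let ?Q = "\<lambda>m'. (\<forall>a<r. m' a = m a) \<and> m' r 0 = ?R I ?s (Suc i) \<and> m' ?idx 0 = i \<and> m' ?bd 0 = k I ?s"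
              show "runs (Seq (Store r (Const 0) (Cell ?rs (Const 0))) step) m4 (X ^ ((c + 4) + (c + 5) + 1)) (Inv (Suc i))"
              proof (rule runs_Seq[OF runs_copy[OF X, where P = ?Q]])
                show "m4 ?rs 0 \<le> 2 ^ X ^ c" unfolding m4' by (rule R_le[OF V s_le]) (use i in auto)
                show "?Q (m4(r := (m4 r)(0 := m4 ?rs 0)))" using m4' by auto
                show "X ^ (c + 4) + X ^ (c + 5) \<le> X ^ ((c + 4) + (c + 5) + 1)" by (rule poly_add[OF X]) auto
                fix m5 assume m5: "?Q m5"
                show "runs step m5 (X ^ (c + 5)) (Inv (Suc i))" unfolding step_def
                proof (rule runs_Store)
                  have "len i \<le> X ^ c + 2" "len (Suc i) \<le> X ^ c + 2"
                    by (rule len_le; rule k_le[OF V, of _ ?s]; use i in simp)+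
                  moreover have "32 * X ^ c \<le> X ^ (c + 5)"
                    using mult_right_mono[OF X16(2), of "X ^ c"] by (simp add: power_add mult.commute)
                  moreover have "len 1 = 2" by (simp add: len_def floorlog_def compute_floorlog)
                  ultimately show "cost (Const 0) m5 + cost (Plus (Cell ?idx (Const 0)) (Const 1)) m5 + len (val (Const 0) m5)
                     + len (val (Plus (Cell ?idx (Const 0)) (Const 1)) m5) \<le> X ^ (c + 5)"
                    using m5 Xc by (simp add: len_def[of 0] floorlog_def[of _ 0])
                qed (use m5 in \<open>auto simp: Inv_def\<close>)
              qed
            qed
            then show "val (Minus (Cell ?bd (Const 0)) (Cell ?idx (Const 0))) m' \<noteq> 0 \<and> runs body m' (X ^ Tb) (Inv (Suc i))"
              using inv i by (auto simp: Inv_def)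
          qed (auto simp: Inv_def)
          moreover have "(k I ?s - 0 + 1) * (X ^ (c + 6) + X ^ Tb) \<le> X ^ Tw"
            unfolding Tw_def
          proof (rule poly_mult)
            have "k I ?s + 1 \<le> 2 * X ^ c0" using c0[OF V, of ?s] X one_le_power[of X c0] by linarith
            also have "\<dots> \<le> X * X ^ c0" using X by (intro mult_right_mono) auto
            finally show "k I ?s - 0 + 1 \<le> X ^ (c0 + 1)" by simp
            show "X ^ (c + 6) + X ^ Tb \<le> X ^ (c + 6 + Tb + 1)" by (rule poly_add[OF X]) auto
          qed
          ultimately show "runs (While (Minus (Cell ?bd (Const 0)) (Cell ?idx (Const 0))) body) m3 (X ^ Tw)
             (\<lambda>m'. m' r 0 = ?f I ?s \<and> (\<forall>a<r. m' a = m a))"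
            by (rule runs_mono) (auto simp: Inv_def)
        qed
      qed
    qed
  qed
  then show "\<exists>p D. cpt ?f locs r j p D" by blast
qed

end

context ram
begin

lemma impl_input:
  assumes b: "b < 2" and f: "impl f"
  shows "impl (\<lambda>I s. input_memory I b (f I s))"
proof (rule implI)
  show "bnd (\<lambda>I s. input_memory I b (f I s))"
  proof (rule bndI)
    have "input_memory I b (f I s) \<le> 2 ^ X ^ 1" if "V I X" for I X s
      by (rule poly_pow2[OF V_ge2[OF that]]) (use V_input[OF that] in simp)
    then show "\<exists>D. \<forall>I X s. V I X \<longrightarrow> (\<forall>v\<in>set s. v \<le> 2 ^ X ^ j) \<longrightarrow> input_memory I b (f I s) \<le> 2 ^ X ^ D" for j
      by blast
  qed
next
  fix locs :: "nat list" and r j :: nat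
  assume r: "2 \<le> r" and locs: "\<And>a. a \<in> set locs \<Longrightarrow> a < r"
  obtain D where D: "\<And>I X s. V I X \<Longrightarrow> (\<And>v. v \<in> set s \<Longrightarrow> v \<le> 2 ^ (X ^ j)) \<Longrightarrow> f I s \<le> 2 ^ (X ^ D)"
    by (rule bndE[OF impl_bnd[OF f]]) blast
  obtain p Dp where p: "cpt f locs r j p Dp" by (rule implE[OF f r locs])
  let ?S = "Store r (Const 0) (Cell b (Cell r (Const 0)))"
  let ?F = "\<lambda>I s. input_memory I b (f I s)"
  have "cpt ?F locs r j (Seq p ?S) (Dp + (D + 6) + 1)"
    unfolding cpt_def
  proof (intro allI impI)
    fix I X and m :: memory
    assume V: "V I X" and inp: "inp I m" and m: "\<forall>a\<in>set locs. m a 0 \<le> 2 ^ X ^ j"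
    let ?s = "map (\<lambda>a. m a 0) locs"
    have X: "2 \<le> X" by (rule V_ge2[OF V])
    show "runs (Seq p ?S) m (X ^ (Dp + (D + 6) + 1)) (\<lambda>m'. m' r 0 = ?F I ?s \<and> (\<forall>a<r. m' a = m a))"
    proof (rule runs_Seq[OF cptD[OF p V inp]])
      show "m a 0 \<le> 2 ^ X ^ j" if "a \<in> set locs" for a using m that by auto
      show "X ^ Dp + X ^ (D + 6) \<le> X ^ (Dp + (D + 6) + 1)" by (rule poly_add[OF X]) auto
      fix m1 assume m1: "m1 r 0 = f I ?s \<and> (\<forall>a<r. m1 a = m a)"
      have b1: "m1 b = input_memory I b" using m1 b r inp by (auto simp: inp_def)
      show "runs ?S m1 (X ^ (D + 6)) (\<lambda>m'. m' r 0 = ?F I ?s \<and> (\<forall>a<r. m' a = m a))"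
      proof (rule runs_Store)
        have "len (f I ?s) \<le> X ^ D + 2" by (rule len_le[OF D[OF V]]) (use m in auto)
        moreover have "?F I ?s \<le> 2 ^ X"
          using V_input[OF V, of b "f I ?s"] less_exp[of X] by linarith
        then have "len (?F I ?s) \<le> X + 2" by (rule len_le)
        moreover have "X \<le> X ^ (D + 1)" "1 \<le> X ^ (D + 1)" "X ^ D \<le> X ^ (D + 1)" using X by auto
        moreover have "X ^ (D + 1) * 32 \<le> X ^ (D + 1) * X ^ 5"
          using power_mono[OF X, of 5] by simp
        moreover have "X ^ (D + 1) * X ^ 5 = X ^ (D + 6)" by (simp only: power_add[symmetric]) (simp add: add.commute)
        ultimately have "6 + 2 * len (f I ?s) + 2 * len (?F I ?s) \<le> X ^ (D + 6)" by linarith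
        then show "cost (Const 0) m1 + cost (Cell b (Cell r (Const 0))) m1 + len (val (Const 0) m1) + len (val (Cell b (Cell r (Const 0))) m1) \<le> X ^ (D + 6)"
          using m1 b1 X by (simp add: len_def[of 0] floorlog_def[of _ 0])
      qed (use m1 b1 in auto)
    qed
  qed
  then show "\<exists>p D. cpt ?F locs r j p D" by blast
qed

text \<open>An index below \<open>k I s\<close> is at most \<open>X ^ c\<close>, so it may be pushed
  on the environment without leaving the values of polynomial length.\<close>

lemma iterated_bound:
  assumes "bnd (\<lambda>I s. g I (tl s) (hd s))" "loopb k"
  obtains D c where "\<And>I X s i. V I X \<Longrightarrow> (\<And>v. v \<in> set s \<Longrightarrow> v \<le> 2 ^ (X ^ j)) \<Longrightarrow> i < k I s \<Longrightarrow> g I s i \<le> 2 ^ (X ^ D)"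
    "\<And>I X s. V I X \<Longrightarrow> k I s \<le> X ^ c"
proof -
  obtain c where c: "\<And>I X s. V I X \<Longrightarrow> k I s \<le> X ^ c" using assms(2) by (auto simp: loopb_def)
  obtain D where D: "\<And>I X s. V I X \<Longrightarrow> (\<And>v. v \<in> set s \<Longrightarrow> v \<le> 2 ^ (X ^ (c + j))) \<Longrightarrow> g I (tl s) (hd s) \<le> 2 ^ (X ^ D)"
    by (rule bndE[OF assms(1)]) blast
  have "g I s i \<le> 2 ^ (X ^ D)" if "V I X" "\<And>v. v \<in> set s \<Longrightarrow> v \<le> 2 ^ (X ^ j)" "i < k I s" for I X s i
  proof -
    have "i \<le> 2 ^ X ^ c" using c[OF that(1), of s] that(3) by (intro poly_pow2[OF V_ge2[OF that(1)]]) linarith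
    then have "v \<le> 2 ^ (X ^ (c + j))" if "v \<in> set (i # s)" for v
      using pow2_exp_mono[OF \<open>V I X\<close> le_add1, of v c j] pow2_exp_mono[OF \<open>V I X\<close> le_add2, of v j c]
        \<open>\<And>v. v \<in> set s \<Longrightarrow> v \<le> 2 ^ (X ^ j)\<close> that by auto
    from D[OF that(1), of "i # s", OF this] show ?thesis by simp
  qed
  then show ?thesis using that c by blast
qed

lemma impl_sum:
  assumes k: "impl k" and kb: "loopb k" and g: "impl (\<lambda>I s. g I (tl s) (hd s))"
  shows "impl (\<lambda>I s. \<Sum>i<k I s. g I s i)"
proof -
  have rec: "rec_nat 0 (\<lambda>i a. a + g I s i) n = (\<Sum>i<n. g I s i)" for I s n
    by (induction n) auto
  have "impl (\<lambda>I s. rec_nat 0 (\<lambda>i a. a + g I s i) (k I s))"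
  proof (rule impl_rec[OF k kb impl_const])
    show "impl (\<lambda>I s. hd s + g I (tl (tl s)) (hd (tl s)))"
      by (intro impl_plus impl_hd impl_weaken[OF g])
    fix j
    obtain D c where D: "\<And>I X s i. V I X \<Longrightarrow> (\<And>v. v \<in> set s \<Longrightarrow> v \<le> 2 ^ (X ^ j)) \<Longrightarrow> i < k I s \<Longrightarrow> g I s i \<le> 2 ^ (X ^ D)"
      and c: "\<And>I X s. V I X \<Longrightarrow> k I s \<le> X ^ c"
      by (rule iterated_bound[OF impl_bnd[OF g] kb]) blast
    have "(\<Sum>i<n. g I s i) \<le> 2 ^ (X ^ (c + D + 1))"
      if V: "V I X" and s: "\<forall>v\<in>set s. v \<le> 2 ^ (X ^ j)" and n: "n \<le> k I s" for I X s n
    proof -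
      have "(\<Sum>i<n. g I s i) \<le> (\<Sum>i<n. 2 ^ (X ^ D))"
        by (intro sum_mono D[OF V]) (use s n in auto)
      also have "\<dots> = n * 2 ^ (X ^ D)" by simp
      also have "\<dots> \<le> 2 ^ (X ^ c) * 2 ^ (X ^ D)"
        using c[OF V, of s] n by (intro mult_right_mono poly_pow2[OF V_ge2[OF V]]) auto
      also have "\<dots> = 2 ^ (X ^ c + X ^ D)" by (simp add: power_add)
      also have "\<dots> \<le> 2 ^ (X ^ (c + D + 1))"
        by (rule power_increasing[OF poly_add[OF V_ge2[OF V]]]) auto
      finally show ?thesis .
    qed
    then show "\<exists>c. \<forall>I X s i. V I X \<longrightarrow> (\<forall>v\<in>set s. v \<le> 2 ^ X ^ j) \<longrightarrow> i \<le> k I s \<longrightarrow>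
       rec_nat 0 (\<lambda>i a. a + g I s i) i \<le> 2 ^ X ^ c"
      unfolding rec by blast
  qed
  then show ?thesis by (simp add: rec)
qed

lemma impl_prod:
  assumes k: "impl k" and kb: "loopb k" and g: "impl (\<lambda>I s. g I (tl s) (hd s))"
  shows "impl (\<lambda>I s. \<Prod>i<k I s. g I s i)"
proof -
  have rec: "rec_nat (Suc 0) (\<lambda>i a. a * g I s i) n = (\<Prod>i<n. g I s i)" for I s n
    by (induction n) auto
  have "impl (\<lambda>I s. rec_nat (Suc 0) (\<lambda>i a. a * g I s i) (k I s))"
  proof (rule impl_rec[OF k kb impl_const])
    show "impl (\<lambda>I s. hd s * g I (tl (tl s)) (hd (tl s)))"
      by (intro impl_times impl_hd impl_weaken[OF g])
    fix j
    obtain D c where D: "\<And>I X s i. V I X \<Longrightarrow> (\<And>v. v \<in> set s \<Longrightarrow> v \<le> 2 ^ (X ^ j)) \<Longrightarrow> i < k I s \<Longrightarrow> g I s i \<le> 2 ^ (X ^ D)"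
      and c: "\<And>I X s. V I X \<Longrightarrow> k I s \<le> X ^ c"
      by (rule iterated_bound[OF impl_bnd[OF g] kb]) blast
    have "(\<Prod>i<n. g I s i) \<le> 2 ^ (X ^ (D + c))"
      if V: "V I X" and s: "\<forall>v\<in>set s. v \<le> 2 ^ (X ^ j)" and n: "n \<le> k I s" for I X s n
    proof -
      have "(\<Prod>i<n. g I s i) \<le> (\<Prod>i<n. 2 ^ (X ^ D))"
        by (intro prod_mono conjI D[OF V]) (use s n in auto)
      also have "\<dots> = 2 ^ (X ^ D * n)" by (simp add: power_mult)
      also have "\<dots> \<le> 2 ^ (X ^ (D + c))"
        by (rule power_increasing[OF poly_mult]) (use c[OF V, of s] n in auto)
      finally show ?thesis .
    qed
    then show "\<exists>c. \<forall>I X s i. V I X \<longrightarrow> (\<forall>v\<in>set s. v \<le> 2 ^ X ^ j) \<longrightarrow> i \<le> k I s \<longrightarrow>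
       rec_nat (Suc 0) (\<lambda>i a. a * g I s i) i \<le> 2 ^ X ^ c"
      unfolding rec by blast
  qed
  then show ?thesis by (simp add: rec)
qed

text \<open>Iterates could double their length in every step, so their bound is a hypothesis. It
  does not mention the environment, because it is applied to input addresses and to bitmasks, which
  are bounded by the input alone.\<close>

lemma impl_funpow:
  assumes k: "impl k" and kb: "loopb k" and z: "impl z" and g: "impl (\<lambda>I s. g I (tl (tl s)) (hd s))"
    and R: "\<And>I X s i. V I X \<Longrightarrow> i \<le> k I s \<Longrightarrow> (g I s ^^ i) (z I s) \<le> 2 ^ (X ^ c)"
  shows "impl (\<lambda>I s. (g I s ^^ k I s) (z I s))"
proof -
  have rec: "rec_nat (z I s) (\<lambda>_. g I s) n = (g I s ^^ n) (z I s)" for I s n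
    by (induction n) auto
  have "impl (\<lambda>I s. rec_nat (z I s) (\<lambda>_. g I s) (k I s))"
  proof (rule impl_rec[OF k kb z g])
    show "\<exists>c. \<forall>I X s i. V I X \<longrightarrow> (\<forall>v\<in>set s. v \<le> 2 ^ X ^ j) \<longrightarrow> i \<le> k I s \<longrightarrow> rec_nat (z I s) (\<lambda>_. g I s) i \<le> 2 ^ X ^ c" for j
      unfolding rec by (intro exI[of _ c]) (simp add: R)
  qed
  then show ?thesis by (simp add: rec)
qed

section \<open>Loop bounds, and predicates as 0-1 valued expressions\<close>

lemma loopb_mono: "loopb g \<Longrightarrow> (\<And>I X s. V I X \<Longrightarrow> f I s \<le> g I s) \<Longrightarrow> loopb f"
  unfolding loopb_def by (meson le_trans)

lemma loopb_const: "loopb (\<lambda>I s. c)"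
  unfolding loopb_def by (intro exI[of _ c] allI impI le_power_self V_ge2)

lemma loopb_input: "loopb (\<lambda>I s. input_memory I b (f I s))"
  unfolding loopb_def by (intro exI[of _ 1]) (simp add: V_input)

lemma loopb_add: "loopb f \<Longrightarrow> loopb g \<Longrightarrow> loopb (\<lambda>I s. f I s + g I s)"
  unfolding loopb_def using poly_add[OF V_ge2] by meson

lemma loopb_mult: "loopb f \<Longrightarrow> loopb g \<Longrightarrow> loopb (\<lambda>I s. f I s * g I s)"
  unfolding loopb_def using poly_mult by meson

lemma loopb_diff: "loopb f \<Longrightarrow> loopb (\<lambda>I s. f I s - g I s)"
  by (erule loopb_mono) simp

lemma loopb_min: "loopb g \<Longrightarrow> loopb (\<lambda>I s. min (f I s) (g I s))"
  by (erule loopb_mono) simp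

lemma impl_power:
  assumes "impl f" "impl g" "loopb g"
  shows "impl (\<lambda>I s. f I s ^ g I s)"
  using impl_prod[OF assms(2,3), of "\<lambda>I s i. f I s"] impl_weaken[OF assms(1)] by simp

lemma impl_mod:
  assumes "impl f" "impl g" shows "impl (\<lambda>I s. f I s mod g I s)"
  unfolding minus_div_mult_eq_mod[symmetric] by (intro impl_minus impl_times impl_div assms)

text \<open>Truncated subtraction supplies the sign function from which all predicates are
  built.\<close>

lemma impl_of_bool_less:
  assumes "impl f" "impl g" shows "impl (\<lambda>I s. of_bool (f I s < g I s))"
proof -
  have "(of_bool (a < b) :: nat) = 1 - (1 - (b - a))" for a b :: nat by auto
  then show ?thesis by (auto intro!: impl_minus impl_const assms)
qed

lemma impl_of_bool_not:
  assumes "impl (\<lambda>I s. of_bool (P I s))" shows "impl (\<lambda>I s. of_bool (\<not> P I s))"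
proof -
  have "(of_bool (\<not> P) :: nat) = 1 - of_bool P" for P by auto
  then show ?thesis by (auto intro!: impl_minus impl_const assms)
qed

lemma impl_of_bool_conj:
  assumes "impl (\<lambda>I s. of_bool (P I s))" "impl (\<lambda>I s. of_bool (Q I s))"
  shows "impl (\<lambda>I s. of_bool (P I s \<and> Q I s))"
  using impl_times[OF assms] by (simp flip: of_bool_conj)

lemma impl_of_bool_disj:
  assumes "impl (\<lambda>I s. of_bool (P I s))" "impl (\<lambda>I s. of_bool (Q I s))"
  shows "impl (\<lambda>I s. of_bool (P I s \<or> Q I s))"
  using impl_of_bool_not[OF impl_of_bool_conj[OF assms[THEN impl_of_bool_not]]] by simp

lemma impl_of_bool_imp:
  assumes "impl (\<lambda>I s. of_bool (P I s))" "impl (\<lambda>I s. of_bool (Q I s))"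
  shows "impl (\<lambda>I s. of_bool (P I s \<longrightarrow> Q I s))"
  using impl_of_bool_disj[OF impl_of_bool_not[OF assms(1)] assms(2)] by (simp only: imp_conv_disj)

lemma impl_of_bool_iff:
  assumes "impl (\<lambda>I s. of_bool (P I s))" "impl (\<lambda>I s. of_bool (Q I s))"
  shows "impl (\<lambda>I s. of_bool (P I s \<longleftrightarrow> Q I s))"
  unfolding iff_conv_conj_imp by (intro impl_of_bool_conj impl_of_bool_imp assms)

lemma impl_of_bool_le:
  assumes "impl f" "impl g" shows "impl (\<lambda>I s. of_bool (f I s \<le> g I s))"
  unfolding not_less[symmetric] by (intro impl_of_bool_not impl_of_bool_less assms)

lemma impl_of_bool_eq:
  assumes "impl f" "impl g" shows "impl (\<lambda>I s. of_bool (f I s = g I s))"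
  unfolding order.eq_iff by (intro impl_of_bool_conj impl_of_bool_le assms)

lemma impl_of_bool_odd:
  assumes "impl f" shows "impl (\<lambda>I s. of_bool (odd (f I s)))"
  unfolding odd_iff_mod_2_eq_one by (intro impl_of_bool_eq impl_mod impl_const assms)

lemma impl_of_bool_even:
  assumes "impl f" shows "impl (\<lambda>I s. of_bool (even (f I s)))"
  using impl_of_bool_not[OF impl_of_bool_odd[OF assms]] by simp

lemma impl_of_bool_Ex:
  assumes "impl k" "loopb k" "impl (\<lambda>I s. of_bool (P I (tl s) (hd s)))"
  shows "impl (\<lambda>I s. of_bool (\<exists>i<k I s. P I s i))"
proof -
  have "(\<exists>i<k. P i) \<longleftrightarrow> 0 < (\<Sum>i<k. of_bool (P i) :: nat)" for k :: nat and P
    by (subst neq0_conv[symmetric], subst sum_eq_0_iff) auto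
  then show ?thesis by (simp only:) (intro impl_of_bool_less impl_const impl_sum assms)
qed

lemma impl_of_bool_All:
  assumes "impl k" "loopb k" "impl (\<lambda>I s. of_bool (P I (tl s) (hd s)))"
  shows "impl (\<lambda>I s. of_bool (\<forall>i<k I s. P I s i))"
  using impl_of_bool_not[OF impl_of_bool_Ex[OF assms(1,2) impl_of_bool_not[OF assms(3)]]] by simp

text \<open>Both branches are evaluated and combined arithmetically. This costs no more than a
  constant number of further operations on values of polynomial length.\<close>

lemma impl_if:
  assumes "impl (\<lambda>I s. of_bool (P I s))" "impl f" "impl g"
  shows "impl (\<lambda>I s. if P I s then f I s else g I s)"
proof -
  have "(if P then a else b) = of_bool P * a + of_bool (\<not> P) * b" for P and a b :: nat by auto
  then show ?thesis by (auto intro!: impl_plus impl_times impl_of_bool_not assms)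
qed

lemma impl_min:
  assumes "impl f" "impl g" shows "impl (\<lambda>I s. min (f I s) (g I s))"
  unfolding min_def by (intro impl_if impl_of_bool_le assms)

lemmas impl_var = impl_hd impl_hd[THEN impl_weaken] impl_hd[THEN impl_weaken, THEN impl_weaken]
  impl_hd[THEN impl_weaken, THEN impl_weaken, THEN impl_weaken]
  impl_hd[THEN impl_weaken, THEN impl_weaken, THEN impl_weaken, THEN impl_weaken]
  impl_hd[THEN impl_weaken, THEN impl_weaken, THEN impl_weaken, THEN impl_weaken, THEN impl_weaken]
  impl_hd[THEN impl_weaken, THEN impl_weaken, THEN impl_weaken, THEN impl_weaken, THEN impl_weaken, THEN impl_weaken]
  impl_hd[THEN impl_weaken, THEN impl_weaken, THEN impl_weaken, THEN impl_weaken, THEN impl_weaken, THEN impl_weaken, THEN impl_weaken]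

lemmas impl_intros = impl_const impl_var impl_plus impl_minus impl_times impl_div impl_mod impl_power impl_min
  impl_sum impl_prod impl_if impl_of_bool_less impl_of_bool_le impl_of_bool_eq impl_of_bool_not
  impl_of_bool_conj impl_of_bool_disj impl_of_bool_imp impl_of_bool_iff impl_of_bool_odd impl_of_bool_even
  impl_of_bool_Ex impl_of_bool_All

lemmas loopb_intros = loopb_const loopb_input loopb_add loopb_mult loopb_diff loopb_min

section \<open>The outermost loop\<close>

lemma runs_accumulate:
  assumes X: "2 \<le> X" and "m a 0 \<le> 2 ^ (X ^ E)" "m b 0 \<le> 2 ^ (X ^ E)" "m a 0 + m b 0 \<le> 2 ^ (X ^ E)"
    and "P (m(a := (m a)(0 := m a 0 + m b 0)))"
  shows "runs (Store a (Const 0) (Plus (Cell a (Const 0)) (Cell b (Const 0)))) m (X ^ (E + 5)) P"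
proof (rule runs_Store)
  have "len (m a 0) \<le> X ^ E + 2" "len (m b 0) \<le> X ^ E + 2" "len (m a 0 + m b 0) \<le> X ^ E + 2"
    by (rule len_le; rule assms)+
  moreover have "1 \<le> X ^ E" using X by simp
  ultimately have "6 + 2 * len (m a 0) + 2 * len (m b 0) + len (m a 0 + m b 0) \<le> 32 * X ^ E" by linarith
  also have "\<dots> \<le> X ^ 5 * X ^ E" using power_mono[OF X, of 5] by (intro mult_right_mono) auto
  finally show "cost (Const 0) m + cost (Plus (Cell a (Const 0)) (Cell b (Const 0))) m + len (val (Const 0) m)
     + len (val (Plus (Cell a (Const 0)) (Cell b (Const 0))) m) \<le> X ^ (E + 5)"
    by (simp add: len_def[of 0] floorlog_def[of _ 0] power_add mult.commute)
qed (use assms(5) in simp)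

lemma runs_zero:
  assumes X: "2 \<le> X" and "P (m(a := (m a)(0 := 0)))"
  shows "runs (Store a (Const 0) (Const 0)) m (X ^ 2) P"
proof (rule runs_Store)
  show "cost (Const 0) m + cost (Const 0) m + len (val (Const 0) m) + len (val (Const 0) m) \<le> X ^ 2"
    using power_mono[OF X, of 2] by (simp add: len_def floorlog_def)
qed (use assms(2) in simp)

text \<open>In contrast to \<open>impl_rec\<close>, the number K of rounds need not be polynomial in
  X. It is only characterised, as the first time the iterates of \<open>nx\<close> reach the limit
  \<open>T\<close>; the program is fixed before K and stops by comparing with the limit, and K
  enters the cost as a linear factor.\<close>

lemma impl_while:
  assumes nx: "impl (\<lambda>I s. nx I (hd s))" and ct: "impl (\<lambda>I s. ct I (hd s))"
    and T: "impl (\<lambda>I s. T I)" and fin: "impl (\<lambda>I s. fin I (hd s))"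
  shows "\<exists>p D. \<forall>I X K. V I X \<longrightarrow> (\<forall>i<K. (nx I ^^ i) 0 < T I) \<longrightarrow> T I \<le> (nx I ^^ K) 0 \<longrightarrow>
    (\<forall>i\<le>K. (nx I ^^ i) 0 \<le> 2 ^ (X ^ c)) \<longrightarrow> (\<forall>i\<le>K. (\<Sum>l<i. ct I ((nx I ^^ l) 0)) \<le> 2 ^ (X ^ c)) \<longrightarrow>
    runs p (input_memory I) ((K + 1) * X ^ D) (\<lambda>m. m 0 0 = fin I (\<Sum>l<K. ct I ((nx I ^^ l) 0)))"
proof -
  obtain DT where DT: "\<And>I X (s :: nat list). V I X \<Longrightarrow> (\<And>v. v \<in> set s \<Longrightarrow> v \<le> 2 ^ (X ^ 0)) \<Longrightarrow> T I \<le> 2 ^ (X ^ DT)"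
    by (rule bndE[OF impl_bnd[OF T]]) blast
  obtain Df where Df: "\<And>I X s. V I X \<Longrightarrow> (\<And>v. v \<in> set s \<Longrightarrow> v \<le> 2 ^ (X ^ c)) \<Longrightarrow> fin I (hd s) \<le> 2 ^ (X ^ Df)"
    by (rule bndE[OF impl_bnd[OF fin]]) blast
  \<comment> \<open>Array 2 holds the running total, 3 the current code and 4 the limit; from 5 on
    there is scratch space for the expressions.\<close>
  obtain pT DpT where pT: "cpt (\<lambda>I s. T I) [] 4 0 pT DpT" by (rule implE[OF T, of 4 "[]"]) auto
  obtain pc Dc where pc: "cpt (\<lambda>I s. ct I (hd s)) [3] 5 c pc Dc" by (rule implE[OF ct, of 5 "[3]"]) auto
  obtain pn Dn where pn: "cpt (\<lambda>I s. nx I (hd s)) [3] 5 c pn Dn" by (rule implE[OF nx, of 5 "[3]"]) auto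
  obtain pf Dpf where pf: "cpt (\<lambda>I s. fin I (hd s)) [2] 5 c pf Dpf" by (rule implE[OF fin, of 5 "[2]"]) auto
  define body where "body = Seq pc (Seq (Store 2 (Const 0) (Plus (Cell 2 (Const 0)) (Cell 5 (Const 0))))
     (Seq pn (Store 3 (Const 0) (Cell 5 (Const 0)))))"
  let ?g = "Minus (Cell 4 (Const 0)) (Cell 3 (Const 0))"
  define P where "P = Seq (Seq (Store 2 (Const 0) (Const 0)) (Seq (Store 3 (Const 0) (Const 0)) pT))
     (Seq (While ?g body) (Seq pf (Store 0 (Const 0) (Cell 5 (Const 0)))))"
  define Tb where "Tb = Dc + ((c + 5) + (Dn + (c + 4) + 1) + 1) + 1"
  define E where "E = c + DT"
  define Tw where "Tw = (E + 6) + Tb + 1"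
  define Te where "Te = Dpf + (Df + 4) + 1"
  define Ti where "Ti = 2 + (2 + DpT + 1) + 1"
  define D where "D = Ti + (Tw + Te + 1) + 1"
  have "runs P (input_memory I) ((K + 1) * X ^ D) (\<lambda>m. m 0 0 = fin I (\<Sum>l<K. ct I ((nx I ^^ l) 0)))"
    if V: "V I X" and lt: "\<forall>i<K. (nx I ^^ i) 0 < T I" and ge: "T I \<le> (nx I ^^ K) 0"
      and b1: "\<forall>i\<le>K. (nx I ^^ i) 0 \<le> 2 ^ (X ^ c)"
      and b2: "\<forall>i\<le>K. (\<Sum>l<i. ct I ((nx I ^^ l) 0)) \<le> 2 ^ (X ^ c)" for I X K
  proof -
    have X: "2 \<le> X" by (rule V_ge2[OF V])
    have X64: "64 \<le> X ^ 6" using power_mono[OF X, of 6] by simp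
    define q where "q i = (nx I ^^ i) 0" for i
    define S where "S i = (\<Sum>l<i. ct I (q l))" for i
    have q: "q 0 = 0" "q (Suc i) = nx I (q i)" "i \<le> K \<Longrightarrow> q i \<le> 2 ^ (X ^ c)" for i using b1 by (auto simp: q_def)
    have S: "S 0 = 0" "S (Suc i) = S i + ct I (q i)" "i \<le> K \<Longrightarrow> S i \<le> 2 ^ (X ^ c)" for i using b2 by (auto simp: S_def q_def)
    have TE: "T I \<le> 2 ^ (X ^ E)" using pow2_exp_mono[OF V _ DT[OF V, of "[]"], of E] by (auto simp: E_def)
    have qE: "i \<le> K \<Longrightarrow> q i \<le> 2 ^ (X ^ E)" for i using pow2_exp_mono[OF V _ q(3), of E] by (auto simp: E_def)
    define Inv where "Inv i m \<longleftrightarrow> inp I m \<and> m 2 0 = S i \<and> m 3 0 = q i \<and> m 4 0 = T I" for i m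
    have body: "runs body m (X ^ Tb) (Inv (Suc i))" if i: "i < K" and inv: "Inv i m" for i m
      unfolding body_def Tb_def
    proof (rule runs_Seq[OF cptD[OF pc V]])
      show "inp I m" using inv by (simp add: Inv_def)
      show "m a 0 \<le> 2 ^ X ^ c" if "a \<in> set [3]" for a using that inv q(3) i by (auto simp: Inv_def)
      show "X ^ Dc + X ^ ((c + 5) + (Dn + (c + 4) + 1) + 1) \<le> X ^ (Dc + ((c + 5) + (Dn + (c + 4) + 1) + 1) + 1)"
        by (rule poly_add[OF X]) auto
      fix m1 assume m1: "m1 5 0 = ct I (hd (map (\<lambda>a. m a 0) [3])) \<and> (\<forall>a<5. m1 a = m a)"
      have m1': "m1 5 0 = ct I (q i)" "Inv i m1" using m1 inv by (auto simp: Inv_def inp_def)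
      show "runs (Seq (Store 2 (Const 0) (Plus (Cell 2 (Const 0)) (Cell 5 (Const 0)))) (Seq pn (Store 3 (Const 0) (Cell 5 (Const 0)))))
        m1 (X ^ ((c + 5) + (Dn + (c + 4) + 1) + 1)) (Inv (Suc i))"
      proof (rule runs_Seq[OF runs_accumulate[OF X, where P = "\<lambda>m. inp I m \<and> m 2 0 = S (Suc i) \<and> m 3 0 = q i \<and> m 4 0 = T I"]])
        show "m1 2 0 \<le> 2 ^ X ^ c" using m1' S(3)[of i] i by (simp add: Inv_def)
        show *: "m1 2 0 + m1 5 0 \<le> 2 ^ X ^ c" using m1' S(3)[of "Suc i"] S(2)[of i] i by (simp add: Inv_def)
        then show "m1 5 0 \<le> 2 ^ X ^ c" by simp
        show "X ^ (c + 5) + X ^ (Dn + (c + 4) + 1) \<le> X ^ ((c + 5) + (Dn + (c + 4) + 1) + 1)" by (rule poly_add[OF X]) auto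
        fix m2 assume m2: "inp I m2 \<and> m2 2 0 = S (Suc i) \<and> m2 3 0 = q i \<and> m2 4 0 = T I"
        show "runs (Seq pn (Store 3 (Const 0) (Cell 5 (Const 0)))) m2 (X ^ (Dn + (c + 4) + 1)) (Inv (Suc i))"
        proof (rule runs_Seq[OF cptD[OF pn V]])
          show "inp I m2" using m2 by simp
          show "m2 a 0 \<le> 2 ^ X ^ c" if "a \<in> set [3]" for a using that m2 q(3) i by auto
          show "X ^ Dn + X ^ (c + 4) \<le> X ^ (Dn + (c + 4) + 1)" by (rule poly_add[OF X]) auto
          fix m3 assume "m3 5 0 = nx I (hd (map (\<lambda>a. m2 a 0) [3])) \<and> (\<forall>a<5. m3 a = m2 a)"
          then show "runs (Store 3 (Const 0) (Cell 5 (Const 0))) m3 (X ^ (c + 4)) (Inv (Suc i))"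
            using m2 q(2)[of i] q(3)[of "Suc i"] i by (intro runs_copy[OF X]) (auto simp: Inv_def inp_def)
        qed
      qed (use m1' in \<open>auto simp: Inv_def inp_def S(2)\<close>)
    qed
    have loop: "runs (While ?g body) m ((K - 0 + 1) * (X ^ (E + 6) + X ^ Tb)) (Inv K)" if "Inv 0 m" for m
    proof (rule runs_While[where Inv = Inv and i = 0 and k = K, OF _ _ _ that])
      fix i m assume i: "i \<le> K" and inv: "Inv i m"
      have "len (T I) \<le> X ^ E + 2" "len (q i) \<le> X ^ E + 2" "len (T I - q i) \<le> X ^ E + 2"
        using TE qE[OF i] by - (rule len_le; linarith)+
      moreover have "1 \<le> X ^ E" using X by simp
      moreover have "64 * X ^ E \<le> X ^ (E + 6)"
        using mult_right_mono[OF X64, of "X ^ E"] by (simp add: power_add mult.commute)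
      ultimately show "cost ?g m + len (val ?g m) \<le> X ^ (E + 6)"
        using inv by (simp add: Inv_def len_def[of 0] floorlog_def[of _ 0])
    next
      fix i m assume i: "i < K" and inv: "Inv i m"
      show "val ?g m \<noteq> 0 \<and> runs body m (X ^ Tb) (Inv (Suc i))"
        using body[OF i inv] lt i inv by (auto simp: Inv_def q_def)
    next
      fix m assume "Inv K m"
      then show "val ?g m = 0" using ge by (simp add: Inv_def q_def)
    qed simp
    have init: "runs (Seq (Store 2 (Const 0) (Const 0)) (Seq (Store 3 (Const 0) (Const 0)) pT)) (input_memory I) (X ^ Ti) (Inv 0)"
      unfolding Ti_def
    proof (rule runs_Seq[OF runs_zero[OF X, where P = "\<lambda>m. inp I m \<and> m 2 0 = 0"]])
      show "X ^ 2 + X ^ (2 + DpT + 1) \<le> X ^ (2 + (2 + DpT + 1) + 1)" by (rule poly_add[OF X]) auto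
      fix m1 assume m1: "inp I m1 \<and> m1 2 0 = 0"
      show "runs (Seq (Store 3 (Const 0) (Const 0)) pT) m1 (X ^ (2 + DpT + 1)) (Inv 0)"
      proof (rule runs_Seq[OF runs_zero[OF X, where P = "\<lambda>m. inp I m \<and> m 2 0 = 0 \<and> m 3 0 = 0"]])
        show "X ^ 2 + X ^ DpT \<le> X ^ (2 + DpT + 1)" by (rule poly_add[OF X]) auto
        fix m2 assume m2: "inp I m2 \<and> m2 2 0 = 0 \<and> m2 3 0 = 0"
        show "runs pT m2 (X ^ DpT) (Inv 0)"
          by (rule runs_mono[OF cptD[OF pT V]]) (use m2 in \<open>auto simp: Inv_def q S inp_def\<close>)
      qed (use m1 in \<open>auto simp: inp_def\<close>)
    qed (auto simp: inp_def)
    have exit: "runs (Seq pf (Store 0 (Const 0) (Cell 5 (Const 0)))) m (X ^ Te) (\<lambda>m. m 0 0 = fin I (S K))"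
      if inv: "Inv K m" for m
      unfolding Te_def
    proof (rule runs_Seq[OF cptD[OF pf V]])
      show "inp I m" using inv by (simp add: Inv_def)
      show "m a 0 \<le> 2 ^ X ^ c" if "a \<in> set [2]" for a using that inv S(3) by (auto simp: Inv_def)
      show "X ^ Dpf + X ^ (Df + 4) \<le> X ^ (Dpf + (Df + 4) + 1)" by (rule poly_add[OF X]) auto
      fix m1 assume m1: "m1 5 0 = fin I (hd (map (\<lambda>a. m a 0) [2])) \<and> (\<forall>a<5. m1 a = m a)"
      have "fin I (hd [S K]) \<le> 2 ^ X ^ Df" by (rule Df[OF V]) (use S(3) in auto)
      then show "runs (Store 0 (Const 0) (Cell 5 (Const 0))) m1 (X ^ (Df + 4)) (\<lambda>m. m 0 0 = fin I (S K))"
        using m1 inv by (intro runs_copy[OF X]) (auto simp: Inv_def)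
    qed
    have TiTw: "(K + 1) * X ^ Tw + X ^ Te \<le> (K + 1) * X ^ (Tw + Te + 1)"
    proof -
      have "(K + 1) * X ^ Tw + X ^ Te \<le> (K + 1) * (X ^ Tw + X ^ Te)" by (simp add: algebra_simps)
      also have "\<dots> \<le> (K + 1) * X ^ (Tw + Te + 1)" by (intro mult_left_mono poly_add[OF X]) auto
      finally show ?thesis .
    qed
    have DD: "X ^ Ti + (K + 1) * X ^ (Tw + Te + 1) \<le> (K + 1) * X ^ D"
    proof -
      have "X ^ Ti + (K + 1) * X ^ (Tw + Te + 1) \<le> (K + 1) * (X ^ Ti + X ^ (Tw + Te + 1))" by (simp add: algebra_simps)
      also have "\<dots> \<le> (K + 1) * X ^ D" unfolding D_def by (intro mult_left_mono poly_add[OF X]) auto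
      finally show ?thesis .
    qed
    have loop': "runs (While ?g body) m ((K + 1) * X ^ Tw) (Inv K)" if "Inv 0 m" for m
      using loop[OF that]
    proof (rule runs_mono)
      show "(K - 0 + 1) * (X ^ (E + 6) + X ^ Tb) \<le> (K + 1) * X ^ Tw"
        unfolding Tw_def minus_nat.diff_0 by (intro mult_left_mono poly_add[OF X]) auto
    qed
    have "runs (Seq (Seq (Store 2 (Const 0) (Const 0)) (Seq (Store 3 (Const 0) (Const 0)) pT))
       (Seq (While ?g body) (Seq pf (Store 0 (Const 0) (Cell 5 (Const 0)))))) (input_memory I) ((K + 1) * X ^ D)
       (\<lambda>m. m 0 0 = fin I (S K))"
      by (rule runs_Seq[OF init runs_Seq[OF loop' exit TiTw] DD])
    then show ?thesis unfolding P_def S_def q_def .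
  qed
  then show ?thesis by blast
qed

end

section \<open>The algorithm\<close>

text \<open>Input 0 encodes the pattern \<open>H\<close> and input 1 the host \<open>G\<close>.\<close>

definition num_verts :: "nat list list \<Rightarrow> nat \<Rightarrow> nat" where
  "num_verts I b = input_memory I b 0"

text \<open>Here and below, \<open>min\<close> only serves to bound the number of iterations for meaningless arguments too.\<close>

definition list_start :: "nat list list \<Rightarrow> nat \<Rightarrow> nat \<Rightarrow> nat" where
  "list_start I b x = ((\<lambda>i. i + 1 + input_memory I b i) ^^ min x (num_verts I b)) 1"

definition has_arc :: "nat list list \<Rightarrow> nat \<Rightarrow> nat \<Rightarrow> nat \<Rightarrow> bool" where
  "has_arc I b x y \<longleftrightarrow> (\<exists>k<input_memory I b (list_start I b x). input_memory I b (list_start I b x + 1 + k) = y)"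

text \<open>At least the number of vertices of either digraph, so truncating an exponent at this
  value changes nothing for vertices of H or of G.\<close>

definition bit_limit :: "nat list list \<Rightarrow> nat" where
  "bit_limit I = num_verts I 0 + num_verts I 1"

definition has_bit :: "nat list list \<Rightarrow> nat \<Rightarrow> nat \<Rightarrow> bool" where
  "has_bit I m x \<longleftrightarrow> odd (m div 2 ^ min x (bit_limit I))"

text \<open>A vertex set is a bitmask, and each round adds the out-neighbours under
  \<open>R\<close>. The number of rounds comes from H for both inputs: on H it yields the
  reflexive-transitive closure, on G a ball whose size depends only on the parameters.\<close>

definition closure_mask :: "nat list list \<Rightarrow> nat \<Rightarrow> (nat \<Rightarrow> nat \<Rightarrow> bool) \<Rightarrow> nat \<Rightarrow> nat" where
  "closure_mask I b R g = ((\<lambda>m. \<Sum>y<num_verts I b. 2 ^ min y (bit_limit I) * of_bool (\<exists>x<num_verts I b. has_bit I m x \<and> (x = y \<or> R x y)))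
     ^^ (num_verts I 0 * num_verts I 0)) (\<Sum>y<num_verts I b. 2 ^ min y (bit_limit I) * of_bool (y = g))"

definition reaches :: "nat list list \<Rightarrow> nat \<Rightarrow> nat \<Rightarrow> bool" where
  "reaches I u v \<longleftrightarrow> has_bit I (closure_mask I 0 (has_arc I 0) u) v"

definition ball_mask :: "nat list list \<Rightarrow> nat \<Rightarrow> nat" where
  "ball_mask I g = closure_mask I 1 (has_arc I 1) g"

text \<open>Membership in a source of the condensation, tested without forming strongly connected
  components.\<close>

definition in_source :: "nat list list \<Rightarrow> nat \<Rightarrow> bool" where
  "in_source I v \<longleftrightarrow> (\<forall>u<num_verts I 0. reaches I u v \<longrightarrow> reaches I v u)"

text \<open>Most significant digit first, so that a prefix of the digit sequence is a quotient of the code.\<close>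

definition digit :: "nat \<Rightarrow> nat \<Rightarrow> nat \<Rightarrow> nat \<Rightarrow> nat" where
  "digit b k q v = q div b ^ (k - 1 - v) mod b"

text \<open>\<open>a\<close> codes a 0-1 matrix, that is, a set of pairs of vertices of \<open>H\<close>.\<close>

definition identified :: "nat list list \<Rightarrow> nat \<Rightarrow> nat \<Rightarrow> nat \<Rightarrow> bool" where
  "identified I a u v \<longleftrightarrow> digit 2 (num_verts I 0 * num_verts I 0) a (u * num_verts I 0 + v) = 1"

text \<open>The classes of \<open>linked\<close> are the source components of H glued along the
  pairs in \<open>a\<close>. Arcs need to be followed forwards only, since inside a source component
  each of them lies on a cycle. Identifications with vertices outside the source components create
  no link; they remain as constraints.\<close>

definition link_step :: "nat list list \<Rightarrow> nat \<Rightarrow> nat \<Rightarrow> nat \<Rightarrow> bool" where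
  "link_step I a u v \<longleftrightarrow> in_source I u \<and> in_source I v \<and> (has_arc I 0 u v \<or> identified I a u v \<or> identified I a v u)"

definition linked :: "nat list list \<Rightarrow> nat \<Rightarrow> nat \<Rightarrow> nat \<Rightarrow> bool" where
  "linked I a u v \<longleftrightarrow> has_bit I (closure_mask I 0 (link_step I a) u) v"

definition ball_size :: "nat list list \<Rightarrow> nat \<Rightarrow> nat" where
  "ball_size I g = (\<Sum>x<num_verts I 1. of_bool (has_bit I (ball_mask I g) x))"

text \<open>Enumerates the ball by rank, with exactly one nonzero summand at most. This allows maps
  into a ball to be coded by numbers in base \<open>ball_size I g\<close>.\<close>

definition ball_elt :: "nat list list \<Rightarrow> nat \<Rightarrow> nat \<Rightarrow> nat" where
  "ball_elt I g t = (\<Sum>x<num_verts I 1. x * of_bool (has_bit I (ball_mask I g) x \<and>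
     (\<Sum>y<num_verts I 1. of_bool (y < x \<and> has_bit I (ball_mask I g) y)) = t))"

text \<open>
  \<open>Q\<close> codes a map on \<open>C\<close>, with digits 0 elsewhere.  The glued source component of \<open>r\<close> is mapped into the
  ball around the image \<open>g\<close> of \<open>r\<close>; the digits of \<open>p\<close> select the elements of that ball.
\<close>

definition assigned :: "nat list list \<Rightarrow> nat \<Rightarrow> nat \<Rightarrow> nat \<Rightarrow> nat \<Rightarrow> nat \<Rightarrow> nat \<Rightarrow> nat" where
  "assigned I Q a r g p v = (if linked I a r v then ball_elt I g (digit (ball_size I g) (num_verts I 0) p v) else digit (num_verts I 1) (num_verts I 0) Q v)"

text \<open>Demanding \<open>u < v\<close> makes every matrix with an entry on or below the diagonal
  contribute 0. So \<open>a\<close> may range over all matrices, while inclusion-exclusion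
  effectively runs over sets of unordered pairs.\<close>

definition arc_constraint :: "nat list list \<Rightarrow> nat \<Rightarrow> nat \<Rightarrow> nat \<Rightarrow> nat \<Rightarrow> nat \<Rightarrow> bool" where
  "arc_constraint I a u v x y \<longleftrightarrow> (has_arc I 0 u v \<longrightarrow> has_arc I 1 x y) \<and> (identified I a u v \<longrightarrow> u < v \<and> x = y)"

text \<open>Fixing the digits outside the glued component makes the code of a map unique, and the
  condition on the image of r separates the maps counted for different centres g. The constraints
  tested are those among the glued component and the vertices outside all source components.\<close>

definition extension_test :: "nat list list \<Rightarrow> nat \<Rightarrow> nat \<Rightarrow> nat \<Rightarrow> nat \<Rightarrow> nat \<Rightarrow> bool" where
  "extension_test I Q a r g p \<longleftrightarrow>
     (\<forall>v<num_verts I 0. \<not> linked I a r v \<longrightarrow> digit (ball_size I g) (num_verts I 0) p v = 0) \<and> assigned I Q a r g p r = g \<and>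
     (\<forall>u<num_verts I 0. \<forall>v<num_verts I 0. (in_source I u \<longrightarrow> linked I a r u) \<and> (in_source I v \<longrightarrow> linked I a r v) \<longrightarrow>
        arc_constraint I a u v (assigned I Q a r g p u) (assigned I Q a r g p v))"

definition component_count :: "nat list list \<Rightarrow> nat \<Rightarrow> nat \<Rightarrow> nat \<Rightarrow> nat" where
  "component_count I Q a r = (\<Sum>g<num_verts I 1. \<Sum>p<ball_size I g ^ num_verts I 0. of_bool (extension_test I Q a r g p))"

text \<open>The product runs over the least vertices of the glued source components.\<close>

definition extension_count :: "nat list list \<Rightarrow> nat \<Rightarrow> nat \<Rightarrow> nat" where
  "extension_count I Q a = of_bool (\<forall>u<num_verts I 0. \<forall>v<num_verts I 0. \<not> in_source I u \<and> \<not> in_source I v \<longrightarrow>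
       arc_constraint I a u v (digit (num_verts I 1) (num_verts I 0) Q u) (digit (num_verts I 1) (num_verts I 0) Q v)) *
     (\<Prod>r<num_verts I 0. if in_source I r \<and> (\<forall>u<num_verts I 0. u < r \<longrightarrow> in_source I u \<longrightarrow> \<not> linked I a u r) then component_count I Q a r else 1)"

definition num_ones :: "nat list list \<Rightarrow> nat \<Rightarrow> nat" where
  "num_ones I a = (\<Sum>c<num_verts I 0 * num_verts I 0. digit 2 (num_verts I 0 * num_verts I 0) a c)"

text \<open>The truncated subtraction is exact, since the difference counts the injective extensions of \<open>Q\<close>.\<close>

definition embedding_count :: "nat list list \<Rightarrow> nat \<Rightarrow> nat" where
  "embedding_count I Q = (\<Sum>a<2 ^ (num_verts I 0 * num_verts I 0). of_bool (even (num_ones I a)) * extension_count I Q a) -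
     (\<Sum>a<2 ^ (num_verts I 0 * num_verts I 0). of_bool (odd (num_ones I a)) * extension_count I Q a)"

text \<open>The target is a parameter: input 1 gives induced embeddings into G, input 0 gives the
  automorphisms of H.\<close>

definition induced_embedding :: "nat list list \<Rightarrow> nat \<Rightarrow> nat \<Rightarrow> nat \<Rightarrow> bool" where
  "induced_embedding I b n Q \<longleftrightarrow> (\<forall>u<num_verts I 0. \<forall>v<num_verts I 0. (has_arc I 0 u v \<longleftrightarrow> has_arc I b (digit n (num_verts I 0) Q u) (digit n (num_verts I 0) Q v)) \<and>
     (u \<noteq> v \<longrightarrow> digit n (num_verts I 0) Q u \<noteq> digit n (num_verts I 0) Q v))"

definition automorphism_count :: "nat list list \<Rightarrow> nat" where
  "automorphism_count I = (\<Sum>q<num_verts I 0 ^ num_verts I 0. of_bool (induced_embedding I 0 (num_verts I 0) q))"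

text \<open>Only the first j digits are inspected, so goodness is a property of prefixes. Every
  vertex s is tried as a starting point; neither the roots of the sources nor a cover enters the
  test.\<close>

definition good :: "(nat list list \<Rightarrow> nat \<Rightarrow> bool) \<Rightarrow> nat list list \<Rightarrow> nat \<Rightarrow> nat \<Rightarrow> bool" where
  "good C I j Q \<longleftrightarrow> (\<forall>v<num_verts I 0. v < j \<and> \<not> C I v \<longrightarrow> digit (num_verts I 1) (num_verts I 0) Q v = 0) \<and>
     (\<forall>s<num_verts I 0. \<exists>g<num_verts I 1. \<forall>v<num_verts I 0. v < j \<and> C I v \<and> reaches I s v \<longrightarrow> has_bit I (ball_mask I g) (digit (num_verts I 1) (num_verts I 0) Q v))"

text \<open>
  If the first \<open>k\<close> digits form the longest good prefix, the codes that agree with \<open>Q\<close> on the first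
  \<open>k + 1\<close> digits are all bad.  For \<open>k = num_verts I 0\<close> the exponent truncates to 0.
\<close>

definition skip_width :: "(nat list list \<Rightarrow> nat \<Rightarrow> bool) \<Rightarrow> nat list list \<Rightarrow> nat \<Rightarrow> nat" where
  "skip_width C I Q = num_verts I 1 ^ (num_verts I 0 - 1 - (\<Sum>j<num_verts I 0. of_bool (good C I (Suc j) Q)))"

text \<open>The first code behind the block of width \<open>skip_width C I Q\<close> that contains
  Q.\<close>

definition next_code :: "(nat list list \<Rightarrow> nat \<Rightarrow> bool) \<Rightarrow> nat list list \<Rightarrow> nat \<Rightarrow> nat" where
  "next_code C I Q = (Q div skip_width C I Q + 1) * skip_width C I Q"

section \<open>Programs for the expressions of the search\<close>

context ram
begin

lemma impl_comp1:
  assumes "impl (\<lambda>I s. F I (hd s))" "impl a" shows "impl (\<lambda>I s. F I (a I s))"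
  using impl_cons[OF assms(2,1)] by simp

lemma impl_comp2:
  assumes F: "impl (\<lambda>I s. F I (hd (tl s)) (hd s))" and a: "impl a" and b: "impl b"
  shows "impl (\<lambda>I s. F I (a I s) (b I s))"
  using impl_cons[OF a impl_cons[OF impl_weaken[OF b] F]] by simp

lemma impl_comp3:
  assumes F: "impl (\<lambda>I s. F I (hd (tl (tl s))) (hd (tl s)) (hd s))" and a: "impl a" and b: "impl b" and c: "impl c"
  shows "impl (\<lambda>I s. F I (a I s) (b I s) (c I s))"
  using impl_cons[OF a impl_cons[OF impl_weaken[OF b] impl_cons[OF impl_weaken[OF impl_weaken[OF c]] F]]] by simp

lemma impl_comp5:
  assumes F: "impl (\<lambda>I s. F I (hd (tl (tl (tl (tl s))))) (hd (tl (tl (tl s)))) (hd (tl (tl s))) (hd (tl s)) (hd s))"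
    and a: "impl a" and b: "impl b" and c: "impl c" and d: "impl d" and e: "impl e"
  shows "impl (\<lambda>I s. F I (a I s) (b I s) (c I s) (d I s) (e I s))"
  using impl_cons[OF a impl_cons[OF impl_weaken[OF b] impl_cons[OF impl_weaken[OF impl_weaken[OF c]]
    impl_cons[OF impl_weaken[OF impl_weaken[OF impl_weaken[OF d]]]
    impl_cons[OF impl_weaken[OF impl_weaken[OF impl_weaken[OF impl_weaken[OF e]]]] F]]]]] by simp

lemma impl_num_verts: "b < 2 \<Longrightarrow> impl (\<lambda>I s. num_verts I b)"
  unfolding num_verts_def by (intro impl_input impl_const)

lemma loopb_num_verts: "loopb (\<lambda>I s. num_verts I b)"
  unfolding num_verts_def by (rule loopb_input)

lemma off_bound: "V I X \<Longrightarrow> ((\<lambda>i. i + 1 + input_memory I b i) ^^ n) 1 \<le> 1 + n * (X + 1)"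
proof (induction n)
  case (Suc n)
  then show ?case using V_input[of I X b "((\<lambda>i. i + 1 + input_memory I b i) ^^ n) 1"] by simp
qed simp

lemma impl_list_start:
  assumes "b < 2" "impl x" shows "impl (\<lambda>I s. list_start I b (x I s))"
  unfolding list_start_def
proof (rule impl_comp1[OF _ assms(2)], rule impl_funpow)
  show "impl (\<lambda>I s. min (hd s) (num_verts I b))" by (intro impl_intros impl_num_verts assms)
  show "loopb (\<lambda>I s. min (hd s) (num_verts I b))" by (intro loopb_intros loopb_num_verts)
  show "impl (\<lambda>I s. hd s + 1 + input_memory I b (hd s))" by (intro impl_intros impl_input assms)
  fix I X i and s :: "nat list" assume V: "V I X" and i: "i \<le> min (hd s) (num_verts I b)"
  have X: "2 \<le> X" by (rule V_ge2[OF V])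
  have "i \<le> X" using i V_input[OF V, of b 0] by (simp add: num_verts_def)
  then have "1 + i * (X + 1) \<le> X ^ 3 * 1"
  proof -
    have "1 + i * (X + 1) \<le> 1 + X * (X + 1)" using \<open>i \<le> X\<close> by (intro add_mono mult_right_mono) auto
    also have "\<dots> \<le> 2 * (X * X)" using X by (cases X) auto
    also have "\<dots> \<le> X * (X * X)" using X by (intro mult_right_mono) auto
    finally show ?thesis by (simp add: eval_nat_numeral)
  qed
  then have "((\<lambda>i. i + 1 + input_memory I b i) ^^ i) 1 \<le> X ^ 3" using off_bound[OF V, where b = b and n = i] by linarith
  then show "((\<lambda>i. i + 1 + input_memory I b i) ^^ i) 1 \<le> 2 ^ X ^ 3" by (rule poly_pow2[OF X])
qed (rule impl_const)

lemma impl_has_arc: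
  assumes "b < 2" "impl x" "impl y" shows "impl (\<lambda>I s. of_bool (has_arc I b (x I s) (y I s)))"
proof (rule impl_comp2[OF _ assms(2,3)])
  show "impl (\<lambda>I s. of_bool (has_arc I b (hd (tl s)) (hd s)))"
    unfolding has_arc_def by (intro impl_intros impl_input impl_list_start assms loopb_intros)
qed

lemma impl_lim: "impl (\<lambda>I s. bit_limit I)"
  unfolding bit_limit_def by (intro impl_intros impl_num_verts) auto

lemma loopb_lim: "loopb (\<lambda>I s. bit_limit I)"
  unfolding bit_limit_def by (intro loopb_intros loopb_num_verts)

lemma impl_has_bit:
  assumes "impl m" "impl x" shows "impl (\<lambda>I s. of_bool (has_bit I (m I s) (x I s)))"
  unfolding has_bit_def by (intro impl_intros impl_lim loopb_intros loopb_lim assms)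

lemma sum_pow2_le: "(\<Sum>y<n. 2 ^ min y l * of_bool (P y)) \<le> (2::nat) ^ n"
proof -
  have "(\<Sum>y<n. 2 ^ min y l * of_bool (P y)) \<le> (\<Sum>y<n. 2 ^ y :: nat)"
    by (intro sum_mono) auto
  also have "\<dots> \<le> 2 ^ n" by (induction n) auto
  finally show ?thesis .
qed

text \<open>Every iterate is a sum of distinct powers of 2 below 2 to the number of vertices, which
  gives the bound needed for the iteration. The argument \<open>e\<close> makes room for a relation
  that depends on a computed value, as \<open>link_step\<close> does on \<open>a\<close>.\<close>

lemma impl_closure_mask:
  assumes b: "b < 2" and e: "impl e" and g: "impl g"
    and R: "\<And>f x y. impl f \<Longrightarrow> impl x \<Longrightarrow> impl y \<Longrightarrow> impl (\<lambda>I s. of_bool (R I (f I s) (x I s) (y I s)))"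
  shows "impl (\<lambda>I s. closure_mask I b (R I (e I s)) (g I s))"
proof (rule impl_comp2[OF _ e g])
  show "impl (\<lambda>I s. closure_mask I b (R I (hd (tl s))) (hd s))"
    unfolding closure_mask_def
  proof (rule impl_funpow)
    show "impl (\<lambda>I s. num_verts I 0 * num_verts I 0)" by (intro impl_intros impl_num_verts) auto
    show "loopb (\<lambda>I s. num_verts I 0 * num_verts I 0)" by (intro loopb_intros loopb_num_verts)
    show "impl (\<lambda>I s. \<Sum>y<num_verts I b. 2 ^ min y (bit_limit I) * of_bool (y = hd s))"
      by (intro impl_intros impl_num_verts impl_lim loopb_intros loopb_num_verts loopb_lim b)
    show "impl (\<lambda>I s. \<Sum>y<num_verts I b. 2 ^ min y (bit_limit I) * of_bool (\<exists>x<num_verts I b. has_bit I (hd s) x \<and> (x = y \<or> R I (hd (tl (tl (tl s)))) x y)))"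
      by (intro impl_intros R impl_has_bit impl_num_verts impl_lim loopb_intros loopb_num_verts loopb_lim b)
    fix I X i and s :: "nat list" assume V: "V I X"
    have le: "(2::nat) ^ num_verts I b \<le> 2 ^ X" using V_input[OF V] by (simp add: num_verts_def)
    show "((\<lambda>m. \<Sum>y<num_verts I b. (2::nat) ^ min y (bit_limit I) * of_bool (\<exists>x<num_verts I b. has_bit I m x \<and> (x = y \<or> R I (hd (tl s)) x y))) ^^ i)
       (\<Sum>y<num_verts I b. 2 ^ min y (bit_limit I) * of_bool (y = hd s)) \<le> 2 ^ X ^ 1"
      by (cases i) (simp_all only: funpow.simps comp_apply id_apply power_one_right order_trans[OF sum_pow2_le le])
  qed
qed

lemma impl_reaches:
  assumes "impl u" "impl v" shows "impl (\<lambda>I s. of_bool (reaches I (u I s) (v I s)))"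
  unfolding reaches_def
  by (intro impl_has_bit impl_closure_mask[where R = "\<lambda>I e. has_arc I 0" and e = "\<lambda>I s. 0"] impl_const impl_has_arc assms) auto

lemma impl_ball_mask:
  assumes "impl g" shows "impl (\<lambda>I s. ball_mask I (g I s))"
  unfolding ball_mask_def
  by (intro impl_closure_mask[where R = "\<lambda>I e. has_arc I 1" and e = "\<lambda>I s. 0"] impl_const impl_has_arc assms) auto

lemma impl_in_source:
  assumes "impl v" shows "impl (\<lambda>I s. of_bool (in_source I (v I s)))"
proof (rule impl_comp1[OF _ assms])
  show "impl (\<lambda>I s. of_bool (in_source I (hd s)))"
    unfolding in_source_def by (intro impl_intros impl_reaches impl_num_verts loopb_num_verts) auto
qed

lemma impl_digit:
  assumes "impl b" "impl k" "loopb k" "impl q" "impl v"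
  shows "impl (\<lambda>I s. digit (b I s) (k I s) (q I s) (v I s))"
  unfolding digit_def by (intro impl_intros assms loopb_intros)

lemma impl_identified:
  assumes "impl a" "impl u" "impl v" shows "impl (\<lambda>I s. of_bool (identified I (a I s) (u I s) (v I s)))"
  unfolding identified_def by (intro impl_intros impl_digit impl_num_verts assms loopb_intros loopb_num_verts) auto

lemma impl_link_step:
  assumes "impl a" "impl u" "impl v" shows "impl (\<lambda>I s. of_bool (link_step I (a I s) (u I s) (v I s)))"
  unfolding link_step_def by (intro impl_intros impl_in_source impl_has_arc impl_identified assms) auto

lemma impl_linked:
  assumes "impl a" "impl u" "impl v" shows "impl (\<lambda>I s. of_bool (linked I (a I s) (u I s) (v I s)))"
  unfolding linked_def by (intro impl_has_bit impl_closure_mask[where R = link_step] impl_link_step assms) auto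

lemma impl_ball_size:
  assumes "impl g" shows "impl (\<lambda>I s. ball_size I (g I s))"
proof (rule impl_comp1[OF _ assms])
  show "impl (\<lambda>I s. ball_size I (hd s))"
    unfolding ball_size_def by (intro impl_intros impl_has_bit impl_ball_mask impl_num_verts loopb_num_verts) auto
qed

lemma impl_ball_elt:
  assumes "impl g" "impl t" shows "impl (\<lambda>I s. ball_elt I (g I s) (t I s))"
proof (rule impl_comp2[OF _ assms])
  show "impl (\<lambda>I s. ball_elt I (hd (tl s)) (hd s))"
    unfolding ball_elt_def by (intro impl_intros impl_has_bit impl_ball_mask impl_num_verts loopb_num_verts) auto
qed

lemma impl_arc_constraint:
  assumes "impl a" "impl u" "impl v" "impl x" "impl y"
  shows "impl (\<lambda>I s. of_bool (arc_constraint I (a I s) (u I s) (v I s) (x I s) (y I s)))"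
  unfolding arc_constraint_def by (intro impl_intros impl_has_arc impl_identified assms) auto

lemma impl_assigned:
  assumes "impl Q" "impl a" "impl r" "impl g" "impl p" "impl v"
  shows "impl (\<lambda>I s. assigned I (Q I s) (a I s) (r I s) (g I s) (p I s) (v I s))"
  unfolding assigned_def by (intro impl_intros impl_linked impl_ball_elt impl_digit impl_ball_size impl_num_verts loopb_num_verts assms) auto

lemma impl_extension_test:
  assumes "impl Q" "impl a" "impl r" "impl g" "impl p"
  shows "impl (\<lambda>I s. of_bool (extension_test I (Q I s) (a I s) (r I s) (g I s) (p I s)))"
proof (rule impl_comp5[OF _ assms])
  show "impl (\<lambda>I s. of_bool (extension_test I (hd (tl (tl (tl (tl s))))) (hd (tl (tl (tl s)))) (hd (tl (tl s))) (hd (tl s)) (hd s)))"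
    unfolding extension_test_def by (intro impl_intros impl_linked impl_in_source impl_digit impl_ball_size impl_arc_constraint impl_assigned impl_num_verts loopb_num_verts) auto
qed

lemma impl_num_ones:
  assumes "impl a" shows "impl (\<lambda>I s. num_ones I (a I s))"
proof (rule impl_comp1[OF _ assms])
  show "impl (\<lambda>I s. num_ones I (hd s))"
    unfolding num_ones_def by (intro impl_intros impl_digit impl_num_verts loopb_intros loopb_num_verts) auto
qed

lemma impl_induced_embedding:
  assumes "b < 2" "impl n" "impl q" shows "impl (\<lambda>I s. of_bool (induced_embedding I b (n I s) (q I s)))"
proof (rule impl_comp2[OF _ assms(2,3)])
  show "impl (\<lambda>I s. of_bool (induced_embedding I b (hd (tl s)) (hd s)))"
    unfolding induced_embedding_def by (intro impl_intros impl_has_arc impl_digit impl_num_verts loopb_num_verts assms) auto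
qed

lemma impl_good:
  assumes C: "\<And>v. impl v \<Longrightarrow> impl (\<lambda>I s. of_bool (C I (v I s)))" and "impl j" "impl q"
  shows "impl (\<lambda>I s. of_bool (good C I (j I s) (q I s)))"
proof (rule impl_comp2[OF _ assms(2,3)])
  show "impl (\<lambda>I s. of_bool (good C I (hd (tl s)) (hd s)))"
    unfolding good_def by (intro impl_intros C impl_reaches impl_has_bit impl_ball_mask impl_digit impl_num_verts loopb_num_verts) auto
qed

lemma impl_skip_width:
  assumes C: "\<And>v. impl v \<Longrightarrow> impl (\<lambda>I s. of_bool (C I (v I s)))" and "impl q"
  shows "impl (\<lambda>I s. skip_width C I (q I s))"
proof (rule impl_comp1[OF _ assms(2)])
  show "impl (\<lambda>I s. skip_width C I (hd s))"
    unfolding skip_width_def Suc_eq_plus1 by (intro impl_intros impl_good C impl_num_verts loopb_intros loopb_num_verts) auto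
qed

lemma impl_next_code:
  assumes C: "\<And>v. impl v \<Longrightarrow> impl (\<lambda>I s. of_bool (C I (v I s)))" and "impl q"
  shows "impl (\<lambda>I s. next_code C I (q I s))"
  unfolding next_code_def by (intro impl_intros impl_skip_width assms)

end

text \<open>Three counts are exponential in the pattern but bounded by the parameters: the sets of
  identified pairs, the candidate automorphisms, and the maps into one ball. Having X dominate them
  admits them as loop bounds.\<close>

locale ram_pattern = ram +
  assumes V_pow2: "V I X \<Longrightarrow> 2 ^ (num_verts I 0 * num_verts I 0) \<le> X"
    and V_aut: "V I X \<Longrightarrow> num_verts I 0 ^ num_verts I 0 \<le> X"
    and V_ball: "V I X \<Longrightarrow> ball_size I g ^ num_verts I 0 \<le> X"
begin

lemma loopb_V: "(\<And>I X s. V I X \<Longrightarrow> k I s \<le> X) \<Longrightarrow> loopb k"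
  unfolding loopb_def by (intro exI[of _ 1]) simp

lemma impl_component_count:
  assumes "impl Q" "impl a" "impl r" shows "impl (\<lambda>I s. component_count I (Q I s) (a I s) (r I s))"
proof (rule impl_comp3[OF _ assms])
  show "impl (\<lambda>I s. component_count I (hd (tl (tl s))) (hd (tl s)) (hd s))"
    unfolding component_count_def by (intro impl_intros impl_extension_test impl_ball_size impl_num_verts loopb_num_verts loopb_V V_ball) auto
qed

lemma impl_extension_count:
  assumes "impl Q" "impl a" shows "impl (\<lambda>I s. extension_count I (Q I s) (a I s))"
proof (rule impl_comp2[OF _ assms])
  show "impl (\<lambda>I s. extension_count I (hd (tl s)) (hd s))"
    unfolding extension_count_def by (intro impl_intros impl_in_source impl_arc_constraint impl_linked impl_component_count impl_digit impl_num_verts loopb_num_verts) auto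
qed

lemma impl_embedding_count:
  assumes "impl Q" shows "impl (\<lambda>I s. embedding_count I (Q I s))"
proof (rule impl_comp1[OF _ assms])
  show "impl (\<lambda>I s. embedding_count I (hd s))"
    unfolding embedding_count_def by (intro impl_intros impl_num_ones impl_extension_count impl_num_verts loopb_intros loopb_num_verts; (rule loopb_V, erule V_pow2)?) auto
qed

lemma impl_automorphism_count: "impl (\<lambda>I s. automorphism_count I)"
  unfolding automorphism_count_def by (intro impl_intros impl_induced_embedding impl_num_verts loopb_num_verts; (rule loopb_V, erule V_aut)?) auto

end

section \<open>Counting functions\<close>

lemma dig_less: "0 < b \<Longrightarrow> digit b k q v < b"
  by (simp add: digit_def)

lemma prefix_step:
  assumes "j < k" shows "q div b ^ (k - 1 - j) = (q div b ^ (k - j)) * b + digit b k q j"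
proof -
  have "k - j = Suc (k - 1 - j)" using assms by simp
  then have "q div b ^ (k - j) = q div b ^ (k - 1 - j) div b" by (simp only: power_Suc2 div_mult2_eq)
  then show ?thesis by (simp add: digit_def)
qed

lemma prefix_eq:
  assumes "q < b ^ k" "q' < b ^ k" "j \<le> k" "\<And>v. v < j \<Longrightarrow> digit b k q v = digit b k q' v"
  shows "q div b ^ (k - j) = q' div b ^ (k - j)"
  using assms(3,4)
proof (induction j)
  case 0
  then show ?case using assms(1,2) by simp
next
  case (Suc j)
  have "k - Suc j = k - 1 - j" by simp
  then show ?case using prefix_step[of j k q b] prefix_step[of j k q' b] Suc by auto
qed

lemma inj_on_dig: "inj_on (\<lambda>q. \<lambda>v\<in>{..<k}. digit b k q v) {..<b ^ k}"
proof (rule inj_onI)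
  fix q q' assume q: "q \<in> {..<b ^ k}" "q' \<in> {..<b ^ k}"
    and eq: "(\<lambda>v\<in>{..<k}. digit b k q v) = (\<lambda>v\<in>{..<k}. digit b k q' v)"
  have "digit b k q v = digit b k q' v" if "v < k" for v
    using fun_cong[OF eq, of v] that by simp
  then have "q div b ^ (k - k) = q' div b ^ (k - k)" using q by (intro prefix_eq) auto
  then show "q = q'" by simp
qed

text \<open>Injectivity and equal cardinalities give surjectivity. For \<open>b = 0\<close> a code
  exists only if \<open>k = 0\<close>.\<close>

lemma bij_dig: "bij_betw (\<lambda>q. \<lambda>v\<in>{..<k}. digit b k q v) {..<b ^ k} ({..<k} \<rightarrow>\<^sub>E {..<b})"
proof -
  have "(\<lambda>v\<in>{..<k}. digit b k q v) \<in> {..<k} \<rightarrow>\<^sub>E {..<b}" if "q < b ^ k" for q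
  proof (cases "b = 0")
    case True
    then have "k = 0" using that by (cases k) auto
    then show ?thesis by (simp add: restrict_def)
  next
    case False
    then show ?thesis by (auto intro: dig_less)
  qed
  then have "(\<lambda>q. \<lambda>v\<in>{..<k}. digit b k q v) ` {..<b ^ k} \<subseteq> {..<k} \<rightarrow>\<^sub>E {..<b}" by blast
  moreover have "card ((\<lambda>q. \<lambda>v\<in>{..<k}. digit b k q v) ` {..<b ^ k}) = card ({..<k} \<rightarrow>\<^sub>E {..<b})"
    using card_image[OF inj_on_dig[of b k]] by (simp add: card_PiE)
  ultimately have "(\<lambda>q. \<lambda>v\<in>{..<k}. digit b k q v) ` {..<b ^ k} = {..<k} \<rightarrow>\<^sub>E {..<b}"
    by (intro card_subset_eq) (auto intro: finite_PiE)
  then show ?thesis using inj_on_dig by (simp add: bij_betw_def)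
qed

lemma dig_surj:
  assumes "\<And>v. v < k \<Longrightarrow> f v < b"
  obtains q where "q < b ^ k" "\<And>v. v < k \<Longrightarrow> digit b k q v = f v"
proof -
  have "restrict f {..<k} \<in> {..<k} \<rightarrow>\<^sub>E {..<b}" using assms by auto
  then have "restrict f {..<k} \<in> (\<lambda>q. \<lambda>v\<in>{..<k}. digit b k q v) ` {..<b ^ k}"
    using bij_betw_imp_surj_on[OF bij_dig[of b k]] by simp
  then obtain q where q: "q < b ^ k" "(\<lambda>v\<in>{..<k}. digit b k q v) = restrict f {..<k}" by auto
  have "digit b k q v = f v" if "v < k" for v using fun_cong[OF q(2), of v] that by simp
  then show ?thesis using q(1) that by blast
qed

lemma card_PiE_Un:
  fixes N :: "'b set"
  assumes "A \<inter> B = {}"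
  shows "card {\<psi> \<in> (A \<union> B) \<rightarrow>\<^sub>E N. P (restrict \<psi> A) \<and> Q (restrict \<psi> B)} =
    card {\<chi> \<in> A \<rightarrow>\<^sub>E N. P \<chi>} * card {\<chi> \<in> B \<rightarrow>\<^sub>E N. Q \<chi>}"
proof -
  let ?L = "{\<psi> \<in> (A \<union> B) \<rightarrow>\<^sub>E N. P (restrict \<psi> A) \<and> Q (restrict \<psi> B)}"
  let ?R = "{\<chi> \<in> A \<rightarrow>\<^sub>E N. P \<chi>} \<times> {\<chi> \<in> B \<rightarrow>\<^sub>E N. Q \<chi>}"
  let ?f = "\<lambda>\<psi>. (restrict \<psi> A, restrict \<psi> B)"
  let ?g = "\<lambda>x v. if v \<in> A then fst x v else snd x v"
  have fg: "?f (?g x) = x" if "x \<in> ?R" for x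
  proof -
    have "restrict (?g x) A = fst x"
      using that by (intro extensionalityI[of _ A]) (auto simp: PiE_iff)
    moreover have "restrict (?g x) B = snd x"
      using that assms by (intro extensionalityI[of _ B]) (auto simp: PiE_iff)
    ultimately show ?thesis by simp
  qed
  have "bij_betw ?f ?L ?R"
  proof (rule bij_betwI[where g = ?g])
    show "?f \<in> ?L \<rightarrow> ?R" by (auto simp: PiE_iff)
    show "?g \<in> ?R \<rightarrow> ?L"
    proof
      fix x assume x: "x \<in> ?R"
      have "?g x \<in> (A \<union> B) \<rightarrow>\<^sub>E N" using x by (auto simp: PiE_iff extensional_def)
      then show "?g x \<in> ?L" using fg[OF x] x by auto
    qed
    show "?g (?f \<psi>) = \<psi>" if "\<psi> \<in> ?L" for \<psi>
      using that by (intro extensionalityI[of _ "A \<union> B"]) (auto simp: PiE_iff extensional_def)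
  qed (rule fg)
  from bij_betw_same_card[OF this] show ?thesis by (simp add: card_cartesian_product)
qed

text \<open>The independence of the glued components: conditions on disjoint blocks
  multiply.\<close>

lemma card_PiE_Union:
  fixes K :: "'i \<Rightarrow> 'a set" and N :: "'b set"
  assumes "finite T" "disjoint_family_on K T"
  shows "card {\<psi> \<in> (\<Union>r\<in>T. K r) \<rightarrow>\<^sub>E N. \<forall>r\<in>T. P r (restrict \<psi> (K r))} =
    (\<Prod>r\<in>T. card {\<chi> \<in> K r \<rightarrow>\<^sub>E N. P r \<chi>})"
  using assms
proof (induction T rule: finite_induct)
  case empty
  have "{\<psi> \<in> {} \<rightarrow>\<^sub>E N. \<forall>r\<in>{}. P r (restrict \<psi> (K r))} = {\<lambda>_. undefined}" by auto
  then show ?case by simp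
next
  case (insert r T)
  let ?U = "\<Union>r\<in>T. K r"
  have dT: "disjoint_family_on K T"
    using insert.prems by (simp add: disjoint_family_on_def)
  have "K r \<inter> K r' = {}" if "r' \<in> T" for r'
    using disjoint_family_onD[OF insert.prems, of r r'] insert.hyps that by auto
  then have dj: "K r \<inter> ?U = {}" by auto
  have res: "?U \<inter> K r' = K r'" if "r' \<in> T" for r'
    using that by auto
  let ?Q = "\<lambda>\<psi>. \<forall>r\<in>T. P r (restrict \<psi> (K r))"
  have eq: "{\<psi> \<in> (\<Union>r\<in>insert r T. K r) \<rightarrow>\<^sub>E N. \<forall>r\<in>insert r T. P r (restrict \<psi> (K r))} =
    {\<psi> \<in> (K r \<union> ?U) \<rightarrow>\<^sub>E N. P r (restrict \<psi> (K r)) \<and> ?Q (restrict \<psi> ?U)}"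
    by (simp add: res)
  have "card {\<psi> \<in> (K r \<union> ?U) \<rightarrow>\<^sub>E N. P r (restrict \<psi> (K r)) \<and> ?Q (restrict \<psi> ?U)} =
    card {\<chi> \<in> K r \<rightarrow>\<^sub>E N. P r \<chi>} * card {\<psi> \<in> ?U \<rightarrow>\<^sub>E N. ?Q \<psi>}"
    by (rule card_PiE_Un[OF dj])
  then show ?case
    unfolding eq prod.insert[OF insert.hyps] insert.IH[OF dT] .
qed

text \<open>Expands the product of the factors \<open>1 - of_bool (E c)\<close>; the digit of
  \<open>a\<close> at c records which of the two terms of the factor is taken.\<close>

lemma inclusion_exclusion_dig:
  "(\<Sum>a<2 ^ n. (-1) ^ (\<Sum>c<n. digit 2 n a c) * of_bool (\<forall>c<n. digit 2 n a c = 1 \<longrightarrow> E c)) =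
    (of_bool (\<forall>c<n. \<not> E c) :: int)"
proof -
  define w :: "nat \<Rightarrow> nat \<Rightarrow> int" where "w c t = (if t = 1 then - of_bool (E c) else 1)" for c t
  have "(of_bool (\<forall>c<n. \<not> E c) :: int) = (\<Prod>c<n. 1 - of_bool (E c))"
  proof (cases "\<forall>c<n. \<not> E c")
    case False
    then have "(\<Prod>c<n. 1 - of_bool (E c) :: int) = 0" by (auto simp: prod_zero_iff)
    then show ?thesis using False by simp
  qed simp
  also have "\<dots> = (\<Prod>c\<in>{..<n}. \<Sum>t\<in>{..<2}. w c t)" by (simp add: w_def numeral_2_eq_2)
  also have "\<dots> = (\<Sum>\<alpha>\<in>{..<n} \<rightarrow>\<^sub>E {..<2}. \<Prod>c\<in>{..<n}. w c (\<alpha> c))"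
    by (rule prod_sum_PiE) auto
  also have "\<dots> = (\<Sum>a\<in>{..<2 ^ n}. \<Prod>c\<in>{..<n}. w c ((\<lambda>v\<in>{..<n}. digit 2 n a v) c))"
    by (rule sum.reindex_bij_betw[OF bij_dig, symmetric])
  also have "\<dots> = (\<Sum>a<2 ^ n. (-1) ^ (\<Sum>c<n. digit 2 n a c) * of_bool (\<forall>c<n. digit 2 n a c = 1 \<longrightarrow> E c))"
  proof (rule sum.cong[OF refl])
    fix a
    have "(\<Prod>c<m. w c (digit 2 n a c)) = (-1) ^ (\<Sum>c<m. digit 2 n a c) * of_bool (\<forall>c<m. digit 2 n a c = 1 \<longrightarrow> E c)" for m
    proof (induction m)
      case (Suc m)
      have "digit 2 n a m = 0 \<or> digit 2 n a m = 1" using dig_less[of 2 n a m] by auto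
      then have "w m (digit 2 n a m) = (-1) ^ digit 2 n a m * of_bool (digit 2 n a m = 1 \<longrightarrow> E m)"
        by (auto simp: w_def)
      then show ?case using Suc by (auto simp: power_add less_Suc_eq)
    qed simp
    then show "(\<Prod>c<n. w c ((\<lambda>v\<in>{..<n}. digit 2 n a v) c)) = (-1) ^ (\<Sum>c<n. digit 2 n a c) * of_bool (\<forall>c<n. digit 2 n a c = 1 \<longrightarrow> E c)"
      by simp
  qed
  finally show ?thesis by simp
qed

text \<open>Maps are extensional, so that for finite vertex sets the cardinality really is the
  number of isomorphisms.\<close>

definition isos :: "'a set \<Rightarrow> 'a rel \<Rightarrow> 'b set \<Rightarrow> 'b rel \<Rightarrow> ('a \<Rightarrow> 'b) set" where
  "isos V E W F = {\<psi> \<in> V \<rightarrow>\<^sub>E W. bij_betw \<psi> V W \<and> (\<forall>u\<in>V. \<forall>v\<in>V. (u, v) \<in> E \<longleftrightarrow> (\<psi> u, \<psi> v) \<in> F)}"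

text \<open>Composition with a fixed isomorphism is a bijection from the automorphisms to the
  isomorphisms, with inverse the composition with its inverse.\<close>

lemma card_isos:
  assumes "\<psi> \<in> isos V E W F"
  shows "card (isos V E W F) = card (isos V E V E)"
proof -
  have \<psi>: "bij_betw \<psi> V W" "\<And>u v. u \<in> V \<Longrightarrow> v \<in> V \<Longrightarrow> (u, v) \<in> E \<longleftrightarrow> (\<psi> u, \<psi> v) \<in> F"
    using assms by (auto simp: isos_def)
  define \<iota> where "\<iota> = the_inv_into V \<psi>"
  have \<iota>: "bij_betw \<iota> W V" "\<And>v. v \<in> V \<Longrightarrow> \<iota> (\<psi> v) = v" "\<And>w. w \<in> W \<Longrightarrow> \<psi> (\<iota> w) = w"
    using bij_betw_the_inv_into[OF \<psi>(1)] the_inv_into_f_f[of \<psi> V] f_the_inv_into_f[of \<psi> V] \<psi>(1)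
    by (auto simp: \<iota>_def bij_betw_def)
  have \<iota>V: "\<iota> w \<in> V" if "w \<in> W" for w using \<iota>(1) that by (auto simp: bij_betw_def)
  have \<psi>W: "\<psi> v \<in> W" if "v \<in> V" for v using \<psi>(1) that by (auto simp: bij_betw_def)
  have "bij_betw (\<lambda>\<alpha>. restrict (\<psi> \<circ> \<alpha>) V) (isos V E V E) (isos V E W F)"
  proof (rule bij_betwI[where g = "\<lambda>\<beta>. restrict (\<iota> \<circ> \<beta>) V"])
    show "(\<lambda>\<alpha>. restrict (\<psi> \<circ> \<alpha>) V) \<in> isos V E V E \<rightarrow> isos V E W F"
    proof
      fix \<alpha> assume a: "\<alpha> \<in> isos V E V E"
      then have "bij_betw (\<psi> \<circ> \<alpha>) V W" using \<psi>(1) by (auto simp: isos_def intro: bij_betw_trans)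
      moreover have "bij_betw (restrict (\<psi> \<circ> \<alpha>) V) V W \<longleftrightarrow> bij_betw (\<psi> \<circ> \<alpha>) V W"
        by (rule bij_betw_cong) simp
      moreover have "\<alpha> v \<in> V" if "v \<in> V" for v using a that by (auto simp: isos_def)
      ultimately show "restrict (\<psi> \<circ> \<alpha>) V \<in> isos V E W F" using a \<psi>(2) \<psi>W by (auto simp: isos_def)
    qed
    show "(\<lambda>\<beta>. restrict (\<iota> \<circ> \<beta>) V) \<in> isos V E W F \<rightarrow> isos V E V E"
    proof
      fix \<beta> assume b: "\<beta> \<in> isos V E W F"
      then have "bij_betw (\<iota> \<circ> \<beta>) V V" using \<iota>(1) by (auto simp: isos_def intro: bij_betw_trans)
      moreover have "bij_betw (restrict (\<iota> \<circ> \<beta>) V) V V \<longleftrightarrow> bij_betw (\<iota> \<circ> \<beta>) V V"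
        by (rule bij_betw_cong) simp
      moreover have bW: "\<beta> v \<in> W" if "v \<in> V" for v using b that by (auto simp: isos_def)
      moreover have "(u, v) \<in> E \<longleftrightarrow> (\<iota> (\<beta> u), \<iota> (\<beta> v)) \<in> E" if "u \<in> V" "v \<in> V" for u v
      proof -
        have "(u, v) \<in> E \<longleftrightarrow> (\<beta> u, \<beta> v) \<in> F" using b that by (auto simp: isos_def)
        also have "\<dots> \<longleftrightarrow> (\<iota> (\<beta> u), \<iota> (\<beta> v)) \<in> E"
          using \<psi>(2)[of "\<iota> (\<beta> u)" "\<iota> (\<beta> v)"] \<iota>V \<iota>(3) bW that by auto
        finally show ?thesis .
      qed
      ultimately show "restrict (\<iota> \<circ> \<beta>) V \<in> isos V E V E" using \<iota>V by (auto simp: isos_def)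
    qed
    show "restrict (\<iota> \<circ> restrict (\<psi> \<circ> \<alpha>) V) V = \<alpha>" if "\<alpha> \<in> isos V E V E" for \<alpha>
      using that \<iota>(2) by (auto simp: isos_def restrict_def PiE_iff extensional_def fun_eq_iff)
    show "restrict (\<psi> \<circ> restrict (\<iota> \<circ> \<beta>) V) V = \<beta>" if "\<beta> \<in> isos V E W F" for \<beta>
      using that \<iota>(3) by (auto simp: isos_def restrict_def PiE_iff extensional_def fun_eq_iff)
  qed
  then show ?thesis by (metis bij_betw_same_card)
qed

section \<open>The fractional cover bound\<close>

text \<open>With S the weighted mean, average the inequality ln t \<le> t - 1 at t = x e /
  S.\<close>

lemma weighted_am_gm:
  fixes x :: "'e \<Rightarrow> real"
  assumes "finite E" "\<And>e. e \<in> E \<Longrightarrow> 0 < x e" "\<And>e. e \<in> E \<Longrightarrow> 0 \<le> w e" "(\<Sum>e\<in>E. w e) = 1"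
  shows "(\<Prod>e\<in>E. x e powr w e) \<le> (\<Sum>e\<in>E. w e * x e)"
proof -
  have "(\<Prod>e\<in>E. x e powr w e) = exp (\<Sum>e\<in>E. w e * ln (x e))"
    unfolding exp_sum[OF assms(1)] by (intro prod.cong refl) (use assms(2) in \<open>force simp: powr_def\<close>)
  define S where "S = (\<Sum>e\<in>E. w e * x e)"
  have S: "0 < S"
  proof (rule ccontr)
    assume "\<not> 0 < S"
    then have "S = 0" using sum_nonneg[of E "\<lambda>e. w e * x e"] assms(2,3) by (force simp: S_def)
    then have "\<forall>e\<in>E. w e * x e = 0" unfolding S_def using assms(1-3) by (subst (asm) sum_nonneg_eq_0_iff) (auto simp: less_imp_le)
    then have "\<forall>e\<in>E. w e = 0" using assms(2) by force
    then show False using assms(4) by simp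
  qed
  have "(\<Sum>e\<in>E. w e * ln (x e)) \<le> (\<Sum>e\<in>E. w e * (ln S + (x e / S - 1)))"
  proof (intro sum_mono mult_left_mono)
    fix e assume e: "e \<in> E"
    have "ln (x e / S) \<le> x e / S - 1" using assms(2)[OF e] S by (intro ln_le_minus_one) simp
    then show "ln (x e) \<le> ln S + (x e / S - 1)" using assms(2)[OF e] S by (simp add: ln_div)
  qed (use assms(3) in auto)
  also have "\<dots> = (\<Sum>e\<in>E. w e * (ln S - 1) + (w e * x e) / S)" by (intro sum.cong refl) (simp add: algebra_simps)
  also have "\<dots> = (\<Sum>e\<in>E. w e) * (ln S - 1) + S / S"
    unfolding sum.distrib by (simp add: S_def sum_distrib_right flip: sum_divide_distrib)
  also have "\<dots> = ln S" using S assms(4) by simp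
  finally have "exp (\<Sum>e\<in>E. w e * ln (x e)) \<le> exp (ln S)" by simp
  then have "(\<Prod>e\<in>E. x e powr w e) \<le> S" using S \<open>(\<Prod>e\<in>E. x e powr w e) = _\<close> by simp
  then show ?thesis by (simp add: S_def)
qed

text \<open>After division by \<open>N e\<close> all quotients are at most 1, so a total exponent
  above 1 can be scaled down to 1 at no loss; the weighted mean inequality for each a and summation
  over a give the claim.\<close>

lemma generalized_holder:
  fixes n :: "'e \<Rightarrow> 'a \<Rightarrow> real"
  assumes "finite E" "finite A" "\<And>e. e \<in> E \<Longrightarrow> 0 \<le> \<gamma> e" "1 \<le> (\<Sum>e\<in>E. \<gamma> e)"
    and pos: "\<And>e a. e \<in> E \<Longrightarrow> a \<in> A \<Longrightarrow> 0 < n e a" and N: "\<And>e. e \<in> E \<Longrightarrow> (\<Sum>a\<in>A. n e a) \<le> N e"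
  shows "(\<Sum>a\<in>A. \<Prod>e\<in>E. n e a powr \<gamma> e) \<le> (\<Prod>e\<in>E. N e powr \<gamma> e)"
proof (cases "A = {}")
  case True
  then show ?thesis by (simp add: prod_nonneg)
next
  case False
  define G where "G = (\<Sum>e\<in>E. \<gamma> e)"
  have G: "1 \<le> G" using assms(4) by (simp add: G_def)
  have le: "n e a \<le> N e" if "e \<in> E" "a \<in> A" for e a
  proof -
    have "n e a \<le> (\<Sum>a\<in>A. n e a)" using that assms(2) pos by (intro member_le_sum) (auto simp: less_imp_le)
    then show ?thesis using N[OF that(1)] by linarith
  qed
  have Npos: "0 < N e" if "e \<in> E" for e using le[OF that] pos[OF that] False by force
  have "(\<Prod>e\<in>E. n e a powr \<gamma> e) \<le> (\<Prod>e\<in>E. N e powr \<gamma> e) * (\<Sum>e\<in>E. \<gamma> e / G * (n e a / N e))" if a: "a \<in> A" for a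
  proof -
    have "(\<Prod>e\<in>E. n e a powr \<gamma> e) = (\<Prod>e\<in>E. N e powr \<gamma> e * (n e a / N e) powr \<gamma> e)"
    proof (intro prod.cong refl)
      fix e assume "e \<in> E"
      then show "n e a powr \<gamma> e = N e powr \<gamma> e * (n e a / N e) powr \<gamma> e"
        using pos[of e a] Npos[of e] a by (simp flip: powr_mult)
    qed
    also have "\<dots> = (\<Prod>e\<in>E. N e powr \<gamma> e) * (\<Prod>e\<in>E. (n e a / N e) powr \<gamma> e)" by (rule prod.distrib)
    also have "\<dots> \<le> (\<Prod>e\<in>E. N e powr \<gamma> e) * (\<Prod>e\<in>E. (n e a / N e) powr (\<gamma> e / G))"
    proof (intro mult_left_mono prod_mono conjI)
      fix e assume e: "e \<in> E"
      \<comment> \<open>A base in (0, 1] grows when its exponent is divided by G, which is at least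
        1.\<close>
      have "\<gamma> e * 1 \<le> \<gamma> e * G" using assms(3)[OF e] G by (intro mult_left_mono) auto
      then have "\<gamma> e / G \<le> \<gamma> e" using G by (simp add: divide_le_eq)
      then show "(n e a / N e) powr \<gamma> e \<le> (n e a / N e) powr (\<gamma> e / G)"
        using pos[OF e a] Npos[OF e] le[OF e a] by (intro powr_mono') auto
    qed (auto intro: prod_nonneg)
    also have "\<dots> \<le> (\<Prod>e\<in>E. N e powr \<gamma> e) * (\<Sum>e\<in>E. \<gamma> e / G * (n e a / N e))"
    proof (intro mult_left_mono weighted_am_gm)
      show "(\<Sum>e\<in>E. \<gamma> e / G) = 1" using G by (simp add: G_def flip: sum_divide_distrib)
    qed (use assms(1,3) G pos Npos a in \<open>auto intro: prod_nonneg\<close>)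
    finally show ?thesis .
  qed
  then have "(\<Sum>a\<in>A. \<Prod>e\<in>E. n e a powr \<gamma> e) \<le> (\<Sum>a\<in>A. (\<Prod>e\<in>E. N e powr \<gamma> e) * (\<Sum>e\<in>E. \<gamma> e / G * (n e a / N e)))"
    by (rule sum_mono)
  also have "\<dots> = (\<Prod>e\<in>E. N e powr \<gamma> e) * (\<Sum>e\<in>E. \<gamma> e / G * ((\<Sum>a\<in>A. n e a) / N e))"
    unfolding sum_distrib_left sum_divide_distrib by (rule sum.swap)
  also have "\<dots> \<le> (\<Prod>e\<in>E. N e powr \<gamma> e) * (\<Sum>e\<in>E. \<gamma> e / G * 1)"
  proof (intro mult_left_mono sum_mono)
    fix e assume "e \<in> E"
    then show "(\<Sum>a\<in>A. n e a) / N e \<le> 1" using N Npos by (simp add: divide_le_eq)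
  qed (use assms(3) G in \<open>auto intro: prod_nonneg\<close>)
  also have "\<dots> = (\<Prod>e\<in>E. N e powr \<gamma> e)" using G by (simp add: G_def flip: sum_divide_distrib)
  finally show ?thesis .
qed

text \<open>Induction on V: slice P by the value at a new vertex v and apply the induction
  hypothesis to each slice. For edges avoiding v the projection of a slice is bounded by that of P.
  For edges containing v the projections of the slices are disjoint, and Hoelder's inequality adds
  them up because these edges have total weight at least 1.\<close>

lemma card_le_cover:
  fixes P :: "('a \<Rightarrow> 'b) set" and \<gamma> :: "'a set \<Rightarrow> real"
  assumes "finite V" "finite E" "finite P" "P \<subseteq> extensional V" "P \<noteq> {}"
    and \<gamma>: "\<And>e. e \<in> E \<Longrightarrow> 0 \<le> \<gamma> e" and cover: "\<And>v. v \<in> V \<Longrightarrow> 1 \<le> (\<Sum>e | e \<in> E \<and> v \<in> e. \<gamma> e)"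
  shows "real (card P) \<le> (\<Prod>e\<in>E. real (card ((\<lambda>\<phi>. restrict \<phi> e) ` P)) powr \<gamma> e)"
  using assms(1,3,4,5) cover
proof (induction V arbitrary: P rule: finite_induct)
  case empty
  then have "\<forall>f\<in>P. f = (\<lambda>_. undefined)" by (fastforce simp: extensional_def fun_eq_iff)
  then have "P \<subseteq> {\<lambda>_. undefined}" by (simp add: subset_iff)
  then have P: "P = {\<lambda>_. undefined}" using empty.prems(3) subset_singletonD by metis
  then show ?case by simp
next
  case (insert v V)
  let ?pr = "\<lambda>P e. card ((\<lambda>\<phi>. restrict \<phi> e) ` P)"
  define A where "A = (\<lambda>\<phi>. \<phi> v) ` P"
  define Q where "Q a = {\<phi>\<in>P. \<phi> v = a}" for a
  \<comment> \<open>Erasing the value at v makes the slice extensional on V, as the induction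
    hypothesis demands. The slice keeps its size, since the erased value is constant on it.\<close>
  define Q' where "Q' a = (\<lambda>\<phi>. \<phi>(v := undefined)) ` Q a" for a
  have fin: "finite A" "finite (Q a)" "finite (Q' a)" for a using insert.prems by (auto simp: A_def Q_def Q'_def)
  have ne: "Q' a \<noteq> {}" "Q a \<noteq> {}" if "a \<in> A" for a using that by (auto simp: A_def Q_def Q'_def)
  define E1 where "E1 = {e\<in>E. v \<in> e}"
  define E2 where "E2 = {e\<in>E. v \<notin> e}"
  have E: "E = E1 \<union> E2" "E1 \<inter> E2 = {}" "finite E1" "finite E2" using assms(2) by (auto simp: E1_def E2_def)
  have pos: "0 < ?pr (Q a) e" if "a \<in> A" for a e
    using ne(2)[OF that] fin(2) by (simp add: card_gt_0_iff)
  have "card P = (\<Sum>a\<in>A. card (Q a))"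
  proof -
    have "P = (\<Union>a\<in>A. Q a)" by (auto simp: A_def Q_def)
    moreover have "card (\<Union>a\<in>A. Q a) = (\<Sum>a\<in>A. card (Q a))"
      using fin by (intro card_UN_disjoint) (auto simp: Q_def)
    ultimately show ?thesis by simp
  qed
  moreover have "real (card (Q a)) \<le> (\<Prod>e\<in>E1. real (?pr (Q a) e) powr \<gamma> e) * (\<Prod>e\<in>E2. real (?pr P e) powr \<gamma> e)"
    if a: "a \<in> A" for a
  proof -
    have "inj_on (\<lambda>\<phi>. \<phi>(v := undefined)) (Q a)"
    proof (rule inj_onI)
      fix f g :: "'a \<Rightarrow> 'b" assume "f \<in> Q a" "g \<in> Q a" and eq: "f(v := undefined) = g(v := undefined)"
      then have "f v = g v" by (simp add: Q_def)
      then show "f = g" using eq by (metis fun_upd_triv fun_upd_upd)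
    qed
    then have "card (Q a) = card (Q' a)" by (simp add: Q'_def card_image)
    also have "real (card (Q' a)) \<le> (\<Prod>e\<in>E. real (?pr (Q' a) e) powr \<gamma> e)"
    proof (rule insert.IH[OF fin(3) _ ne(1)[OF a]])
      show "Q' a \<subseteq> extensional V" using insert.prems(2) by (auto simp: Q'_def Q_def extensional_def)
      show "1 \<le> (\<Sum>e | e \<in> E \<and> x \<in> e. \<gamma> e)" if "x \<in> V" for x using insert.prems(4) that by simp
    qed
    also have "\<dots> = (\<Prod>e\<in>E1. real (?pr (Q' a) e) powr \<gamma> e) * (\<Prod>e\<in>E2. real (?pr (Q' a) e) powr \<gamma> e)"
      unfolding E(1) using E by (intro prod.union_disjoint) auto
    also have "\<dots> \<le> (\<Prod>e\<in>E1. real (?pr (Q a) e) powr \<gamma> e) * (\<Prod>e\<in>E2. real (?pr P e) powr \<gamma> e)"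
    proof (intro mult_mono prod_mono conjI powr_mono2)
      fix e assume e: "e \<in> E1"
      have "(\<lambda>\<phi>. restrict \<phi> e) ` Q' a = (\<lambda>\<phi>. \<phi>(v := undefined)) ` (\<lambda>\<phi>. restrict \<phi> e) ` Q a"
        unfolding Q'_def image_image using e by (intro image_cong refl) (auto simp: restrict_def E1_def)
      then show "real (?pr (Q' a) e) \<le> real (?pr (Q a) e)"
        using card_image_le[of "(\<lambda>\<phi>. restrict \<phi> e) ` Q a" "\<lambda>\<phi>. \<phi>(v := undefined)"] fin(2) by simp
      show "0 \<le> \<gamma> e" using e \<gamma> by (simp add: E1_def)
    next
      fix e assume e: "e \<in> E2"
      have "(\<lambda>\<phi>. restrict \<phi> e) ` Q' a = (\<lambda>\<phi>. restrict \<phi> e) ` Q a"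
        unfolding Q'_def image_image using e by (intro image_cong refl) (auto simp: restrict_def E2_def)
      also have "\<dots> \<subseteq> (\<lambda>\<phi>. restrict \<phi> e) ` P" by (auto simp: Q_def)
      finally show "real (?pr (Q' a) e) \<le> real (?pr P e)"
        using insert.prems(1) by (simp add: card_mono)
      show "0 \<le> \<gamma> e" using e \<gamma> by (simp add: E2_def)
    qed (auto intro: prod_nonneg)
    finally show ?thesis .
  qed
  ultimately have "real (card P) \<le> (\<Sum>a\<in>A. (\<Prod>e\<in>E1. real (?pr (Q a) e) powr \<gamma> e) * (\<Prod>e\<in>E2. real (?pr P e) powr \<gamma> e))"
    by (simp add: sum_mono)
  also have "\<dots> = (\<Sum>a\<in>A. \<Prod>e\<in>E1. real (?pr (Q a) e) powr \<gamma> e) * (\<Prod>e\<in>E2. real (?pr P e) powr \<gamma> e)"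
    by (simp add: sum_distrib_right)
  also have "\<dots> \<le> (\<Prod>e\<in>E1. real (?pr P e) powr \<gamma> e) * (\<Prod>e\<in>E2. real (?pr P e) powr \<gamma> e)"
  proof (intro mult_right_mono generalized_holder)
    show "1 \<le> (\<Sum>e\<in>E1. \<gamma> e)" using insert.prems(4)[of v] by (simp add: E1_def)
    fix e assume e: "e \<in> E1"
    \<comment> \<open>As v lies in e, restrictions to e from different slices differ at v.\<close>
    have "(\<Sum>a\<in>A. ?pr (Q a) e) = card (\<Union>a\<in>A. (\<lambda>\<phi>. restrict \<phi> e) ` Q a)"
    proof (rule card_UN_disjoint[symmetric])
      show "\<forall>i\<in>A. \<forall>j\<in>A. i \<noteq> j \<longrightarrow> (\<lambda>\<phi>. restrict \<phi> e) ` Q i \<inter> (\<lambda>\<phi>. restrict \<phi> e) ` Q j = {}"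
      proof (intro ballI impI equals0I)
        fix i j f assume "i \<noteq> j" "f \<in> (\<lambda>\<phi>. restrict \<phi> e) ` Q i \<inter> (\<lambda>\<phi>. restrict \<phi> e) ` Q j"
        then obtain x y where "f = restrict x e" "x v = i" "f = restrict y e" "y v = j"
          unfolding Q_def by blast
        moreover have "v \<in> e" using e by (simp add: E1_def)
        ultimately show False using \<open>i \<noteq> j\<close> by (metis restrict_apply')
      qed
    qed (use fin in auto)
    also have "\<dots> \<le> ?pr P e" using insert.prems(1) by (intro card_mono) (auto simp: Q_def)
    finally have "real (\<Sum>a\<in>A. ?pr (Q a) e) \<le> real (?pr P e)" by (rule of_nat_mono)
    then show "(\<Sum>a\<in>A. real (?pr (Q a) e)) \<le> real (?pr P e)" by simp
    show "0 \<le> \<gamma> e" using e \<gamma> by (simp add: E1_def)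
    show "0 < real (?pr (Q a) e)" if "a \<in> A" for a using pos[OF that] by simp
  qed (use E fin in \<open>auto intro: prod_nonneg\<close>)
  also have "\<dots> = (\<Prod>e\<in>E. real (?pr P e) powr \<gamma> e)"
    unfolding E(1) using E by (intro prod.union_disjoint[symmetric]) auto
  finally show ?case .
qed

section \<open>Reading the encodings\<close>

definition nth_or_0 :: "nat list \<Rightarrow> nat \<Rightarrow> nat" where
  "nth_or_0 ys i = (if i < length ys then ys ! i else 0)"

text \<open>By induction the address reached after x jumps is the total length of the leading entry
  and the first x records, which is where the record of vertex x begins.\<close>

lemma encoding_layout:
  assumes ys: "ys = n # concat (map (\<lambda>l. length l # l) ns)" and len: "length ns = n" and x: "x < n"
  defines "p \<equiv> ((\<lambda>i. i + 1 + nth_or_0 ys i) ^^ x) 1"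
  shows "nth_or_0 ys p = length (ns ! x) \<and> (\<forall>k<length (ns ! x). nth_or_0 ys (p + 1 + k) = ns ! x ! k)"
proof -
  let ?f = "\<lambda>l. length l # l :: nat list"
  have split: "ys = (n # concat (map ?f (take x ns))) @ (?f (ns ! x) @ concat (map ?f (drop (Suc x) ns)))"
    if "x < n" for x
  proof -
    have "ns = take x ns @ ns ! x # drop (Suc x) ns" using that len by (simp add: id_take_nth_drop)
    then have "concat (map ?f ns) = concat (map ?f (take x ns @ ns ! x # drop (Suc x) ns))" by simp
    then show ?thesis using ys by simp
  qed
  have list_start: "((\<lambda>i. i + 1 + nth_or_0 ys i) ^^ x) 1 = length (n # concat (map ?f (take x ns)))" if "x \<le> n" for x
    using that
  proof (induction x)
    case (Suc x)
    let ?q = "length (n # concat (map ?f (take x ns)))"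
    have "nth_or_0 ys ?q = length (ns ! x)"
    proof -
      have x: "x < n" using Suc.prems by simp
      have "?q < length ys" using arg_cong[OF split[OF x], of length] by simp
      moreover have "ys ! ?q = length (ns ! x)"
        by (subst split[OF x]) (simp only: append_Cons[of "length (ns ! x)"] nth_append_length)
      ultimately show ?thesis by (simp only: nth_or_0_def if_True)
    qed
    moreover have "take (Suc x) ns = take x ns @ [ns ! x]" using Suc.prems len by (simp add: take_Suc_conv_app_nth)
    ultimately show ?case using Suc by simp
  qed simp
  let ?q = "length (n # concat (map ?f (take x ns)))"
  have p: "p = ?q" using list_start[of x] x by (simp add: p_def)
  have *: "nth_or_0 ys (?q + i) = (?f (ns ! x)) ! i" if "i < Suc (length (ns ! x))" for i
  proof -
    have "?q + i < length ys" using arg_cong[OF split[OF x], of length] that by simp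
    then have "nth_or_0 ys (?q + i) = ((n # concat (map ?f (take x ns))) @ (?f (ns ! x) @ concat (map ?f (drop (Suc x) ns)))) ! (?q + i)"
      using split[OF x] by (simp add: nth_or_0_def)
    also have "\<dots> = (?f (ns ! x) @ concat (map ?f (drop (Suc x) ns))) ! i"
      by (rule nth_append_length_plus)
    also have "\<dots> = (?f (ns ! x)) ! i" using that by (subst nth_append) simp
    finally show ?thesis .
  qed
  have "nth_or_0 ys (p + 1 + k) = ns ! x ! k" if "k < length (ns ! x)" for k
    using *[of "Suc k"] that by (simp add: p)
  then show ?thesis using *[of 0] by (simp add: p)
qed

text \<open>Every entry is the vertex count, an outdegree or a vertex, hence at most the vertex
  count; each vertex contributes at least one entry besides the first, so the vertex count is below
  the length.\<close>

lemma encodingD: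
  assumes "adjacency_encoding G ys"
  shows "pair_fin_digraph G" "pverts G = {..<nth_or_0 ys 0}" "nth_or_0 ys 0 < length ys" "nth_or_0 ys i < length ys"
    and "x < nth_or_0 ys 0 \<Longrightarrow> (\<exists>k<nth_or_0 ys (((\<lambda>i. i + 1 + nth_or_0 ys i) ^^ x) 1).
      nth_or_0 ys (((\<lambda>i. i + 1 + nth_or_0 ys i) ^^ x) 1 + 1 + k) = y) \<longleftrightarrow> (x, y) \<in> parcs G"
proof -
  obtain n ns where fin: "pair_fin_digraph G" and V: "pverts G = {..<n}" and len: "length ns = n"
    and ns: "\<And>v. v < n \<Longrightarrow> distinct (ns ! v) \<and> set (ns ! v) = {w. (v, w) \<in> parcs G}"
    and ys: "ys = n # concat (map (\<lambda>l. length l # l) ns)"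
    using assms by (auto simp: adjacency_encoding_def)
  interpret pair_fin_digraph G by (rule fin)
  have 0: "nth_or_0 ys 0 = n" by (simp add: nth_or_0_def ys)
  show "pair_fin_digraph G" by (rule fin)
  show "pverts G = {..<nth_or_0 ys 0}" using V 0 by simp
  have "n \<le> length (concat (map (\<lambda>l. length l # l) ns))"
    unfolding len[symmetric] by (induction ns) auto
  then have n: "n < length ys" by (simp add: ys)
  then show "nth_or_0 ys 0 < length ys" by (simp add: 0)
  have "e \<le> n" if "e \<in> set ys" for e
  proof -
    have "e = n \<or> (\<exists>l\<in>set ns. e = length l \<or> e \<in> set l)" using that by (auto simp: ys)
    then consider "e = n" | l where "l \<in> set ns" "e = length l \<or> e \<in> set l" by blast
    then show ?thesis
    proof cases
      case 2
      then obtain v where v: "v < n" "l = ns ! v" by (metis in_set_conv_nth len)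
      have sub: "set l \<subseteq> {..<n}" using ns[OF v(1)] v(2) V by (auto dest: in_arcsD2)
      have "length l = card (set l)" using ns[OF v(1)] v(2) by (metis distinct_card)
      also have "\<dots> \<le> n" using card_mono[OF _ sub] by simp
      finally show ?thesis using 2(2) sub by auto
    qed simp
  qed
  then show "nth_or_0 ys i < length ys" using n nth_mem[of i ys] by (fastforce simp: nth_or_0_def)
  assume x: "x < nth_or_0 ys 0"
  have "nth_or_0 ys (((\<lambda>i. i + 1 + nth_or_0 ys i) ^^ x) 1) = length (ns ! x)"
    "\<And>k. k < length (ns ! x) \<Longrightarrow> nth_or_0 ys (((\<lambda>i. i + 1 + nth_or_0 ys i) ^^ x) 1 + 1 + k) = ns ! x ! k"
    using encoding_layout[OF ys len, of x] x 0 by auto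
  then have "(\<exists>k<nth_or_0 ys (((\<lambda>i. i + 1 + nth_or_0 ys i) ^^ x) 1). nth_or_0 ys (((\<lambda>i. i + 1 + nth_or_0 ys i) ^^ x) 1 + 1 + k) = y)
    \<longleftrightarrow> (\<exists>k<length (ns ! x). ns ! x ! k = y)" by auto
  also have "\<dots> \<longleftrightarrow> y \<in> set (ns ! x)" by (auto simp: in_set_conv_nth)
  also have "\<dots> \<longleftrightarrow> (x, y) \<in> parcs G" using ns x 0 by auto
  finally show "(\<exists>k<nth_or_0 ys (((\<lambda>i. i + 1 + nth_or_0 ys i) ^^ x) 1). nth_or_0 ys (((\<lambda>i. i + 1 + nth_or_0 ys i) ^^ x) 1 + 1 + k) = y)
    \<longleftrightarrow> (x, y) \<in> parcs G" .
qed

section \<open>Balls, reachability and bitmasks\<close>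

definition ball_of :: "'a rel \<Rightarrow> nat \<Rightarrow> 'a \<Rightarrow> 'a set" where
  "ball_of R m g = {y. \<exists>j\<le>m. (g, y) \<in> R ^^ j}"

lemma ball_of_0: "ball_of R 0 g = {g}"
  by (auto simp: ball_of_def)

lemma ball_of_Suc: "ball_of R (Suc m) g = ball_of R m g \<union> R `` ball_of R m g"
proof -
  have "(\<exists>j\<le>Suc m. (g, y) \<in> R ^^ j) \<longleftrightarrow> (\<exists>j\<le>m. (g, y) \<in> R ^^ j) \<or> (\<exists>x. (\<exists>j\<le>m. (g, x) \<in> R ^^ j) \<and> (x, y) \<in> R)" (is "?L \<longleftrightarrow> ?R") for y
  proof
    assume ?L
    then obtain j where j: "j \<le> Suc m" "(g, y) \<in> R ^^ j" by blast
    show ?R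
    proof (cases "j \<le> m")
      case False
      then have "j = Suc m" using j by simp
      then show ?thesis using j(2) by auto
    qed (use j in blast)
  next
    assume ?R
    then show ?L
    proof
      assume "\<exists>x. (\<exists>j\<le>m. (g, x) \<in> R ^^ j) \<and> (x, y) \<in> R"
      then obtain x j where "j \<le> m" "(g, x) \<in> R ^^ j" "(x, y) \<in> R" by blast
      then have "(g, y) \<in> R ^^ Suc j" "Suc j \<le> Suc m" by auto
      then show ?L by blast
    qed (use le_SucI in blast)
  qed
  then show ?thesis unfolding ball_of_def Image_def by blast
qed

lemma card_ball_of:
  assumes "\<And>x. finite (R `` {x}) \<and> card (R `` {x}) \<le> d"
  shows "finite (ball_of R m g) \<and> card (ball_of R m g) \<le> (d + 1) ^ m"
proof (induction m)
  case (Suc m)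
  let ?B = "ball_of R m g"
  have im: "R `` ?B = (\<Union>x\<in>?B. R `` {x})" by auto
  have "card (R `` ?B) \<le> (\<Sum>x\<in>?B. card (R `` {x}))" unfolding im by (rule card_UN_le) (use Suc in simp)
  also have "\<dots> \<le> (\<Sum>x\<in>?B. d)" by (rule sum_mono) (use assms in blast)
  finally have "card (ball_of R (Suc m) g) \<le> card ?B + card ?B * d"
    unfolding ball_of_Suc using card_Un_le[of ?B "R `` ?B"] by simp
  also have "\<dots> = card ?B * (d + 1)" by simp
  also have "\<dots> \<le> (d + 1) ^ m * (d + 1)" using Suc by (intro mult_right_mono) auto
  finally have "card (ball_of R (Suc m) g) \<le> (d + 1) ^ Suc m" by (simp add: mult.commute)
  moreover have "finite (R `` ?B)" unfolding im using Suc assms by blast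
  ultimately show ?case using Suc by (simp add: ball_of_Suc)
qed (simp add: ball_of_0)

lemma ball_of_rtrancl:
  assumes "finite R" "card R \<le> m" shows "y \<in> ball_of R m g \<longleftrightarrow> (g, y) \<in> R\<^sup>*"
proof
  assume "(g, y) \<in> R\<^sup>*"
  then obtain j where "j \<le> card R" "(g, y) \<in> R ^^ j" using rtrancl_finite_eq_relpow[OF assms(1)] by blast
  then show "y \<in> ball_of R m g" using assms(2) le_trans unfolding ball_of_def by blast
qed (auto simp: ball_of_def intro: relpow_imp_rtrancl)

definition on_verts :: "nat \<Rightarrow> (nat \<Rightarrow> nat \<Rightarrow> bool) \<Rightarrow> nat rel" where
  "on_verts n R = {(x, y). x < n \<and> y < n \<and> R x y}"

lemma ball_on_verts: "g < n \<Longrightarrow> y \<in> ball_of (on_verts n R) m g \<Longrightarrow> y < n"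
proof (induction m arbitrary: y)
  case (Suc m)
  have "on_verts n R `` S \<subseteq> {..<n}" for S by (auto simp: on_verts_def)
  then show ?case using Suc unfolding ball_of_Suc by blast
qed (simp add: ball_of_0)

lemma finite_on_verts: "finite (on_verts n R) \<and> card (on_verts n R) \<le> n * n"
proof -
  have "on_verts n R \<subseteq> {..<n} \<times> {..<n}" by (auto simp: on_verts_def)
  then show ?thesis using card_mono[of "{..<n} \<times> {..<n}" "on_verts n R"] by (auto intro: finite_subset)
qed

lemma odd_bitmask:
  "odd ((\<Sum>y<n. 2 ^ y * of_bool (P y)) div 2 ^ x :: nat) \<longleftrightarrow> x < n \<and> P x"
proof -
  have "(\<Sum>y<n. 2 ^ y * of_bool (P y)) = (horner_sum of_bool 2 (map P [0..<n]) :: nat)"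
    by (simp add: horner_sum_eq_sum mult.commute atLeast0LessThan)
  then show ?thesis by (simp only: bit_iff_odd[symmetric] bit_horner_sum_bit_iff) auto
qed

lemma tb_bitmask:
  assumes "n \<le> bit_limit I"
  shows "has_bit I (\<Sum>y<n. 2 ^ min y (bit_limit I) * of_bool (P y)) x \<longleftrightarrow> x < n \<and> P x"
proof -
  have "(\<Sum>y<n. 2 ^ min y (bit_limit I) * of_bool (P y)) = (\<Sum>y<n. 2 ^ y * of_bool (P y) :: nat)"
    using assms by (intro sum.cong refl) (auto simp: min_def)
  then have "has_bit I (\<Sum>y<n. 2 ^ min y (bit_limit I) * of_bool (P y)) x \<longleftrightarrow> min x (bit_limit I) < n \<and> P (min x (bit_limit I))"
    unfolding has_bit_def by (simp only: odd_bitmask)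
  then show ?thesis using assms by (auto simp: min_def split: if_splits)
qed

text \<open>After m rounds the mask is the ball of radius m. If g is no vertex, the initial mask is
  already empty.\<close>

lemma tb_clo:
  assumes "num_verts I b \<le> bit_limit I"
  shows "has_bit I (closure_mask I b R g) y \<longleftrightarrow> g < num_verts I b \<and> y \<in> ball_of (on_verts (num_verts I b) R) (num_verts I 0 * num_verts I 0) g"
proof -
  let ?n = "num_verts I b"
  let ?F = "\<lambda>m. \<Sum>y<?n. 2 ^ min y (bit_limit I) * of_bool (\<exists>x<?n. has_bit I m x \<and> (x = y \<or> R x y))"
  let ?z = "\<Sum>y<?n. 2 ^ min y (bit_limit I) * of_bool (y = g)"
  have "has_bit I ((?F ^^ m) ?z) y \<longleftrightarrow> g < ?n \<and> y \<in> ball_of (on_verts ?n R) m g" for m y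
  proof (induction m arbitrary: y)
    case 0
    show ?case unfolding funpow_0 tb_bitmask[OF assms] ball_of_0 by auto
  next
    case (Suc m)
    have "has_bit I ((?F ^^ Suc m) ?z) y \<longleftrightarrow> y < ?n \<and> (\<exists>x<?n. has_bit I ((?F ^^ m) ?z) x \<and> (x = y \<or> R x y))"
      unfolding funpow.simps comp_apply by (rule tb_bitmask[OF assms])
    also have "\<dots> \<longleftrightarrow> g < ?n \<and> y \<in> ball_of (on_verts ?n R) (Suc m) g"
      unfolding Suc.IH ball_of_Suc using ball_on_verts[of g ?n _ R m] by (auto simp: on_verts_def)
    finally show ?case .
  qed
  then show ?thesis unfolding closure_mask_def .
qed

text \<open>Counting the smaller elements is a bijection from B to an initial segment of the
  naturals; the sum selects the unique element of given rank and so computes the inverse.\<close>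

lemma bij_rank_inverse:
  fixes B :: "nat set"
  assumes B: "B \<subseteq> {..<n}"
  shows "bij_betw (\<lambda>t. \<Sum>x<n. x * of_bool (x \<in> B \<and> card {y\<in>B. y < x} = t)) {..<card B} B"
proof -
  have fB: "finite B" using B finite_subset by blast
  let ?r = "\<lambda>x. card {y\<in>B. y < x}"
  let ?e = "\<lambda>t. \<Sum>x<n. x * of_bool (x \<in> B \<and> ?r x = t)"
  have less: "?r x < ?r y" if "x \<in> B" "x < y" for x y
    using that fB by (intro psubset_card_mono) auto
  have inj: "inj_on ?r B"
  proof (rule inj_onI)
    fix x y assume xy: "x \<in> B" "y \<in> B" "?r x = ?r y"
    show "x = y" using less[of x y] less[of y x] xy by (cases x y rule: linorder_cases) auto
  qed
  have "?r ` B \<subseteq> {..<card B}"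
    using fB by (auto intro!: psubset_card_mono)
  then have r: "bij_betw ?r B {..<card B}"
    using inj card_image[OF inj] by (intro bij_betw_imageI inj card_subset_eq) auto
  have e: "?e (?r x) = x" if x: "x \<in> B" for x
  proof -
    have "?e (?r x) = (\<Sum>y\<in>{..<n}. if y = x then x else 0)"
      using x inj by (intro sum.cong refl) (auto dest: inj_onD)
    then show ?thesis using x B by auto
  qed
  have "bij_betw ?e (?r ` B) B"
    by (rule bij_betw_byWitness[where f' = ?r]) (use e in auto)
  then show ?thesis using r by (simp add: bij_betw_def)
qed

locale pattern_host =
  fixes H G :: "nat pair_pre_digraph" and xs ys :: "nat list" and I :: "nat list list" and h n :: nat
  assumes encH: "adjacency_encoding H xs" and encG: "adjacency_encoding G ys" and I: "I = [xs, ys]"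
  defines "h \<equiv> num_verts I 0" and "n \<equiv> num_verts I 1"
begin

abbreviation "EH \<equiv> parcs H"
abbreviation "EG \<equiv> parcs G"
abbreviation "m \<equiv> h * h"

lemma input_I: "input_memory I 0 = nth_or_0 xs" "input_memory I (Suc 0) = nth_or_0 ys"
  by (auto simp: I input_memory_def nth_or_0_def fun_eq_iff)

lemma h_eq: "h = nth_or_0 xs 0" and n_eq: "n = nth_or_0 ys 0"
  by (simp_all add: h_def n_def num_verts_def input_I)

lemma vH: "pverts H = {..<h}" and vG: "pverts G = {..<n}"
  using encodingD(2)[OF encH] encodingD(2)[OF encG] by (simp_all add: h_eq n_eq)

lemma EH_sub: "EH \<subseteq> {..<h} \<times> {..<h}" and EG_sub: "EG \<subseteq> {..<n} \<times> {..<n}"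
proof -
  interpret H: pair_fin_digraph H by (rule encodingD(1)[OF encH])
  interpret G: pair_fin_digraph G by (rule encodingD(1)[OF encG])
  show "EH \<subseteq> {..<h} \<times> {..<h}" using H.in_arcsD1 H.in_arcsD2 by (auto simp flip: vH)
  show "EG \<subseteq> {..<n} \<times> {..<n}" using G.in_arcsD1 G.in_arcsD2 by (auto simp flip: vG)
qed

lemma h_less: "h < length xs" and n_less: "n < length ys"
  using encodingD(3)[OF encH] encodingD(3)[OF encG] by (simp_all add: h_eq n_eq)

lemma input_le: "input_memory I a i < length xs + length ys"
proof (cases "a < 2")
  case True
  then consider "a = 0" | "a = 1" by linarith
  then show ?thesis
    using encodingD(4)[OF encH, of i] encodingD(4)[OF encG, of i] by cases (simp_all add: input_I)
next
  case False
  then show ?thesis using h_less by (auto simp: I input_memory_def)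
qed

lemma arcH: "x < h \<Longrightarrow> has_arc I 0 x y \<longleftrightarrow> (x, y) \<in> EH"
  using encodingD(5)[OF encH, of x y] by (simp add: has_arc_def list_start_def input_I h_eq num_verts_def)

lemma arcG: "x < n \<Longrightarrow> has_arc I 1 x y \<longleftrightarrow> (x, y) \<in> EG"
  using encodingD(5)[OF encG, of x y] by (simp add: has_arc_def list_start_def input_I n_eq num_verts_def)

lemma bit_limit: "num_verts I 0 \<le> bit_limit I" "num_verts I 1 \<le> bit_limit I"
  by (simp_all add: bit_limit_def)

lemma on_vertsH: "on_verts h (has_arc I 0) = EH" and on_vertsG: "on_verts n (has_arc I 1) = EG"
  using EH_sub EG_sub arcH arcG by (auto simp: on_verts_def)

lemma tb_ball: "g < n \<Longrightarrow> has_bit I (ball_mask I g) y \<longleftrightarrow> y \<in> ball_of EG m g"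
  using tb_clo[OF bit_limit(2), of "has_arc I 1" g y] on_vertsG by (simp add: ball_mask_def h_def n_def)

lemma ball_sub: "g < n \<Longrightarrow> ball_of EG m g \<subseteq> {..<n}"
  using ball_on_verts[of g n _ "has_arc I 1" m] on_vertsG by auto

lemma reach_iff: "reaches I u v \<longleftrightarrow> u < h \<and> (u, v) \<in> EH\<^sup>*"
  using tb_clo[OF bit_limit(1), of "has_arc I 0" u v] on_vertsH ball_of_rtrancl[of EH m v u] finite_on_verts[of h "has_arc I 0"]
  by (simp add: reaches_def flip: h_def)

lemma lnk_iff: "linked I a u v \<longleftrightarrow> u < h \<and> (u, v) \<in> (on_verts h (link_step I a))\<^sup>*"
  using tb_clo[OF bit_limit(1), of "link_step I a" u v] ball_of_rtrancl[of "on_verts h (link_step I a)" m v u] finite_on_verts[of h "link_step I a"]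
  by (simp add: linked_def flip: h_def)

lemma rtranclH_less: "(u, v) \<in> EH\<^sup>* \<Longrightarrow> u < h \<Longrightarrow> v < h"
  by (induction rule: rtrancl_induct) (use EH_sub in auto)

lemma bsz_eq: "g < n \<Longrightarrow> ball_size I g = card (ball_of EG m g)"
proof -
  assume g: "g < n"
  have "ball_size I g = card ({..<n} \<inter> {x. has_bit I (ball_mask I g) x})" by (simp add: ball_size_def n_def)
  also have "{..<n} \<inter> {x. has_bit I (ball_mask I g) x} = ball_of EG m g" using tb_ball[OF g] ball_sub[OF g] by auto
  finally show ?thesis .
qed

lemma bij_elt: "g < n \<Longrightarrow> bij_betw (ball_elt I g) {..<ball_size I g} (ball_of EG m g)"
proof -
  assume g: "g < n"
  let ?B = "ball_of EG m g"
  have "(\<Sum>y<n. of_bool (y < x \<and> has_bit I (ball_mask I g) y)) = card {y\<in>?B. y < x}" for x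
  proof -
    have "(\<Sum>y<n. of_bool (y < x \<and> has_bit I (ball_mask I g) y)) = card ({..<n} \<inter> {y. y < x \<and> has_bit I (ball_mask I g) y})" by simp
    also have "{..<n} \<inter> {y. y < x \<and> has_bit I (ball_mask I g) y} = {y\<in>?B. y < x}" using tb_ball[OF g] ball_sub[OF g] by auto
    finally show ?thesis .
  qed
  then have "ball_elt I g = (\<lambda>t. \<Sum>x<n. x * of_bool (x \<in> ?B \<and> card {y\<in>?B. y < x} = t))"
    unfolding ball_elt_def n_def[symmetric] using tb_ball[OF g] by simp
  then show ?thesis using bij_rank_inverse[OF ball_sub[OF g]] bsz_eq[OF g] by simp
qed

lemma outdegree_le: "finite (EG `` {x}) \<and> card (EG `` {x}) \<le> max_outdegree G"
proof -
  have fin: "finite EG" using EG_sub finite_subset by blast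
  then have f: "finite (EG `` {x})" by auto
  show ?thesis
  proof (cases "x < n")
    case True
    have "EG `` {x} = snd ` {e \<in> EG. fst e = x}" by force
    then have "card (EG `` {x}) \<le> card {e \<in> EG. fst e = x}" using fin by (simp add: card_image_le)
    also have "\<dots> = out_degree (with_proj G) x" by (simp add: out_degree_def out_arcs_def)
    also have "\<dots> \<le> max_outdegree G" unfolding max_outdegree_def using True by (intro Max_ge) (auto simp: vG)
    finally show ?thesis using f by simp
  next
    case False
    then have "EG `` {x} = {}" using EG_sub by auto
    then show ?thesis by simp
  qed
qed

lemma card_ball_mask: "finite (ball_of EG m g) \<and> card (ball_of EG m g) \<le> (max_outdegree G + 1) ^ m"
  by (rule card_ball_of[OF outdegree_le])

text \<open>Valid for every number g, since a loop bound has to hold for meaningless arguments too;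
  there the mask is empty.\<close>

lemma bsz_le: "ball_size I g \<le> (max_outdegree G + 1) ^ m"
proof (cases "g < n")
  case True
  then show ?thesis using card_ball_mask bsz_eq by simp
next
  case False
  then have "\<not> has_bit I (ball_mask I g) x" for x
    using tb_clo[OF bit_limit(2), of "has_arc I 1" g x] by (simp add: ball_mask_def n_def)
  then show ?thesis by (simp add: ball_size_def)
qed

end

section \<open>Correctness of the counting expressions\<close>

lemma sum_card_fibers:
  assumes "finite S" "f ` S \<subseteq> T" "finite T"
  shows "(\<Sum>g\<in>T. card {x\<in>S. f x = g}) = card S"
  using sum.group[OF assms(1,3,2), of "\<lambda>_. 1::nat"] by simp

context pattern_host
begin

section \<open>Glued source components\<close>

definition cst_ok :: "nat \<Rightarrow> nat set \<Rightarrow> (nat \<Rightarrow> nat) \<Rightarrow> bool" where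
  "cst_ok a S \<psi> \<longleftrightarrow> (\<forall>u\<in>S. \<forall>v\<in>S. arc_constraint I a u v (\<psi> u) (\<psi> v))"

definition U :: "nat set" where "U = {v. v < h \<and> in_source I v}"

definition ST :: "nat \<Rightarrow> nat rel" where "ST a = on_verts h (link_step I a)"

definition K :: "nat \<Rightarrow> nat \<Rightarrow> nat set" where "K a r = {v. (r, v) \<in> (ST a)\<^sup>*}"

definition reps :: "nat \<Rightarrow> nat set" where "reps a = {r\<in>U. \<forall>u\<in>U. u < r \<longrightarrow> r \<notin> K a u}"

lemma inU_iff: "v < h \<Longrightarrow> in_source I v \<longleftrightarrow> (\<forall>u. (u, v) \<in> EH\<^sup>* \<longrightarrow> (v, u) \<in> EH\<^sup>*)"
proof -
  assume v: "v < h"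
  have "u < h" if "(u, v) \<in> EH\<^sup>*" for u
    using that v EH_sub by (cases rule: converse_rtranclE) auto
  then show ?thesis using v by (auto simp: in_source_def reach_iff h_def)
qed

text \<open>Whatever reaches a predecessor u of v also reaches v, so v reaches it back, and u does
  so through v.\<close>

lemma U_pred:
  assumes "v \<in> U" "(u, v) \<in> EH" shows "u \<in> U" "(v, u) \<in> EH\<^sup>*"
proof -
  have u: "u < h" using assms EH_sub by auto
  show vu: "(v, u) \<in> EH\<^sup>*" using assms inU_iff by (auto simp: U_def)
  have "(u, w) \<in> EH\<^sup>*" if "(w, u) \<in> EH\<^sup>*" for w
  proof -
    have "(w, v) \<in> EH\<^sup>*" using that assms(2) by (rule rtrancl_into_rtrancl)
    then have "(v, w) \<in> EH\<^sup>*" using assms inU_iff by (auto simp: U_def)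
    then show ?thesis using assms(2) by (rule converse_rtrancl_into_rtrancl[rotated])
  qed
  then show "u \<in> U" using u inU_iff by (auto simp: U_def)
qed

lemma ST_iff: "(u, v) \<in> ST a \<longleftrightarrow> u \<in> U \<and> v \<in> U \<and> ((u, v) \<in> EH \<or> identified I a u v \<or> identified I a v u)"
  by (auto simp: ST_def on_verts_def link_step_def U_def arcH)

lemma EH_rtrancl_ST: "(x, y) \<in> EH\<^sup>* \<Longrightarrow> y \<in> U \<Longrightarrow> x \<in> U \<and> (x, y) \<in> (ST a)\<^sup>*"
proof (induction rule: converse_rtrancl_induct)
  case (step x z)
  then have "x \<in> U" using U_pred by blast
  then have "(x, z) \<in> ST a" using step by (auto simp: ST_iff)
  then show ?case using step \<open>x \<in> U\<close> by (auto intro: converse_rtrancl_into_rtrancl)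
qed simp

text \<open>Identifications are symmetric by definition of the step. An arc into v with v in a
  source component has a return path, and that path stays among the source components because these
  are closed under predecessors.\<close>

lemma ST_sym: "(u, v) \<in> (ST a)\<^sup>* \<Longrightarrow> (v, u) \<in> (ST a)\<^sup>*"
proof (induction rule: rtrancl_induct)
  case (step v w)
  have "(w, v) \<in> (ST a)\<^sup>*"
  proof (cases "(v, w) \<in> EH")
    case True
    then have "(w, v) \<in> EH\<^sup>*" "v \<in> U" using step(2) U_pred by (auto simp: ST_iff)
    then show ?thesis using EH_rtrancl_ST by blast
  next
    case False
    then show ?thesis using step(2) by (auto simp: ST_iff)
  qed
  then show ?case using step.IH by (rule rtrancl_trans)
qed simp

lemma K_sub: "r \<in> U \<Longrightarrow> K a r \<subseteq> U"
proof
  fix v assume "r \<in> U" "v \<in> K a r"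
  then have "(r, v) \<in> (ST a)\<^sup>*" by (simp add: K_def)
  then show "v \<in> U" using \<open>r \<in> U\<close> by (induction rule: rtrancl_induct) (auto simp: ST_iff)
qed

lemma U_sub: "U \<subseteq> {..<h}" "finite U"
  by (auto simp: U_def)

lemma reps_sub: "reps a \<subseteq> U" "finite (reps a)"
  using U_sub by (auto simp: reps_def)

lemma disjoint_K: "disjoint_family_on (K a) (reps a)"
  unfolding disjoint_family_on_def
proof (intro ballI impI equals0I)
  fix r r' v assume r: "r \<in> reps a" "r' \<in> reps a" "r \<noteq> r'" and "v \<in> K a r \<inter> K a r'"
  then have "(r, r') \<in> (ST a)\<^sup>*" "(r', r) \<in> (ST a)\<^sup>*"
    using ST_sym by (auto simp: K_def intro: rtrancl_trans)
  then have "r' \<in> K a r" "r \<in> K a r'" by (auto simp: K_def)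
  then show False using r by (cases r r' rule: linorder_cases) (auto simp: reps_def)
qed

lemma Union_K: "(\<Union>r\<in>reps a. K a r) = U"
proof
  show "(\<Union>r\<in>reps a. K a r) \<subseteq> U" using K_sub reps_sub by blast
  show "U \<subseteq> (\<Union>r\<in>reps a. K a r)"
  proof
    fix v assume v: "v \<in> U"
    let ?P = "\<lambda>u. u \<in> U \<and> v \<in> K a u"
    \<comment> \<open>The least vertex whose class contains v represents that class.\<close>
    define r where "r = (LEAST u. ?P u)"
    have "?P v" using v by (simp add: K_def)
    then have r: "?P r" unfolding r_def by (rule LeastI)
    have "r \<notin> K a u" if "u \<in> U" "u < r" for u
    proof
      assume "r \<in> K a u"
      then have "?P u" using r that by (auto simp: K_def intro: rtrancl_trans)
      then show False using not_less_Least[of u ?P] that(2) by (simp add: r_def)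
    qed
    then have "r \<in> reps a" using r by (simp add: reps_def)
    then show "v \<in> (\<Union>r\<in>reps a. K a r)" using r by blast
  qed
qed

lemma lnk_K: "u < h \<Longrightarrow> linked I a u v \<longleftrightarrow> v \<in> K a u"
  by (simp add: lnk_iff K_def ST_def)

definition glue :: "nat \<Rightarrow> nat set \<Rightarrow> (nat \<Rightarrow> nat) \<Rightarrow> nat \<Rightarrow> nat" where
  "glue Q S \<chi> v = (if v \<in> S then \<chi> v else digit n h Q v)"

definition cmp_ok :: "nat \<Rightarrow> nat \<Rightarrow> nat \<Rightarrow> (nat \<Rightarrow> nat) \<Rightarrow> bool" where
  "cmp_ok Q a r \<chi> \<longleftrightarrow> cst_ok a (({..<h} - U) \<union> K a r) (glue Q (K a r) \<chi>)"

lemma cst_iff: "u < h \<Longrightarrow> x < n \<Longrightarrow> arc_constraint I a u v x y \<longleftrightarrow> ((u, v) \<in> EH \<longrightarrow> (x, y) \<in> EG) \<and> (identified I a u v \<longrightarrow> u < v \<and> x = y)"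
  unfolding arc_constraint_def using arcH[of u v] arcG[of x y] by blast

text \<open>Along a link the image either follows an arc of G or stays put, so each link enlarges
  the radius by at most 1. Links form a relation on h vertices, hence \<open>h * h\<close> of them
  reach the whole glued component.\<close>

lemma cmp_ok_ball:
  assumes r: "r \<in> U" and \<chi>: "\<chi> \<in> K a r \<rightarrow>\<^sub>E {..<n}" and ok: "cmp_ok Q a r \<chi>"
  shows "\<chi> \<in> K a r \<rightarrow>\<^sub>E ball_of EG m (\<chi> r)"
proof -
  have "\<chi> v \<in> ball_of EG k (\<chi> r)" if "v \<in> ball_of (ST a) k r" for v k
    using that
  proof (induction k arbitrary: v)
    case 0
    then show ?case by (simp add: ball_of_0)
  next
    case (Suc k)
    show ?case
    proof (cases "v \<in> ball_of (ST a) k r")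
      case True
      then show ?thesis using Suc.IH by (simp add: ball_of_Suc)
    next
      case False
      then obtain u where u: "u \<in> ball_of (ST a) k r" "(u, v) \<in> ST a" using Suc.prems by (auto simp: ball_of_Suc)
      have uK: "u \<in> K a r" using u(1) relpow_imp_rtrancl by (fastforce simp: ball_of_def K_def)
      then have vK: "v \<in> K a r" using u(2) by (auto simp: K_def intro: rtrancl_into_rtrancl)
      have lt: "u < h" "v < h" "\<chi> u < n" "\<chi> v < n" using uK vK K_sub[OF r] U_sub \<chi> by (auto simp: PiE_iff)
      \<comment> \<open>The constraint is needed in both orders because a link from u to v may stem
        from the pair (v, u) being identified.\<close>
      have "arc_constraint I a u v (\<chi> u) (\<chi> v)" "arc_constraint I a v u (\<chi> v) (\<chi> u)"
        using bspec[OF bspec[OF ok[unfolded cmp_ok_def cst_ok_def]], of u v]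
          bspec[OF bspec[OF ok[unfolded cmp_ok_def cst_ok_def]], of v u] uK vK by (simp_all add: glue_def)
      then have "(\<chi> u, \<chi> v) \<in> EG \<or> \<chi> u = \<chi> v" using u(2) lt by (auto simp: cst_iff ST_iff)
      then show ?thesis using Suc.IH[OF u(1)] by (auto simp: ball_of_Suc)
    qed
  qed
  moreover have "v \<in> ball_of (ST a) m r" if "v \<in> K a r" for v
    using that ball_of_rtrancl[of "ST a" m v r] finite_on_verts[of h "link_step I a"] by (simp add: K_def ST_def)
  ultimately show ?thesis using \<chi> by (auto simp: PiE_iff)
qed

text \<open>For fixed image g of r, the admissible codes p correspond bijectively to the maps into
  the ball around g, and by \<open>cmp_ok_ball\<close> no admissible map leaves that ball. Summing
  over g partitions the maps by the image of r.\<close>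

lemma cmp_eq:
  assumes r: "r \<in> U"
  shows "component_count I Q a r = card {\<chi> \<in> K a r \<rightarrow>\<^sub>E {..<n}. cmp_ok Q a r \<chi>}"
proof -
  have rh: "r < h" using r by (simp add: U_def)
  have rK: "r \<in> K a r" by (simp add: K_def)
  have Kh: "K a r \<subseteq> {..<h}" using K_sub[OF r] U_sub by blast
  let ?S = "{\<chi> \<in> K a r \<rightarrow>\<^sub>E {..<n}. cmp_ok Q a r \<chi>}"
  have "(\<Sum>p<ball_size I g ^ h. of_bool (extension_test I Q a r g p)) = card {\<chi>\<in>?S. \<chi> r = g}" if g: "g < n" for g
  proof -
    let ?b = "ball_size I g"
    \<comment> \<open>Codes whose digits vanish off the component; decoding by \<open>f\<close> is
      injective on them and onto the maps into the ball.\<close>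
    define D where "D = {p. p < ?b ^ h \<and> (\<forall>v<h. v \<notin> K a r \<longrightarrow> digit ?b h p v = 0)}"
    define f where "f p = (\<lambda>v\<in>K a r. ball_elt I g (digit ?b h p v))" for p
    have gB: "g \<in> ball_of EG m g" by (auto simp: ball_of_def intro: exI[of _ 0])
    then have "ball_of EG m g \<noteq> {}" by blast
    then have b: "0 < ?b" using bsz_eq[OF g] card_ball_mask[of g] card_gt_0_iff by metis
    have ball_elt: "inj_on (ball_elt I g) {..<?b}" "ball_elt I g ` {..<?b} = ball_of EG m g"
      using bij_elt[OF g] by (auto simp: bij_betw_def)
    have fim: "f p \<in> K a r \<rightarrow>\<^sub>E ball_of EG m g" for p
      using ball_elt(2) dig_less[OF b] by (auto simp: f_def)
    have inj: "inj_on f D"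
    proof (rule inj_onI)
      fix p q assume p: "p \<in> D" and q: "q \<in> D" and eq: "f p = f q"
      have "digit ?b h p v = digit ?b h q v" if "v < h" for v
      proof (cases "v \<in> K a r")
        case True
        then have "ball_elt I g (digit ?b h p v) = ball_elt I g (digit ?b h q v)" using fun_cong[OF eq, of v] by (simp add: f_def)
        then show ?thesis using ball_elt(1) dig_less[OF b] by (meson inj_onD lessThan_iff)
      next
        case False
        then show ?thesis using p q that by (simp add: D_def)
      qed
      then have "p div ?b ^ (h - h) = q div ?b ^ (h - h)" using p q by (intro prefix_eq) (auto simp: D_def)
      then show "p = q" by simp
    qed
    have surj: "\<chi> \<in> f ` D" if \<chi>: "\<chi> \<in> K a r \<rightarrow>\<^sub>E ball_of EG m g" for \<chi>
    proof -
      have "\<exists>t<?b. ball_elt I g t = \<chi> v" if "v \<in> K a r" for v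
        using \<chi> that ball_elt(2) by (auto simp: PiE_iff image_iff) (metis imageE lessThan_iff)
      then obtain t where t: "\<And>v. v \<in> K a r \<Longrightarrow> t v < ?b \<and> ball_elt I g (t v) = \<chi> v" by metis
      obtain p where p: "p < ?b ^ h" "\<And>v. v < h \<Longrightarrow> digit ?b h p v = (if v \<in> K a r then t v else 0)"
        by (rule dig_surj[of h "\<lambda>v. if v \<in> K a r then t v else 0" ?b]) (use t b in auto)
      have "f p = \<chi>"
      proof (rule extensionalityI[of _ "K a r"])
        fix v assume v: "v \<in> K a r"
        then have "v < h" using Kh by auto
        then show "f p v = \<chi> v" using v p t by (simp add: f_def)
      qed (use \<chi> in \<open>auto simp: f_def PiE_iff\<close>)
      moreover have "p \<in> D" using p by (auto simp: D_def)
      ultimately show ?thesis by blast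
    qed
    have assigned: "assigned I Q a r g p v = glue Q (K a r) (f p) v" for p v
      using rh by (simp add: assigned_def lnk_K glue_def f_def h_def n_def)
    have extension_test: "extension_test I Q a r g p \<longleftrightarrow> p \<in> D \<and> f p r = g \<and> cmp_ok Q a r (f p)" if "p < ?b ^ h" for p
    proof -
      have mem: "(in_source I u \<longrightarrow> linked I a r u) \<longleftrightarrow> u \<in> ({..<h} - U) \<union> K a r" if "u < h" for u
        using that K_sub[OF r] rh by (auto simp: lnk_K U_def)
      have "(\<forall>u<h. \<forall>v<h. (in_source I u \<longrightarrow> linked I a r u) \<and> (in_source I v \<longrightarrow> linked I a r v) \<longrightarrow>
        arc_constraint I a u v (assigned I Q a r g p u) (assigned I Q a r g p v)) \<longleftrightarrow> cmp_ok Q a r (f p)"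
        unfolding cmp_ok_def cst_ok_def assigned using mem Kh by blast
      moreover have "assigned I Q a r g p r = f p r" using rK by (simp add: assigned glue_def)
      ultimately show ?thesis unfolding extension_test_def D_def using that rh by (auto simp: lnk_K simp flip: h_def)
    qed
    have "(\<Sum>p<?b ^ h. of_bool (extension_test I Q a r g p)) = card ({..<?b ^ h} \<inter> {p. extension_test I Q a r g p})" by simp
    also have "{..<?b ^ h} \<inter> {p. extension_test I Q a r g p} = {p\<in>D. f p r = g \<and> cmp_ok Q a r (f p)}"
      using extension_test by (auto simp: D_def)
    also have "card \<dots> = card (f ` \<dots>)" using inj by (intro card_image[symmetric]) (auto simp: inj_on_def)
    also have "f ` {p\<in>D. f p r = g \<and> cmp_ok Q a r (f p)} = {\<chi> \<in> K a r \<rightarrow>\<^sub>E ball_of EG m g. \<chi> r = g \<and> cmp_ok Q a r \<chi>}"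
    proof (intro equalityI subsetI)
      fix \<chi> assume "\<chi> \<in> f ` {p\<in>D. f p r = g \<and> cmp_ok Q a r (f p)}"
      then obtain p where "\<chi> = f p" "f p r = g" "cmp_ok Q a r (f p)" by auto
      then show "\<chi> \<in> {\<chi> \<in> K a r \<rightarrow>\<^sub>E ball_of EG m g. \<chi> r = g \<and> cmp_ok Q a r \<chi>}" using fim[of p] by simp
    next
      fix \<chi> assume \<chi>: "\<chi> \<in> {\<chi> \<in> K a r \<rightarrow>\<^sub>E ball_of EG m g. \<chi> r = g \<and> cmp_ok Q a r \<chi>}"
      then obtain p where "p \<in> D" "\<chi> = f p" using surj[of \<chi>] by auto
      then show "\<chi> \<in> f ` {p\<in>D. f p r = g \<and> cmp_ok Q a r (f p)}" using \<chi> by simp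
    qed
    also have "\<dots> = {\<chi>\<in>?S. \<chi> r = g}"
    proof (intro equalityI subsetI)
      fix \<chi> assume \<chi>: "\<chi> \<in> {\<chi> \<in> K a r \<rightarrow>\<^sub>E ball_of EG m g. \<chi> r = g \<and> cmp_ok Q a r \<chi>}"
      then have "\<chi> \<in> K a r \<rightarrow>\<^sub>E {..<n}" using PiE_mono[of "K a r" "\<lambda>_. ball_of EG m g" "\<lambda>_. {..<n}"] ball_sub[OF g] by blast
      then show "\<chi> \<in> {\<chi>\<in>?S. \<chi> r = g}" using \<chi> by simp
    next
      fix \<chi> assume "\<chi> \<in> {\<chi>\<in>?S. \<chi> r = g}"
      then show "\<chi> \<in> {\<chi> \<in> K a r \<rightarrow>\<^sub>E ball_of EG m g. \<chi> r = g \<and> cmp_ok Q a r \<chi>}"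
        using cmp_ok_ball[OF r, of \<chi> a Q] by simp
    qed
    finally show ?thesis .
  qed
  then have "component_count I Q a r = (\<Sum>g<n. card {\<chi>\<in>?S. \<chi> r = g})"
    unfolding component_count_def h_def[symmetric] n_def[symmetric] by (intro sum.cong refl) simp
  also have "\<dots> = card ?S"
  proof (rule sum_card_fibers)
    have "finite (K a r \<rightarrow>\<^sub>E {..<n})" using finite_subset[OF Kh] by (intro finite_PiE) auto
    then show "finite ?S" by simp
    show "(\<lambda>\<chi>. \<chi> r) ` ?S \<subseteq> {..<n}" using rK by (auto simp: PiE_iff)
  qed simp
  finally show ?thesis .
qed

text \<open>No constraint relates two different glued components, so the extensions of a fixed map
  outside the source components are a product of independent choices, one for each
  representative.\<close>

lemma ext_eq:
  assumes Q: "Q < n ^ h"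
  shows "extension_count I Q a = card {\<psi> \<in> {..<h} \<rightarrow>\<^sub>E {..<n}. (\<forall>v\<in>{..<h} - U. \<psi> v = digit n h Q v) \<and> cst_ok a {..<h} \<psi>}"
    (is "_ = card ?S")
proof -
  let ?C = "{..<h} - U"
  let ?\<phi> = "digit n h Q"
  have \<phi>: "?\<phi> v < n" if "v < h" for v
  proof -
    have "0 < n" using Q that by (cases n) (auto simp: power_0_left split: if_splits)
    then show ?thesis by (rule dig_less)
  qed
  have okC: "(\<forall>u<h. \<forall>v<h. \<not> in_source I u \<and> \<not> in_source I v \<longrightarrow> arc_constraint I a u v (?\<phi> u) (?\<phi> v)) \<longleftrightarrow> cst_ok a ?C ?\<phi>"
    by (auto simp: cst_ok_def U_def)
  have "(\<Prod>r<h. if in_source I r \<and> (\<forall>u<h. u < r \<longrightarrow> in_source I u \<longrightarrow> \<not> linked I a u r) then component_count I Q a r else 1) =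
    (\<Prod>r<h. if r \<in> reps a then component_count I Q a r else 1)"
    by (intro prod.cong refl) (auto simp: reps_def U_def lnk_K)
  also have "\<dots> = (\<Prod>r\<in>reps a. component_count I Q a r)"
    using reps_sub[of a] U_sub by (subst prod.inter_restrict[symmetric]) (auto intro!: prod.cong)
  also have "\<dots> = (\<Prod>r\<in>reps a. card {\<chi> \<in> K a r \<rightarrow>\<^sub>E {..<n}. cmp_ok Q a r \<chi>})"
    using reps_sub by (intro prod.cong refl cmp_eq) auto
  also have "\<dots> = card {\<psi> \<in> U \<rightarrow>\<^sub>E {..<n}. \<forall>r\<in>reps a. cmp_ok Q a r (restrict \<psi> (K a r))}"
    using card_PiE_Union[OF reps_sub(2) disjoint_K, where P = "cmp_ok Q a" and N = "{..<n}"] by (simp add: Union_K)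
  finally have extension_count: "extension_count I Q a = of_bool (cst_ok a ?C ?\<phi>) * card {\<psi> \<in> U \<rightarrow>\<^sub>E {..<n}. \<forall>r\<in>reps a. cmp_ok Q a r (restrict \<psi> (K a r))}"
    unfolding extension_count_def h_def[symmetric] n_def[symmetric] okC by simp
  show ?thesis
  proof (cases "cst_ok a ?C ?\<phi>")
    case False
    have "?S = {}"
    proof (rule equals0I)
      fix \<psi> assume "\<psi> \<in> ?S"
      then have "\<And>v. v \<in> ?C \<Longrightarrow> \<psi> v = ?\<phi> v" "cst_ok a {..<h} \<psi>" by auto
      then have "cst_ok a ?C ?\<phi>" unfolding cst_ok_def by (metis DiffD1)
      then show False using False by simp
    qed
    then show ?thesis using extension_count False by (simp only: card.empty of_bool_eq mult_zero_left)
  next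
    case True
    let ?L = "{\<psi> \<in> U \<rightarrow>\<^sub>E {..<n}. \<forall>r\<in>reps a. cmp_ok Q a r (restrict \<psi> (K a r))}"
    let ?f = "\<lambda>\<psi>. restrict (glue Q U \<psi>) {..<h}"
    have ok: "cst_ok a {..<h} (?f \<psi>) \<longleftrightarrow> (\<forall>r\<in>reps a. cmp_ok Q a r (restrict \<psi> (K a r)))" for \<psi>
    proof
      assume l: "cst_ok a {..<h} (?f \<psi>)"
      show "\<forall>r\<in>reps a. cmp_ok Q a r (restrict \<psi> (K a r))"
        unfolding cmp_ok_def cst_ok_def
      proof (intro ballI)
        fix r u v assume r: "r \<in> reps a" and uv: "u \<in> ?C \<union> K a r" "v \<in> ?C \<union> K a r"
        have Kr: "K a r \<subseteq> U" using K_sub reps_sub r by blast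
        have eq: "glue Q (K a r) (restrict \<psi> (K a r)) w = ?f \<psi> w" and lt: "w < h" if "w \<in> ?C \<union> K a r" for w
          using that Kr U_sub by (auto simp: glue_def)
        show "arc_constraint I a u v (glue Q (K a r) (restrict \<psi> (K a r)) u) (glue Q (K a r) (restrict \<psi> (K a r)) v)"
          using l uv unfolding eq[OF uv(1)] eq[OF uv(2)] cst_ok_def by (simp add: lt)
      qed
    next
      assume R: "\<forall>r\<in>reps a. cmp_ok Q a r (restrict \<psi> (K a r))"
      show "cst_ok a {..<h} (?f \<psi>)" unfolding cst_ok_def
      proof (intro ballI)
        fix u v assume uv: "u \<in> {..<h}" "v \<in> {..<h}"
        have comp: "arc_constraint I a u v (?f \<psi> u) (?f \<psi> v)" if "r \<in> reps a" "u \<in> ?C \<union> K a r" "v \<in> ?C \<union> K a r" for r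
        proof -
          have Kr: "K a r \<subseteq> U" using K_sub reps_sub that(1) by blast
          have eq: "glue Q (K a r) (restrict \<psi> (K a r)) w = ?f \<psi> w" if "w \<in> ?C \<union> K a r" for w
            using that Kr U_sub by (auto simp: glue_def)
          have "arc_constraint I a u v (glue Q (K a r) (restrict \<psi> (K a r)) u) (glue Q (K a r) (restrict \<psi> (K a r)) v)"
            using R that unfolding cmp_ok_def cst_ok_def by blast
          then show "arc_constraint I a u v (?f \<psi> u) (?f \<psi> v)" unfolding eq[OF that(2)] eq[OF that(3)] .
        qed
        \<comment> \<open>Two vertices of source components that are not linked by a step carry no
          constraint. All other pairs lie outside the source components or involve a single glued
          component.\<close>
        consider "u \<in> ?C" "v \<in> ?C" | r where "r \<in> reps a" "u \<in> ?C \<union> K a r" "v \<in> ?C \<union> K a r"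
          | "(u, v) \<notin> EH" "\<not> identified I a u v"
        proof (cases "u \<in> U \<and> v \<in> U")
          case True
          then obtain r where r: "r \<in> reps a" "u \<in> K a r" using Union_K by blast
          show thesis
          proof (cases "(u, v) \<in> ST a")
            case True
            then have "v \<in> K a r" using r by (auto simp: K_def intro: rtrancl_into_rtrancl)
            then show thesis using r that(2) by blast
          next
            case False
            then show thesis using \<open>u \<in> U \<and> v \<in> U\<close> that(3) by (simp add: ST_iff)
          qed
        next
          case False
          show thesis
          proof (cases "u \<in> U \<or> v \<in> U")
            case True
            then obtain r where "r \<in> reps a" "u \<in> K a r \<or> v \<in> K a r" using Union_K by blast
            then show thesis using that(2) False uv by (metis DiffI UnCI K_sub reps_sub(1) subsetD)
          next
            case False
            then show thesis using that(1) uv by blast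
          qed
        qed
        then show "arc_constraint I a u v (?f \<psi> u) (?f \<psi> v)"
        proof cases
          case 1
          then have "arc_constraint I a u v (?\<phi> u) (?\<phi> v)" using True by (simp add: cst_ok_def)
          then show ?thesis using 1 by (simp add: glue_def)
        next
          case 2
          then show ?thesis by (rule comp)
        next
          case 3
          then show ?thesis using uv by (simp add: arc_constraint_def arcH)
        qed
      qed
    qed
    have bck: "?f (restrict \<psi> U) = \<psi>" if "\<psi> \<in> ?S" for \<psi>
      using that by (intro extensionalityI[of _ "{..<h}"]) (auto simp: glue_def PiE_iff)
    have "bij_betw ?f ?L ?S"
    proof (rule bij_betwI[where g = "\<lambda>\<psi>. restrict \<psi> U"])
      show "?f \<in> ?L \<rightarrow> ?S"
      proof
        fix \<psi> assume \<psi>: "\<psi> \<in> ?L"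
        then have "?f \<psi> \<in> {..<h} \<rightarrow>\<^sub>E {..<n}" using \<phi> by (auto simp: glue_def PiE_iff)
        moreover have "cst_ok a {..<h} (?f \<psi>)" using \<psi> ok by blast
        ultimately show "?f \<psi> \<in> ?S" by (auto simp: glue_def)
      qed
      show "(\<lambda>\<psi>. restrict \<psi> U) \<in> ?S \<rightarrow> ?L"
      proof
        fix \<psi> assume \<psi>: "\<psi> \<in> ?S"
        then have "cst_ok a {..<h} (?f (restrict \<psi> U))" using bck[OF \<psi>] by simp
        then have "\<forall>r\<in>reps a. cmp_ok Q a r (restrict (restrict \<psi> U) (K a r))" using ok by blast
        moreover have "restrict \<psi> U \<in> U \<rightarrow>\<^sub>E {..<n}" using \<psi> U_sub by (auto simp: PiE_iff)
        ultimately show "restrict \<psi> U \<in> ?L" by blast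
      qed
      show "restrict (?f \<psi>) U = \<psi>" if "\<psi> \<in> ?L" for \<psi>
        using that U_sub(1) by (intro extensionalityI[of _ U]) (auto simp: glue_def PiE_iff)
    qed (rule bck)
    from bij_betw_same_card[OF this] show ?thesis using extension_count True by simp
  qed
qed


section \<open>Injectivity by inclusion-exclusion\<close>

definition hom :: "(nat \<Rightarrow> nat) set" where
  "hom = {\<psi> \<in> {..<h} \<rightarrow>\<^sub>E {..<n}. \<forall>(u, v)\<in>EH. (\<psi> u, \<psi> v) \<in> EG}"

lemma finite_hom: "finite hom"
  unfolding hom_def using finite_PiE[of "{..<h}" "\<lambda>_. {..<n}"] by simp

text \<open>Rewrites the constraints over matrix cells: cell c stands for the pair of
  \<open>c div h\<close> and \<open>c mod h\<close>, which is the form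
  \<open>inclusion_exclusion_dig\<close> works with.\<close>

lemma cst_ok_iff:
  assumes \<psi>: "\<psi> \<in> {..<h} \<rightarrow>\<^sub>E {..<n}"
  shows "cst_ok a {..<h} \<psi> \<longleftrightarrow> \<psi> \<in> hom \<and>
    (\<forall>c<m. digit 2 m a c = 1 \<longrightarrow> c div h < c mod h \<and> \<psi> (c div h) = \<psi> (c mod h))" (is "_ \<longleftrightarrow> _ \<and> ?E")
proof -
  have "cst_ok a {..<h} \<psi> \<longleftrightarrow> (\<forall>u<h. \<forall>v<h. ((u, v) \<in> EH \<longrightarrow> (\<psi> u, \<psi> v) \<in> EG) \<and> (identified I a u v \<longrightarrow> u < v \<and> \<psi> u = \<psi> v))"
    unfolding cst_ok_def using \<psi> by (auto simp: cst_iff PiE_iff)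
  also have "\<dots> \<longleftrightarrow> \<psi> \<in> hom \<and> (\<forall>u<h. \<forall>v<h. identified I a u v \<longrightarrow> u < v \<and> \<psi> u = \<psi> v)"
    using \<psi> EH_sub by (fastforce simp: hom_def)
  also have "(\<forall>u<h. \<forall>v<h. identified I a u v \<longrightarrow> u < v \<and> \<psi> u = \<psi> v) \<longleftrightarrow> ?E"
  proof (intro iffI allI impI)
    fix c assume R: "\<forall>u<h. \<forall>v<h. identified I a u v \<longrightarrow> u < v \<and> \<psi> u = \<psi> v" and c: "c < m" "digit 2 m a c = 1"
    have "0 < h" using c(1) by (cases h) auto
    then have "c div h < h" "c mod h < h" using c(1) by (auto simp: less_mult_imp_div_less)
    moreover have "identified I a (c div h) (c mod h)" using c(2) by (simp add: identified_def flip: h_def)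
    ultimately show "c div h < c mod h \<and> \<psi> (c div h) = \<psi> (c mod h)" using R by blast
  next
    fix u v assume E: ?E and uv: "u < h" "v < h" and e: "identified I a u v"
    have "u * h + v < u * h + h" using uv by simp
    also have "\<dots> = (u + 1) * h" by simp
    also have "\<dots> \<le> h * h" using uv by (intro mult_right_mono) auto
    finally have "u * h + v < m" .
    moreover have "(u * h + v) div h = u" "(u * h + v) mod h = v" using uv by auto
    moreover have "digit 2 m a (u * h + v) = 1" using e by (simp add: identified_def flip: h_def)
    ultimately show "u < v \<and> \<psi> u = \<psi> v" using E by metis
  qed
  finally show ?thesis .
qed

lemma inj_iff:
  "(\<forall>c<m. \<not> (c div h < c mod h \<and> \<psi> (c div h) = \<psi> (c mod h))) \<longleftrightarrow> inj_on \<psi> {..<h}" (is "?L \<longleftrightarrow> ?R")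
proof
  assume L: ?L
  have lt: "\<psi> u \<noteq> \<psi> v" if "u < v" "v < h" for u v
  proof -
    have "u * h + v < u * h + h" using that by simp
    also have "\<dots> = (u + 1) * h" by simp
    also have "\<dots> \<le> h * h" using that by (intro mult_right_mono) auto
    finally have "u * h + v < m" .
    moreover have "(u * h + v) div h = u" "(u * h + v) mod h = v" using that by auto
    ultimately show ?thesis using L that(1) by metis
  qed
  show ?R
  proof (rule inj_onI)
    fix u v assume "u \<in> {..<h}" "v \<in> {..<h}" "\<psi> u = \<psi> v"
    then show "u = v" using lt[of u v] lt[of v u] by (cases u v rule: linorder_cases) auto
  qed
next
  assume R: ?R
  show ?L
  proof (intro allI impI notI)
    fix c assume c: "c < m" and e: "c div h < c mod h \<and> \<psi> (c div h) = \<psi> (c mod h)"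
    have "0 < h" using c by (cases h) auto
    then have "c div h < h" "c mod h < h" using c by (auto simp: less_mult_imp_div_less)
    then show False using inj_onD[OF R, of "c div h" "c mod h"] e by auto
  qed
qed

text \<open>After exchanging the sums, each homomorphism extending the given map receives the
  alternating sum over all sets of pairs on which it coincides, and this is 1 if it is injective and
  0 otherwise.\<close>

lemma con_eq:
  assumes Q: "Q < n ^ h"
  shows "embedding_count I Q = card {\<psi> \<in> hom. inj_on \<psi> {..<h} \<and> (\<forall>v\<in>{..<h} - U. \<psi> v = digit n h Q v)}"
proof -
  define S where "S = {\<psi> \<in> hom. \<forall>v\<in>{..<h} - U. \<psi> v = digit n h Q v}"
  define E where "E \<psi> c \<longleftrightarrow> c div h < c mod h \<and> \<psi> (c div h) = \<psi> (c mod h)" for \<psi> :: "nat \<Rightarrow> nat" and c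
  have fS: "finite S" using finite_hom by (simp add: S_def)
  have extension_count: "int (extension_count I Q a) = (\<Sum>\<psi>\<in>S. of_bool (\<forall>c<m. digit 2 m a c = 1 \<longrightarrow> E \<psi> c))" for a
  proof -
    have "{\<psi> \<in> {..<h} \<rightarrow>\<^sub>E {..<n}. (\<forall>v\<in>{..<h} - U. \<psi> v = digit n h Q v) \<and> cst_ok a {..<h} \<psi>} =
      {\<psi>\<in>S. \<forall>c<m. digit 2 m a c = 1 \<longrightarrow> E \<psi> c}"
      using cst_ok_iff by (auto simp: S_def E_def hom_def)
    also have "\<dots> = S \<inter> {\<psi>. \<forall>c<m. digit 2 m a c = 1 \<longrightarrow> E \<psi> c}" by auto
    finally show ?thesis unfolding ext_eq[OF Q] using fS by (simp only: sum_of_bool_eq)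
  qed
  let ?o = "\<lambda>a. \<Sum>c<m. digit 2 m a c"
  let ?pos = "\<Sum>a<2 ^ m. of_bool (even (?o a)) * extension_count I Q a"
  let ?neg = "\<Sum>a<2 ^ m. of_bool (odd (?o a)) * extension_count I Q a"
  have "int ?pos - int ?neg = (\<Sum>a<2 ^ m. (-1) ^ ?o a * int (extension_count I Q a))"
    unfolding of_nat_sum sum_subtractf[symmetric] by (intro sum.cong refl) auto
  also have "\<dots> = (\<Sum>\<psi>\<in>S. \<Sum>a<2 ^ m. (-1) ^ ?o a * of_bool (\<forall>c<m. digit 2 m a c = 1 \<longrightarrow> E \<psi> c))"
    unfolding extension_count sum_distrib_left by (rule sum.swap)
  also have "\<dots> = (\<Sum>\<psi>\<in>S. of_bool (\<forall>c<m. \<not> E \<psi> c))" by (intro sum.cong refl inclusion_exclusion_dig)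
  also have "\<dots> = (\<Sum>\<psi>\<in>S. of_bool (inj_on \<psi> {..<h}))" unfolding E_def inj_iff ..
  also have "\<dots> = int (card (S \<inter> {\<psi>. inj_on \<psi> {..<h}}))" using fS by (simp only: sum_of_bool_eq)
  also have "S \<inter> {\<psi>. inj_on \<psi> {..<h}} = {\<psi> \<in> hom. inj_on \<psi> {..<h} \<and> (\<forall>v\<in>{..<h} - U. \<psi> v = digit n h Q v)}"
    by (auto simp: S_def)
  finally have "?pos - ?neg = card {\<psi> \<in> hom. inj_on \<psi> {..<h} \<and> (\<forall>v\<in>{..<h} - U. \<psi> v = digit n h Q v)}" by linarith
  then show ?thesis by (simp add: embedding_count_def num_ones_def flip: h_def)
qed

section \<open>Good codes and homomorphisms\<close>

lemma good_iff:
  "good C I j Q \<longleftrightarrow> (\<forall>v<h. v < j \<and> \<not> C I v \<longrightarrow> digit n h Q v = 0) \<and>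
    (\<forall>s<h. \<exists>g<n. \<forall>v<h. v < j \<and> C I v \<and> (s, v) \<in> EH\<^sup>* \<longrightarrow> digit n h Q v \<in> ball_of EG m g)"
proof -
  have "(\<exists>g<n. \<forall>v<h. v < j \<and> C I v \<and> reaches I s v \<longrightarrow> has_bit I (ball_mask I g) (digit n h Q v)) \<longleftrightarrow>
    (\<exists>g<n. \<forall>v<h. v < j \<and> C I v \<and> (s, v) \<in> EH\<^sup>* \<longrightarrow> digit n h Q v \<in> ball_of EG m g)" if "s < h" for s
    using tb_ball that by (auto simp: reach_iff)
  then show ?thesis unfolding good_def h_def[symmetric] n_def[symmetric] by blast
qed

text \<open>Walks are mapped to walks of the same length, and reachability in H needs no more than
  \<open>h * h\<close> steps.\<close>

lemma hom_ball:
  assumes \<psi>: "\<psi> \<in> hom" and sv: "(s, v) \<in> EH\<^sup>*"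
  shows "\<psi> v \<in> ball_of EG m (\<psi> s)"
proof -
  have "\<psi> v \<in> ball_of EG k (\<psi> s)" if "v \<in> ball_of EH k s" for v k
    using that
  proof (induction k arbitrary: v)
    case (Suc k)
    then show ?case using \<psi> unfolding ball_of_Suc hom_def by fastforce
  qed (simp add: ball_of_0)
  then show ?thesis
    using sv ball_of_rtrancl[of EH m v s] finite_on_verts[of h "has_arc I 0"] on_vertsH by auto
qed

lemma hom_good:
  assumes \<psi>: "\<psi> \<in> hom" and Q: "\<And>v. v < h \<Longrightarrow> digit n h Q v = (if C I v then \<psi> v else 0)"
  shows "good C I j Q"
  unfolding good_iff
proof (intro conjI allI impI)
  fix s assume s: "s < h"
  show "\<exists>g<n. \<forall>v<h. v < j \<and> C I v \<and> (s, v) \<in> EH\<^sup>* \<longrightarrow> digit n h Q v \<in> ball_of EG m g"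
    using \<psi> s Q hom_ball[OF \<psi>] by (intro exI[of _ "\<psi> s"]) (auto simp: hom_def PiE_iff)
qed (use Q in auto)

text \<open>Double counting: an injective homomorphism is counted at exactly one code, its
  restriction to the vertices outside the source components with digits 0 elsewhere, and this code
  is good. Good codes that extend to no injective homomorphism contribute 0.\<close>

lemma sum_good_con:
  "(\<Sum>Q | Q < n ^ h \<and> good (\<lambda>I v. \<not> in_source I v) I h Q. embedding_count I Q) = card {\<psi>\<in>hom. inj_on \<psi> {..<h}}"
proof -
  let ?C = "\<lambda>I v. \<not> in_source I v"
  define GQ where "GQ = {Q. Q < n ^ h \<and> good ?C I h Q}"
  define M where "M = {\<psi>\<in>hom. inj_on \<psi> {..<h}}"
  let ?r = "\<lambda>\<psi> Q. \<forall>v\<in>{..<h} - U. \<psi> v = digit n h Q v"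
  have fin: "finite GQ" "finite M" using finite_hom by (auto simp: GQ_def M_def)
  have "(\<Sum>Q\<in>GQ. embedding_count I Q) = (\<Sum>Q\<in>GQ. card {\<psi>\<in>M. ?r \<psi> Q})"
  proof (intro sum.cong refl)
    fix Q assume "Q \<in> GQ"
    then have "Q < n ^ h" by (simp add: GQ_def)
    moreover have "{\<psi>\<in>M. ?r \<psi> Q} = {\<psi> \<in> hom. inj_on \<psi> {..<h} \<and> ?r \<psi> Q}" unfolding M_def by blast
    ultimately show "embedding_count I Q = card {\<psi>\<in>M. ?r \<psi> Q}" by (simp only: con_eq)
  qed
  also have "\<dots> = (\<Sum>Q\<in>GQ. \<Sum>\<psi>\<in>M. of_bool (?r \<psi> Q))"
  proof (intro sum.cong refl)
    fix Q
    have "{\<psi>\<in>M. ?r \<psi> Q} = M \<inter> {\<psi>. ?r \<psi> Q}" by blast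
    then show "card {\<psi>\<in>M. ?r \<psi> Q} = (\<Sum>\<psi>\<in>M. of_bool (?r \<psi> Q))"
      by (subst sum_of_bool_eq) (use fin(2) in simp_all)
  qed
  also have "\<dots> = (\<Sum>\<psi>\<in>M. \<Sum>Q\<in>GQ. of_bool (?r \<psi> Q))" by (rule sum.swap)
  also have "\<dots> = (\<Sum>\<psi>\<in>M. 1)"
  proof (intro sum.cong refl)
    fix \<psi> assume "\<psi> \<in> M"
    then have \<psi>: "\<psi> \<in> hom" by (simp add: M_def)
    have lt: "(if \<not> in_source I v then \<psi> v else 0) < n" if "v < h" for v
      using \<psi> that by (fastforce simp: hom_def PiE_iff)
    obtain Q where Q: "Q < n ^ h" "\<And>v. v < h \<Longrightarrow> digit n h Q v = (if \<not> in_source I v then \<psi> v else 0)"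
      by (rule dig_surj[of h "\<lambda>v. if \<not> in_source I v then \<psi> v else 0" n]) (use lt in auto)
    have "good ?C I h Q" using Q(2) by (intro hom_good[OF \<psi>]) simp
    have "GQ \<inter> {Q. ?r \<psi> Q} = {Q}"
    proof (intro equalityI subsetI)
      fix Q' assume Q': "Q' \<in> GQ \<inter> {Q. ?r \<psi> Q}"
      have "digit n h Q' v = digit n h Q v" if "v < h" for v
        using Q' Q(2)[OF that] that by (auto simp: GQ_def good_iff U_def)
      then have "Q' div n ^ (h - h) = Q div n ^ (h - h)" using Q' Q(1) by (intro prefix_eq) (auto simp: GQ_def)
      then show "Q' \<in> {Q}" by simp
    next
      fix Q' assume "Q' \<in> {Q}"
      then show "Q' \<in> GQ \<inter> {Q. ?r \<psi> Q}" using Q \<open>good ?C I h Q\<close> by (auto simp: GQ_def U_def)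
    qed
    then show "(\<Sum>Q\<in>GQ. of_bool (?r \<psi> Q)) = (1::nat)" by (subst sum_of_bool_eq) (use fin(1) in simp_all)
  qed
  finally show ?thesis unfolding GQ_def[symmetric] M_def[symmetric] by simp
qed

section \<open>Induced embeddings and automorphisms\<close>

definition iemb :: "(nat \<Rightarrow> nat) set" where
  "iemb = {\<psi> \<in> {..<h} \<rightarrow>\<^sub>E {..<n}. inj_on \<psi> {..<h} \<and> (\<forall>u<h. \<forall>v<h. (u, v) \<in> EH \<longleftrightarrow> (\<psi> u, \<psi> v) \<in> EG)}"

lemma iemb_hom: "iemb \<subseteq> hom"
  using EH_sub by (fastforce simp: iemb_def hom_def)

lemma inj_on_lessThan_iff: "inj_on f {..<h} \<longleftrightarrow> (\<forall>u<h. \<forall>v<h. u \<noteq> v \<longrightarrow> f u \<noteq> f v)"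
  by (auto simp: inj_on_def)

text \<open>The target digraph is left general in order to serve both the host and the pattern
  itself.\<close>

lemma card_induced_embedding:
  assumes F: "\<And>x y. x < k \<Longrightarrow> has_arc I b x y \<longleftrightarrow> (x, y) \<in> F"
  defines "M \<equiv> {\<psi> \<in> {..<h} \<rightarrow>\<^sub>E {..<k}. inj_on \<psi> {..<h} \<and> (\<forall>u<h. \<forall>v<h. (u, v) \<in> EH \<longleftrightarrow> (\<psi> u, \<psi> v) \<in> F)}"
  shows "Q < k ^ h \<Longrightarrow> induced_embedding I b k Q \<longleftrightarrow> (\<lambda>v\<in>{..<h}. digit k h Q v) \<in> M"
    and "card {Q. Q < k ^ h \<and> induced_embedding I b k Q} = card M"
proof -
  let ?f = "\<lambda>Q. \<lambda>v\<in>{..<h}. digit k h Q v"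
  show induced_embedding: "induced_embedding I b k Q \<longleftrightarrow> ?f Q \<in> M" if Q: "Q < k ^ h" for Q
  proof -
    have "?f Q \<in> {..<h} \<rightarrow>\<^sub>E {..<k}" using bij_dig[of k h] Q by (meson bij_betwE lessThan_iff)
    then have lt: "digit k h Q v < k" if "v < h" for v using that by (auto simp: PiE_iff)
    have "inj_on (?f Q) {..<h} \<longleftrightarrow> (\<forall>u<h. \<forall>v<h. u \<noteq> v \<longrightarrow> digit k h Q u \<noteq> digit k h Q v)"
      unfolding inj_on_lessThan_iff by simp
    moreover have "(\<forall>u<h. \<forall>v<h. (u, v) \<in> EH \<longleftrightarrow> (?f Q u, ?f Q v) \<in> F) \<longleftrightarrow>
      (\<forall>u<h. \<forall>v<h. has_arc I 0 u v \<longleftrightarrow> has_arc I b (digit k h Q u) (digit k h Q v))"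
      using arcH F[OF lt] by simp
    ultimately show ?thesis
      unfolding induced_embedding_def M_def h_def[symmetric] using \<open>?f Q \<in> _\<close> by blast
  qed
  have eq: "{Q. Q < k ^ h \<and> induced_embedding I b k Q} = {Q. Q < k ^ h \<and> ?f Q \<in> M}" using induced_embedding by auto
  have "card {Q. Q < k ^ h \<and> induced_embedding I b k Q} = card (?f ` {Q. Q < k ^ h \<and> ?f Q \<in> M})"
    unfolding eq
    using inj_on_dig[of k h] by (intro card_image[symmetric]) (auto simp: inj_on_def)
  also have "?f ` {Q. Q < k ^ h \<and> ?f Q \<in> M} = M"
  proof -
    have "M \<subseteq> ?f ` {..<k ^ h}" using bij_betw_imp_surj_on[OF bij_dig[of k h]] by (auto simp: M_def)
    then show ?thesis by auto
  qed
  finally show "card {Q. Q < k ^ h \<and> induced_embedding I b k Q} = card M" .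
qed

lemma sum_good_ind:
  "(\<Sum>Q | Q < n ^ h \<and> good (\<lambda>I v. True) I h Q. of_bool (induced_embedding I 1 n Q)) = card iemb"
proof -
  note card_induced_embedding = card_induced_embedding[where k = n and F = EG and b = 1, OF arcG]
  have "good (\<lambda>I v. True) I h Q" if "Q < n ^ h" "induced_embedding I 1 n Q" for Q
  proof (rule hom_good)
    have "(\<lambda>v\<in>{..<h}. digit n h Q v) \<in> iemb" using card_induced_embedding(1)[OF _ that(1)] that(2) unfolding iemb_def by simp
    then show "(\<lambda>v\<in>{..<h}. digit n h Q v) \<in> hom" using iemb_hom by (rule subsetD[rotated])
  qed simp
  then have "{Q. Q < n ^ h \<and> good (\<lambda>I v. True) I h Q} \<inter> {Q. induced_embedding I 1 n Q} = {Q. Q < n ^ h \<and> induced_embedding I 1 n Q}"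
    by blast
  then show ?thesis using card_induced_embedding(2) unfolding iemb_def by (subst sum_of_bool_eq) simp_all
qed

lemma aut_eq: "automorphism_count I = card (isos {..<h} EH {..<h} EH)"
proof -
  have "isos {..<h} EH {..<h} EH =
    {\<psi> \<in> {..<h} \<rightarrow>\<^sub>E {..<h}. inj_on \<psi> {..<h} \<and> (\<forall>u<h. \<forall>v<h. (u, v) \<in> EH \<longleftrightarrow> (\<psi> u, \<psi> v) \<in> EH)}"
    using endo_inj_surj[of "{..<h}"] unfolding isos_def bij_betw_def PiE_iff by blast
  moreover have "automorphism_count I = card {Q. Q < h ^ h \<and> induced_embedding I 0 h Q}"
    unfolding automorphism_count_def h_def[symmetric] by (subst sum_of_bool_eq) (simp_all add: lessThan_def Int_def)
  ultimately show ?thesis using card_induced_embedding(2)[OF arcH] by simp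
qed

end

section \<open>Copies and isomorphisms\<close>

text \<open>An isomorphism in the sense of the library consists of maps on vertices and arcs
  together with new head and tail functions. Between digraphs whose arcs are pairs it is determined
  by the vertex map. The directions are opposite, so the vertex map is inverted.\<close>

lemma digraph_iso_iff_isos:
  assumes K: "wf_digraph (with_proj K)" and H: "wf_digraph (with_proj H)"
  shows "digraph_iso (with_proj K) (with_proj H) \<longleftrightarrow> isos (pverts H) (parcs H) (pverts K) (parcs K) \<noteq> {}"
proof
  interpret K: wf_digraph "with_proj K" by (rule K)
  assume "digraph_iso (with_proj K) (with_proj H)"
  then obtain f where f: "pre_digraph.digraph_isomorphism (with_proj K) f" "with_proj H = app_iso f (with_proj K)"
    by (auto simp: digraph_iso_def)
  define \<theta> where "\<theta> = iso_verts f"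
  have 1: "pverts H = \<theta> ` pverts K" "parcs H = iso_arcs f ` parcs K" "iso_tail f = fst" "iso_head f = snd"
    using f(2) by (simp_all add: with_proj_def app_iso_def \<theta>_def)
  have 2: "inj_on \<theta> (pverts K)" "\<And>e. e \<in> parcs K \<Longrightarrow> iso_arcs f e = (\<theta> (fst e), \<theta> (snd e))"
    using f(1) 1(3,4) unfolding K.digraph_isomorphism_def by (auto simp: \<theta>_def prod_eq_iff)
  have K': "fst e \<in> pverts K" "snd e \<in> pverts K" if "e \<in> parcs K" for e
    using K.wellformed[of e] that by auto
  define \<psi> where "\<psi> = restrict (the_inv_into (pverts K) \<theta>) (pverts H)"
  have bij: "bij_betw \<theta> (pverts K) (pverts H)" using 1 2 by (simp add: bij_betw_def)
  have \<psi>: "bij_betw \<psi> (pverts H) (pverts K)"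
    unfolding \<psi>_def using bij_betw_the_inv_into[OF bij] by (subst bij_betw_cong) auto
  have inv: "\<psi> (\<theta> w) = w" if "w \<in> pverts K" for w
    using that 2(1) 1(1) by (simp add: \<psi>_def the_inv_into_f_f)
  have "(u, v) \<in> parcs H \<longleftrightarrow> (\<psi> u, \<psi> v) \<in> parcs K" if uv: "u \<in> pverts H" "v \<in> pverts H" for u v
  proof -
    obtain x y where xy: "x \<in> pverts K" "y \<in> pverts K" "u = \<theta> x" "v = \<theta> y" using uv 1(1) by auto
    have "(u, v) \<in> parcs H \<longleftrightarrow> (\<exists>e\<in>parcs K. (\<theta> (fst e), \<theta> (snd e)) = (\<theta> x, \<theta> y))"
      unfolding 1(2) using 2(2) xy by force
    also have "\<dots> \<longleftrightarrow> (\<exists>e\<in>parcs K. e = (x, y))"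
      using 2(1) K' xy by (intro bex_cong refl) (auto simp: inj_on_def prod_eq_iff)
    finally show ?thesis using inv xy by simp
  qed
  then have "\<psi> \<in> isos (pverts H) (parcs H) (pverts K) (parcs K)"
    using \<psi> by (auto simp: isos_def \<psi>_def bij_betw_def)
  then show "isos (pverts H) (parcs H) (pverts K) (parcs K) \<noteq> {}" by blast
next
  interpret K: wf_digraph "with_proj K" by (rule K)
  interpret H: wf_digraph "with_proj H" by (rule H)
  assume "isos (pverts H) (parcs H) (pverts K) (parcs K) \<noteq> {}"
  then obtain \<psi> where \<psi>: "bij_betw \<psi> (pverts H) (pverts K)"
    "\<And>u v. u \<in> pverts H \<Longrightarrow> v \<in> pverts H \<Longrightarrow> (u, v) \<in> parcs H \<longleftrightarrow> (\<psi> u, \<psi> v) \<in> parcs K"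
    by (auto simp: isos_def)
  have K': "fst e \<in> pverts K" "snd e \<in> pverts K" if "e \<in> parcs K" for e
    using K.wellformed[of e] that by auto
  have H': "fst e \<in> pverts H" "snd e \<in> pverts H" if "e \<in> parcs H" for e
    using H.wellformed[of e] that by auto
  define \<theta> where "\<theta> = the_inv_into (pverts H) \<psi>"
  have \<theta>: "bij_betw \<theta> (pverts K) (pverts H)" unfolding \<theta>_def by (rule bij_betw_the_inv_into[OF \<psi>(1)])
  have inv: "\<And>v. v \<in> pverts H \<Longrightarrow> \<theta> (\<psi> v) = v" "\<And>w. w \<in> pverts K \<Longrightarrow> \<psi> (\<theta> w) = w"
    using \<psi>(1) by (auto simp: \<theta>_def bij_betw_def the_inv_into_f_f f_the_inv_into_f)
  have \<theta>V: "\<theta> w \<in> pverts H" if "w \<in> pverts K" for w using \<theta> that by (auto simp: bij_betw_def)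
  have \<psi>V: "\<psi> v \<in> pverts K" if "v \<in> pverts H" for v using \<psi>(1) that by (auto simp: bij_betw_def)
  \<comment> \<open>The vertex map forces the map on arcs, and the projections remain the head and
    tail functions.\<close>
  define f where "f = \<lparr> iso_verts = \<theta>, iso_arcs = map_prod \<theta> \<theta>, iso_head = snd, iso_tail = fst \<rparr>"
  have arcs: "parcs H = map_prod \<theta> \<theta> ` parcs K"
  proof (intro equalityI subrelI)
    fix u v assume uv: "(u, v) \<in> parcs H"
    then have "u \<in> pverts H" "v \<in> pverts H" using H'[OF uv] by auto
    then have "(\<psi> u, \<psi> v) \<in> parcs K" "(u, v) = map_prod \<theta> \<theta> (\<psi> u, \<psi> v)" using \<psi>(2) uv inv by auto
    then show "(u, v) \<in> map_prod \<theta> \<theta> ` parcs K" by blast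
  next
    fix u v assume "(u, v) \<in> map_prod \<theta> \<theta> ` parcs K"
    then obtain x y where xy: "(x, y) \<in> parcs K" "u = \<theta> x" "v = \<theta> y" by auto
    then show "(u, v) \<in> parcs H" using K'[OF xy(1)] \<psi>(2)[of u v] \<theta>V inv by auto
  qed
  have "inj_on (map_prod \<theta> \<theta>) (parcs K)"
  proof (rule inj_onI)
    fix e e' assume e: "e \<in> parcs K" "e' \<in> parcs K" and eq: "map_prod \<theta> \<theta> e = map_prod \<theta> \<theta> e'"
    have "\<theta> (fst e) = \<theta> (fst e')" "\<theta> (snd e) = \<theta> (snd e')"
      using arg_cong[OF eq, of fst] arg_cong[OF eq, of snd] by simp_all
    then show "e = e'" using K'[OF e(1)] K'[OF e(2)] bij_betw_imp_inj_on[OF \<theta>] by (auto simp: inj_on_def prod_eq_iff)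
  qed
  then have "pre_digraph.digraph_isomorphism (with_proj K) f"
    unfolding K.digraph_isomorphism_def using K \<theta> by (auto simp: f_def bij_betw_def)
  moreover have "with_proj H = app_iso f (with_proj K)"
    using arcs \<theta> by (simp add: with_proj_def app_iso_def f_def bij_betw_def)
  ultimately show "digraph_iso (with_proj K) (with_proj H)" unfolding digraph_iso_def by blast
qed

context pattern_host
begin

lemma wfH: "wf_digraph (with_proj H)" and wfG: "wf_digraph (with_proj G)"
proof -
  interpret H: pair_fin_digraph H by (rule encodingD(1)[OF encH])
  interpret G: pair_fin_digraph G by (rule encodingD(1)[OF encG])
  show "wf_digraph (with_proj H)" "wf_digraph (with_proj G)" by unfold_locales
qed

lemma aut_pos: "0 < automorphism_count I"
proof -
  have "(\<lambda>v\<in>{..<h}. v) \<in> isos {..<h} EH {..<h} EH"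
    unfolding isos_def by (auto simp: bij_betw_def inj_on_def)
  moreover have "finite (isos {..<h} EH {..<h} EH)"
    unfolding isos_def using finite_PiE[of "{..<h}" "\<lambda>_. {..<h}"] by simp
  ultimately show ?thesis unfolding aut_eq card_gt_0_iff by blast
qed

text \<open>An embedding determines its image subgraph, and the embeddings with image K are exactly
  the isomorphisms from H to K. By \<open>card_isos\<close> each fibre has as many elements as H has
  automorphisms.\<close>

lemma card_subgraph_copies:
  "card {\<psi>\<in>hom. inj_on \<psi> {..<h}} = card (subgraph_copies H G) * automorphism_count I"
proof -
  let ?M = "{\<psi>\<in>hom. inj_on \<psi> {..<h}}"
  define img where "img \<psi> = \<lparr> pverts = \<psi> ` {..<h}, parcs = map_prod \<psi> \<psi> ` EH \<rparr>" for \<psi> :: "nat \<Rightarrow> nat"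
  let ?iso = "\<lambda>K. isos {..<h} EH (pverts K) (parcs K)"
  have copies: "K \<in> subgraph_copies H G \<longleftrightarrow>
    pverts K \<subseteq> {..<n} \<and> parcs K \<subseteq> EG \<and> wf_digraph (with_proj K) \<and> ?iso K \<noteq> {}" for K
    using digraph_iso_iff_isos[OF _ wfH, of K] wfG
    by (auto simp: subgraph_copies_def subgraph_def compatible_def vH vG)
  have iso_img: "\<psi> \<in> ?iso (img \<psi>)" if "\<psi> \<in> ?M" for \<psi>
  proof -
    have inj: "inj_on \<psi> {..<h}" and \<psi>: "\<psi> \<in> {..<h} \<rightarrow>\<^sub>E {..<n}" using that by (auto simp: hom_def)
    have "(u, v) \<in> EH \<longleftrightarrow> (\<psi> u, \<psi> v) \<in> map_prod \<psi> \<psi> ` EH" if "u < h" "v < h" for u v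
    proof
      assume "(\<psi> u, \<psi> v) \<in> map_prod \<psi> \<psi> ` EH"
      then obtain x y where xy: "(x, y) \<in> EH" "\<psi> u = \<psi> x" "\<psi> v = \<psi> y" by auto
      then have "u = x" "v = y" using inj_onD[OF inj] EH_sub that by blast+
      then show "(u, v) \<in> EH" using xy by simp
    qed force
    then show ?thesis using inj \<psi> by (auto simp: isos_def img_def bij_betw_def PiE_iff)
  qed
  have img_copy: "img \<psi> \<in> subgraph_copies H G" if "\<psi> \<in> ?M" for \<psi>
  proof -
    have "wf_digraph (with_proj (img \<psi>))"
      by unfold_locales (use EH_sub in \<open>auto simp: img_def\<close>)
    moreover have "pverts (img \<psi>) \<subseteq> {..<n}" "parcs (img \<psi>) \<subseteq> EG"
      using that by (auto simp: hom_def img_def PiE_iff)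
    ultimately show ?thesis using copies iso_img[OF that] by blast
  qed
  have fiber: "{\<psi>\<in>?M. img \<psi> = K} = ?iso K" if K: "K \<in> subgraph_copies H G" for K
  proof (intro equalityI subsetI)
    fix \<psi> assume "\<psi> \<in> {\<psi>\<in>?M. img \<psi> = K}"
    then show "\<psi> \<in> ?iso K" using iso_img[of \<psi>] by auto
  next
    fix \<psi> assume \<psi>: "\<psi> \<in> ?iso K"
    interpret K: wf_digraph "with_proj K" using K copies by blast
    have b: "bij_betw \<psi> {..<h} (pverts K)" and arcs: "\<And>u v. u < h \<Longrightarrow> v < h \<Longrightarrow> (u, v) \<in> EH \<longleftrightarrow> (\<psi> u, \<psi> v) \<in> parcs K"
      and e: "\<psi> \<in> {..<h} \<rightarrow>\<^sub>E pverts K"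
      using \<psi> by (auto simp: isos_def)
    have "map_prod \<psi> \<psi> ` EH = parcs K"
    proof (intro equalityI subrelI)
      fix x y assume "(x, y) \<in> map_prod \<psi> \<psi> ` EH"
      then obtain u v where "(u, v) \<in> EH" "x = \<psi> u" "y = \<psi> v" by auto
      then show "(x, y) \<in> parcs K" using arcs EH_sub by auto
    next
      fix x y assume xy: "(x, y) \<in> parcs K"
      then have "x \<in> pverts K" "y \<in> pverts K" using K.wellformed[of "(x, y)"] by auto
      then have "x \<in> \<psi> ` {..<h}" "y \<in> \<psi> ` {..<h}" using b by (auto simp: bij_betw_def)
      then obtain u v where uv: "u < h" "v < h" "x = \<psi> u" "y = \<psi> v" by blast
      then have "(u, v) \<in> EH" using arcs xy by blast
      then show "(x, y) \<in> map_prod \<psi> \<psi> ` EH" using uv by force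
    qed
    moreover have "\<psi> ` {..<h} = pverts K" using b by (simp add: bij_betw_def)
    ultimately have "img \<psi> = K" by (simp add: img_def)
    moreover have "\<psi> \<in> hom"
    proof -
      have sub: "pverts K \<subseteq> {..<n}" "parcs K \<subseteq> EG" using K copies by auto
      have "\<psi> \<in> {..<h} \<rightarrow>\<^sub>E {..<n}" using PiE_mono[of "{..<h}" "\<lambda>_. pverts K" "\<lambda>_. {..<n}"] sub(1) e by blast
      moreover have "(\<psi> u, \<psi> v) \<in> EG" if "(u, v) \<in> EH" for u v
        using arcs[of u v] EH_sub sub(2) that by auto
      ultimately show ?thesis by (auto simp: hom_def)
    qed
    ultimately show "\<psi> \<in> {\<psi>\<in>?M. img \<psi> = K}" using b by (auto simp: bij_betw_def)
  qed
  have "subgraph_copies H G \<subseteq> img ` ?M"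
  proof
    fix K assume K: "K \<in> subgraph_copies H G"
    then have "?iso K \<noteq> {}" using copies by simp
    then obtain \<psi> where "\<psi> \<in> ?iso K" by (meson ex_in_conv)
    then have "\<psi> \<in> {\<psi>\<in>?M. img \<psi> = K}" by (simp only: fiber[OF K])
    then show "K \<in> img ` ?M" by auto
  qed
  \<comment> \<open>Every copy is the image of one of finitely many embeddings.\<close>
  then have "finite (subgraph_copies H G)" using finite_hom finite_subset by fastforce
  then have "card ?M = (\<Sum>K\<in>subgraph_copies H G. card {\<psi>\<in>?M. img \<psi> = K})"
    using finite_hom img_copy by (intro sum_card_fibers[symmetric]) auto
  also have "\<dots> = (\<Sum>K\<in>subgraph_copies H G. automorphism_count I)"
  proof (intro sum.cong refl)
    fix K assume K: "K \<in> subgraph_copies H G"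
    then have "?iso K \<noteq> {}" using copies by simp
    then obtain \<psi> where "\<psi> \<in> ?iso K" by (meson ex_in_conv)
    from card_isos[OF this] show "card {\<psi>\<in>?M. img \<psi> = K} = automorphism_count I" unfolding fiber[OF K] aut_eq .
  qed
  finally show ?thesis by simp
qed

text \<open>The fibre argument of \<open>card_subgraph_copies\<close>; the arcs of an induced copy
  are determined by its vertex set, so the image of the vertices alone suffices.\<close>

lemma card_induced_copies: "card iemb = card (induced_copies H G) * automorphism_count I"
proof -
  let ?iso = "\<lambda>S. isos {..<h} EH S (EG \<inter> S \<times> S)"
  have copies: "S \<in> induced_copies H G \<longleftrightarrow> S \<subseteq> {..<n} \<and> ?iso S \<noteq> {}" for S
  proof -
    let ?K = "\<lparr> pverts = S, parcs = EG \<inter> S \<times> S \<rparr>"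
    have wf: "wf_digraph (with_proj ?K)" by unfold_locales auto
    have "with_proj G \<restriction> S = with_proj ?K"
      by (auto simp: induce_subgraph_def with_proj_def)
    then have "digraph_iso (with_proj G \<restriction> S) (with_proj H) \<longleftrightarrow> ?iso S \<noteq> {}"
      using digraph_iso_iff_isos[OF wf wfH] by (simp add: vH)
    then show ?thesis by (auto simp: induced_copies_def vG)
  qed
  have fiber: "{\<psi>\<in>iemb. \<psi> ` {..<h} = S} = ?iso S" if "S \<subseteq> {..<n}" for S
    using that by (auto simp: iemb_def isos_def bij_betw_def PiE_iff)
  have sub: "induced_copies H G \<subseteq> Pow {..<n}" using copies by blast
  have "card iemb = (\<Sum>S\<in>induced_copies H G. card {\<psi>\<in>iemb. \<psi> ` {..<h} = S})"
  proof (rule sum_card_fibers[symmetric])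
    show "finite iemb" using finite_subset[OF iemb_hom finite_hom] .
    show "finite (induced_copies H G)" by (rule finite_subset[OF sub]) simp
    show "(\<lambda>\<psi>. \<psi> ` {..<h}) ` iemb \<subseteq> induced_copies H G"
    proof
      fix S assume "S \<in> (\<lambda>\<psi>. \<psi> ` {..<h}) ` iemb"
      then obtain \<psi> where \<psi>: "\<psi> \<in> iemb" "S = \<psi> ` {..<h}" by blast
      then have "S \<subseteq> {..<n}" by (auto simp: iemb_def PiE_iff)
      moreover have "\<psi> \<in> {\<psi>\<in>iemb. \<psi> ` {..<h} = S}" using \<psi> by simp
      then have "?iso S \<noteq> {}" using fiber[OF \<open>S \<subseteq> {..<n}\<close>] by auto
      ultimately show "S \<in> induced_copies H G" using copies by simp
    qed
  qed
  also have "\<dots> = (\<Sum>S\<in>induced_copies H G. automorphism_count I)"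
  proof (intro sum.cong refl)
    fix S assume "S \<in> induced_copies H G"
    then have S': "S \<subseteq> {..<n}" "?iso S \<noteq> {}" using copies by auto
    then obtain \<psi> where S: "S \<subseteq> {..<n}" "\<psi> \<in> ?iso S" by (meson ex_in_conv)
    from card_isos[OF S(2)] show "card {\<psi>\<in>iemb. \<psi> ` {..<h} = S} = automorphism_count I" unfolding fiber[OF S(1)] aut_eq .
  qed
  finally show ?thesis by simp
qed

end

section \<open>The number of iterations\<close>

context pattern_host
begin

text \<open>Goodness passes to shorter prefixes, so the number of good prefixes is the length of the
  longest one.\<close>

definition level :: "(nat list list \<Rightarrow> nat \<Rightarrow> bool) \<Rightarrow> nat \<Rightarrow> nat" where
  "level C Q = (\<Sum>j<h. of_bool (good C I (Suc j) Q))"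

lemma width_eq: "skip_width C I Q = n ^ (h - 1 - level C Q)"
  unfolding skip_width_def level_def h_def n_def ..

lemma n_pos: "Q < n ^ h \<Longrightarrow> 0 < h \<Longrightarrow> 0 < n"
  by (cases n) (auto simp: power_0_left)

lemma good_antimono: "good C I j Q \<Longrightarrow> i \<le> j \<Longrightarrow> good C I i Q"
  unfolding good_iff by (meson less_le_trans)

lemma level_props:
  assumes Q: "Q < n ^ h"
  shows "level C Q \<le> h" "good C I (level C Q) Q" "level C Q < h \<Longrightarrow> \<not> good C I (Suc (level C Q)) Q"
proof -
  have g0: "good C I 0 Q"
  proof -
    have "0 < n" if "0 < h" using n_pos[OF Q that] .
    then show ?thesis unfolding good_iff by auto
  qed
  define k where "k = (GREATEST k. k \<le> h \<and> good C I k Q)"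
  have k: "k \<le> h \<and> good C I k Q" unfolding k_def
    by (rule GreatestI_nat[where b = h and k = 0]) (use g0 in auto)
  have max: "j \<le> k" if "j \<le> h" "good C I j Q" for j
    unfolding k_def by (rule Greatest_le_nat[where b = h]) (use that in auto)
  have "good C I (Suc j) Q \<longleftrightarrow> j < k" if "j < h" for j
    using good_antimono[of C k Q "Suc j"] k max[of "Suc j"] that by auto
  then have "level C Q = (\<Sum>j<h. of_bool (j < k))" unfolding level_def by (intro sum.cong refl) auto
  also have "\<dots> = card ({..<h} \<inter> {j. j < k})" by simp
  also have "{..<h} \<inter> {j. j < k} = {..<k}" using k by auto
  finally have lk: "level C Q = k" by simp
  show "level C Q \<le> h" "good C I (level C Q) Q" using k lk by auto
  show "\<not> good C I (Suc (level C Q)) Q" if "level C Q < h"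
    using max[of "Suc k"] that lk by auto
qed

lemma dig_prefix:
  assumes "v < j" "j \<le> h" shows "digit n h Q v = (Q div n ^ (h - j)) div n ^ (j - 1 - v) mod n"
proof -
  have "h - 1 - v = (h - j) + (j - 1 - v)" using assms by simp
  then show ?thesis by (simp add: digit_def power_add div_mult2_eq)
qed

lemma good_prefix:
  assumes "Q div n ^ (h - j) = Q' div n ^ (h - j)" "j \<le> h"
  shows "good C I j Q \<longleftrightarrow> good C I j Q'"
proof -
  have "digit n h Q v = digit n h Q' v" if "v < j" for v
    using dig_prefix[OF that assms(2)] assms(1) by simp
  then show ?thesis unfolding good_iff by (simp cong: conj_cong imp_cong)
qed

text \<open>The codes that are skipped share with Q the shortest bad prefix. If all of Q is good,
  the step is 1 and nothing is skipped.\<close>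

lemma nxt_props:
  assumes Q: "Q < n ^ h"
  shows "Q < next_code C I Q" "next_code C I Q \<le> n ^ h" "\<And>Q'. Q < Q' \<Longrightarrow> Q' < next_code C I Q \<Longrightarrow> \<not> good C I h Q'"
proof -
  let ?k = "level C Q"
  let ?w = "n ^ (h - 1 - ?k)"
  have w: "0 < ?w"
  proof (cases "h = 0")
    case False
    then have "0 < n" using n_pos[OF Q] by simp
    then show ?thesis by simp
  qed simp
  have nx: "next_code C I Q = (Q div ?w + 1) * ?w" by (simp add: next_code_def width_eq)
  show "Q < next_code C I Q" unfolding nx using w by (metis Suc_eq_plus1 dividend_less_div_times mult.commute mult_Suc)
  \<comment> \<open>The width divides \<open>n ^ h\<close>, so rounding up to a multiple of it
    cannot overshoot.\<close>
  have "n ^ h = n ^ (h - (h - 1 - ?k)) * ?w" by (simp flip: power_add)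
  moreover from this have "Q div ?w < n ^ (h - (h - 1 - ?k))" using Q w by (simp add: less_mult_imp_div_less)
  ultimately show "next_code C I Q \<le> n ^ h" unfolding nx by (metis Suc_eq_plus1 Suc_leI mult_le_mono1)
  fix Q' assume Q': "Q < Q'" "Q' < next_code C I Q"
  show "\<not> good C I h Q'"
  proof (cases "?k < h")
    case False
    then have "h - 1 - ?k = 0" by simp
    then have "next_code C I Q = Suc Q" unfolding nx by (simp only: power_0) simp
    then show ?thesis using Q' by simp
  next
    case True
    have "Q' div ?w = Q div ?w"
    proof (rule antisym)
      show "Q div ?w \<le> Q' div ?w" using Q' by (intro div_le_mono) simp
      show "Q' div ?w \<le> Q div ?w" using Q'(2) w unfolding nx by (simp add: less_mult_imp_div_less flip: less_Suc_eq_le)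
    qed
    moreover have "h - 1 - ?k = h - Suc ?k" by simp
    ultimately have "good C I (Suc ?k) Q' \<longleftrightarrow> good C I (Suc ?k) Q"
      using True by (intro good_prefix) auto
    then show ?thesis using level_props(3)[OF Q True] good_antimono[of C h Q' "Suc ?k"] True by auto
  qed
qed

section \<open>The sequence of visited codes\<close>

definition seq :: "(nat list list \<Rightarrow> nat \<Rightarrow> bool) \<Rightarrow> nat \<Rightarrow> nat" where
  "seq C i = (next_code C I ^^ i) 0"

definition iters :: "(nat list list \<Rightarrow> nat \<Rightarrow> bool) \<Rightarrow> nat" where
  "iters C = (LEAST i. n ^ h \<le> seq C i)"

lemma seq_0 [simp]: "seq C 0 = 0"
  by (simp add: seq_def)

lemma seq_Suc: "seq C (Suc i) = next_code C I (seq C i)"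
  by (simp add: seq_def)

lemma iters_props:
  shows "n ^ h \<le> seq C (iters C)" "i < iters C \<Longrightarrow> seq C i < n ^ h" "i \<le> iters C \<Longrightarrow> seq C i \<le> n ^ h"
proof -
  have "\<exists>i. n ^ h \<le> seq C i"
  proof (rule ccontr)
    assume "\<not> (\<exists>i. n ^ h \<le> seq C i)"
    then have lt: "seq C i < n ^ h" for i by (simp add: not_le)
    have "i \<le> seq C i" for i
    proof (induction i)
      case (Suc i)
      then show ?case using nxt_props(1)[OF lt[of i], of C] by (simp add: seq_Suc)
    qed simp
    then show False using lt[of "n ^ h"] not_le by blast
  qed
  then show "n ^ h \<le> seq C (iters C)" unfolding iters_def by (rule LeastI_ex)
  show 2: "seq C i < n ^ h" if "i < iters C" for i using not_less_Least[OF that[unfolded iters_def]] by simp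
  show "seq C i \<le> n ^ h" if "i \<le> iters C"
  proof (cases i)
    case (Suc j)
    then show ?thesis using nxt_props(2)[OF 2[of j], of C] that by (simp add: seq_Suc)
  qed simp
qed

lemma seq_less: "i < j \<Longrightarrow> j \<le> iters C \<Longrightarrow> next_code C I (seq C i) \<le> seq C j"
proof (induction j)
  case (Suc j)
  then have lt: "seq C j < n ^ h" using iters_props(2) by simp
  show ?case
  proof (cases "i = j")
    case False
    then have "next_code C I (seq C i) \<le> seq C j" using Suc by simp
    then show ?thesis using nxt_props(1)[OF lt, of C] by (simp add: seq_Suc)
  qed (simp add: seq_Suc)
qed simp

lemma seq_strict: "i < j \<Longrightarrow> j \<le> iters C \<Longrightarrow> seq C i < seq C j"
  using seq_less[of i j C] nxt_props(1)[OF iters_props(2)[of i C], of C] by linarith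

lemma inj_seq: "inj_on (seq C) {..<iters C}"
proof (rule inj_onI)
  fix i j assume "i \<in> {..<iters C}" "j \<in> {..<iters C}" "seq C i = seq C j"
  then show "i = j" using seq_strict[of i j C] seq_strict[of j i C] by (cases i j rule: linorder_cases) auto
qed

text \<open>Good codes are never skipped, and the bad codes that are visited contribute 0.\<close>

lemma sum_seq:
  assumes "\<And>Q. \<not> good C I h Q \<Longrightarrow> F Q = (0::nat)"
  shows "(\<Sum>l<iters C. F (seq C l)) = (\<Sum>Q | Q < n ^ h \<and> good C I h Q. F Q)"
proof -
  have "(\<Sum>l<iters C. F (seq C l)) = (\<Sum>Q\<in>seq C ` {..<iters C}. F Q)"
    by (simp add: sum.reindex[OF inj_seq])
  also have "\<dots> = (\<Sum>Q | Q < n ^ h \<and> good C I h Q. F Q)"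
  proof (rule sum.mono_neutral_right)
    show "{Q. Q < n ^ h \<and> good C I h Q} \<subseteq> seq C ` {..<iters C}"
    proof
      fix Q assume "Q \<in> {Q. Q < n ^ h \<and> good C I h Q}"
      then have Q: "Q < n ^ h" "good C I h Q" by auto
      \<comment> \<open>The last visited code that is not beyond Q. Were it smaller than Q, then Q,
        being good, could not lie in the skipped gap, and the next visited code would not be beyond
        Q either.\<close>
      define l where "l = (GREATEST l. l < iters C \<and> seq C l \<le> Q)"
      have "seq C (iters C) \<noteq> 0" using iters_props(1)[of C] Q(1) by linarith
      then have pos: "0 < iters C" by (metis gr0I seq_0)
      have l: "l < iters C \<and> seq C l \<le> Q"
        unfolding l_def
        by (rule GreatestI_nat[where P = "\<lambda>l. l < iters C \<and> seq C l \<le> Q" and b = "iters C" and k = 0]) (simp_all add: pos)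
      have "\<not> seq C l < Q"
      proof
        assume "seq C l < Q"
        then have "\<not> Q < seq C (Suc l)"
          using nxt_props(3)[OF iters_props(2)[of l C], of Q C] l Q(2) by (auto simp: seq_Suc)
        moreover from this have "Suc l \<noteq> iters C" using iters_props(1)[of C] Q(1) by auto
        ultimately have "Suc l \<le> l"
          unfolding l_def using \<open>seq C l < Q\<close> l
          by (intro Greatest_le_nat[where P = "\<lambda>l. l < iters C \<and> seq C l \<le> Q" and b = "iters C"]) (auto simp flip: l_def)
        then show False by simp
      qed
      then show "Q \<in> seq C ` {..<iters C}" using l by force
    qed
    show "\<forall>Q\<in>seq C ` {..<iters C} - {Q. Q < n ^ h \<and> good C I h Q}. F Q = 0"
    proof
      fix Q assume "Q \<in> seq C ` {..<iters C} - {Q. Q < n ^ h \<and> good C I h Q}"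
      then have "\<not> good C I h Q" using iters_props(2) by auto
      then show "F Q = 0" by (rule assms)
    qed
  qed simp
  finally show ?thesis .
qed

definition Pre :: "(nat list list \<Rightarrow> nat \<Rightarrow> bool) \<Rightarrow> nat \<Rightarrow> nat set" where
  "Pre C k = (\<lambda>Q. Q div n ^ (h - k)) ` {Q. Q < n ^ h \<and> good C I k Q}"

text \<open>A visited code is charged to its longest good prefix and the digit that follows. Two
  visited codes with the same charge would lie in one block, but the step from the first leaves that
  block. Hence only good prefixes count, each at most \<open>n + 1\<close> times per length.\<close>

lemma iters_le:
  assumes M: "\<And>k. k \<le> h \<Longrightarrow> card (Pre C k) \<le> M"
  shows "iters C \<le> (h + 1) * (M * (n + 1))"
proof -
  let ?w = "\<lambda>Q. n ^ (h - 1 - level C Q)"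
  \<comment> \<open>The length of the longest good prefix, that prefix as a quotient, and, if the
    prefix is not the whole code, the first digit after it.\<close>
  define f where "f Q = (level C Q, Q div n ^ (h - level C Q), Q div ?w Q mod n)" for Q
  \<comment> \<open>The closed range of the last component keeps it nonempty for
    \<open>n = 0\<close>, where the only code is 0.\<close>
  let ?T = "SIGMA k:{..h}. Pre C k \<times> {..n}"
  have fin: "finite (Pre C k)" for k by (simp add: Pre_def)
  have div_eq: "Q div ?w Q = (if level C Q < h then Q div n ^ (h - level C Q) * n + Q div ?w Q mod n else Q div n ^ (h - level C Q))"
    if "Q < n ^ h" for Q
  proof (cases "level C Q < h")
    case True
    then have "h - level C Q = Suc (h - 1 - level C Q)" by simp
    then have "Q div n ^ (h - level C Q) = Q div ?w Q div n" by (simp only: power_Suc2 div_mult2_eq)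
    then show ?thesis using True by simp
  next
    case False
    then show ?thesis using level_props(1)[OF that, of C] by simp
  qed
  have "inj_on (\<lambda>i. f (seq C i)) {..<iters C}"
  proof (rule linorder_inj_onI)
    fix i j assume ij: "i < j" "i \<in> {..<iters C}" "j \<in> {..<iters C}"
    let ?Q = "seq C i" and ?R = "seq C j"
    have lt: "?Q < n ^ h" "?R < n ^ h" using ij iters_props(2) by auto
    have le: "next_code C I ?Q \<le> ?R" using seq_less[of i j C] ij by simp
    show "f ?Q \<noteq> f ?R"
    proof
      assume eq: "f ?Q = f ?R"
      then have lev: "level C ?Q = level C ?R" by (simp add: f_def)
      have "?Q div ?w ?Q = ?R div ?w ?R"
      proof -
        have "?Q div n ^ (h - level C ?R) = ?R div n ^ (h - level C ?R)"
          "?Q div ?w ?R mod n = ?R div ?w ?R mod n"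
          using eq unfolding f_def prod.inject lev by simp_all
        then show ?thesis by (subst div_eq[OF lt(1)], subst div_eq[OF lt(2)]) (simp only: lev)
      qed
      then have "?Q div ?w ?Q = ?R div ?w ?Q" by (simp only: lev)
      moreover have w: "0 < ?w ?Q"
      proof (cases "h = 0")
        case False
        then have "0 < n" using n_pos[OF lt(1)] by simp
        then show ?thesis by simp
      qed simp
      have "(?Q div ?w ?Q + 1) * ?w ?Q \<le> ?R" using le by (simp only: next_code_def width_eq)
      then have "(?Q div ?w ?Q + 1) * ?w ?Q div ?w ?Q \<le> ?R div ?w ?Q" by (rule div_le_mono)
      then have "?Q div ?w ?Q + 1 \<le> ?R div ?w ?Q" using w by (simp only: nonzero_mult_div_cancel_right[OF less_imp_neq[OF w, symmetric]])
      ultimately show False by simp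
    qed
  qed auto
  then have "iters C = card ((\<lambda>i. f (seq C i)) ` {..<iters C})" by (simp add: card_image)
  also have "\<dots> \<le> card ?T"
  proof (rule card_mono)
    show "finite ?T" using fin by auto
    show "(\<lambda>i. f (seq C i)) ` {..<iters C} \<subseteq> ?T"
    proof (intro image_subsetI)
      fix i assume "i \<in> {..<iters C}"
      then have lt: "seq C i < n ^ h" using iters_props(2) by simp
      have "seq C i div ?w (seq C i) mod n \<le> n"
      proof (cases "n = 0")
        case True
        then have "seq C i = 0" using lt by (cases "h = 0") (auto simp: power_0_left)
        then show ?thesis by simp
      next
        case False
        then show ?thesis by (simp add: less_imp_le)
      qed
      then show "f (seq C i) \<in> ?T" using level_props(1,2)[OF lt, of C] lt by (auto simp: f_def Pre_def)
    qed
  qed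
  also have "card ?T = (\<Sum>k\<le>h. card (Pre C k) * (n + 1))"
    using fin by (simp add: card_SigmaI card_cartesian_product)
  also have "\<dots> \<le> (\<Sum>k\<le>h. M * (n + 1))" using M by (intro sum_mono mult_right_mono) auto
  finally show ?thesis by simp
qed

lemma card_image_le_factor:
  assumes "finite S" "\<And>x y. x \<in> S \<Longrightarrow> y \<in> S \<Longrightarrow> g x = g y \<Longrightarrow> f x = f y"
  shows "card (f ` S) \<le> card (g ` S)"
proof -
  have "f x = f (inv_into S g (g x))" if "x \<in> S" for x
    using that by (intro assms(2)) (auto simp: inv_into_into f_inv_into_f)
  then have "f ` S = (\<lambda>z. f (inv_into S g z)) ` g ` S" unfolding image_image by (intro image_cong refl) auto
  then show ?thesis using assms(1) by (simp add: card_image_le)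
qed

abbreviation "ballmax \<equiv> (max_outdegree G + 1) ^ m"

text \<open>A good prefix is determined by its digits on \<open>C\<close>. Its projection to an edge
  lies in a ball around one of n centres, since all vertices of the edge in \<open>C\<close> are
  reachable from one vertex; this leaves at most \<open>n * ballmax ^ h\<close> projections, and
  \<open>card_le_cover\<close> combines the edges. The number \<open>N\<close> replaces n to keep
  the base positive.\<close>

lemma card_Pre_le:
  fixes \<gamma> :: "nat set \<Rightarrow> real"
  assumes k: "k \<le> h" and E: "finite E"
    and edge: "\<And>e. e \<in> E \<Longrightarrow> \<exists>s<h. \<forall>v\<in>e. v < h \<longrightarrow> C I v \<longrightarrow> (s, v) \<in> EH\<^sup>*"
    and \<gamma>: "\<And>e. e \<in> E \<Longrightarrow> 0 \<le> \<gamma> e"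
    and cover: "\<And>v. v < h \<Longrightarrow> C I v \<Longrightarrow> 1 \<le> (\<Sum>e | e \<in> E \<and> v \<in> e. \<gamma> e)"
    and N: "n \<le> N" "1 \<le> N"
  shows "real (card (Pre C k)) \<le> real (N * ballmax ^ h) powr (\<Sum>e\<in>E. \<gamma> e)"
proof (cases "{Q. Q < n ^ h \<and> good C I k Q} = {}")
  case True
  then show ?thesis unfolding Pre_def True by simp
next
  case False
  define S where "S = {Q. Q < n ^ h \<and> good C I k Q}"
  define D where "D = {v. v < k \<and> C I v}"
  have D: "finite D" "D \<subseteq> {..<h}" using k by (auto simp: D_def)
  define P where "P = (\<lambda>Q. restrict (digit n h Q) D) ` S"
  have fS: "finite S" by (simp add: S_def)
  have "card (Pre C k) \<le> card P"
    unfolding Pre_def S_def[symmetric] P_def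
  proof (rule card_image_le_factor[OF fS])
    fix Q Q' assume Q: "Q \<in> S" "Q' \<in> S" and eq: "restrict (digit n h Q) D = restrict (digit n h Q') D"
    have "digit n h Q v = digit n h Q' v" if "v < k" for v
    proof (cases "C I v")
      case True
      then show ?thesis using fun_cong[OF eq, of v] that by (simp add: D_def)
    next
      case False
      then show ?thesis using Q that k by (simp add: S_def good_iff)
    qed
    then show "Q div n ^ (h - k) = Q' div n ^ (h - k)" using Q k by (intro prefix_eq) (auto simp: S_def)
  qed
  also have "real (card P) \<le> (\<Prod>e\<in>E. real (card ((\<lambda>\<phi>. restrict \<phi> e) ` P)) powr \<gamma> e)"
  proof (rule card_le_cover[OF D(1) E])
    show "finite P" "P \<subseteq> extensional D" "P \<noteq> {}" using fS False by (auto simp: P_def S_def)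
    show "1 \<le> (\<Sum>e | e \<in> E \<and> v \<in> e. \<gamma> e)" if "v \<in> D" for v using cover that D by (auto simp: D_def)
  qed (rule \<gamma>)
  also have "\<dots> \<le> (\<Prod>e\<in>E. real (N * ballmax ^ h) powr \<gamma> e)"
  proof (intro prod_mono conjI powr_mono2)
    fix e assume e: "e \<in> E"
    obtain s where s: "s < h" "\<And>v. v \<in> e \<Longrightarrow> v < h \<Longrightarrow> C I v \<Longrightarrow> (s, v) \<in> EH\<^sup>*" using edge[OF e] by blast
    let ?F = "\<lambda>g. (D \<inter> e) \<rightarrow>\<^sub>E ball_of EG m g"
    have finF: "finite (?F g)" for g using D(1) card_ball_mask by (intro finite_PiE) auto
    have "(\<lambda>\<phi>. restrict \<phi> e) ` P \<subseteq> (\<Union>g<n. (\<lambda>\<psi>. restrict \<psi> e) ` ?F g)"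
    proof (intro image_subsetI)
      fix \<phi> assume "\<phi> \<in> P"
      then obtain Q where Q: "\<phi> = restrict (digit n h Q) D" "Q < n ^ h" "good C I k Q" by (auto simp: P_def S_def)
      then obtain g where g: "g < n" "\<And>v. v < h \<Longrightarrow> v < k \<Longrightarrow> C I v \<Longrightarrow> (s, v) \<in> EH\<^sup>* \<Longrightarrow> digit n h Q v \<in> ball_of EG m g"
        using s(1) by (auto simp: good_iff)
      have "restrict (digit n h Q) (D \<inter> e) \<in> ?F g" using g(2) s(2) k by (auto simp: D_def)
      moreover have "restrict \<phi> e = restrict (restrict (digit n h Q) (D \<inter> e)) e"
        unfolding Q(1) by (auto simp: restrict_def fun_eq_iff)
      ultimately show "restrict \<phi> e \<in> (\<Union>g<n. (\<lambda>\<psi>. restrict \<psi> e) ` ?F g)" using g(1) by blast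
    qed
    then have "card ((\<lambda>\<phi>. restrict \<phi> e) ` P) \<le> card (\<Union>g<n. (\<lambda>\<psi>. restrict \<psi> e) ` ?F g)"
      using finF by (intro card_mono) auto
    also have "\<dots> \<le> (\<Sum>g<n. card ((\<lambda>\<psi>. restrict \<psi> e) ` ?F g))" by (rule card_UN_le) simp
    also have "\<dots> \<le> (\<Sum>g<n. ballmax ^ h)"
    proof (rule sum_mono)
      fix g
      have "card ((\<lambda>\<psi>. restrict \<psi> e) ` ?F g) \<le> card (?F g)" by (rule card_image_le[OF finF])
      also have "\<dots> = card (ball_of EG m g) ^ card (D \<inter> e)" using D(1) by (simp add: card_PiE)
      also have "\<dots> \<le> ballmax ^ card (D \<inter> e)" using card_ball_mask by (intro power_mono) auto
      also have "\<dots> \<le> ballmax ^ h"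
      proof (rule power_increasing)
        show "card (D \<inter> e) \<le> h" using card_mono[of "{..<h}" "D \<inter> e"] D by auto
      qed simp
      finally show "card ((\<lambda>\<psi>. restrict \<psi> e) ` ?F g) \<le> ballmax ^ h" .
    qed
    also have "\<dots> \<le> N * ballmax ^ h" using N(1) by simp
    finally show "real (card ((\<lambda>\<phi>. restrict \<phi> e) ` P)) \<le> real (N * ballmax ^ h)" by (rule of_nat_mono)
  qed (use \<gamma> in auto)
  also have "\<dots> = real (N * ballmax ^ h) powr (\<Sum>e\<in>E. \<gamma> e)"
    using N E by (simp add: powr_sum)
  finally show ?thesis by simp
qed

end

section \<open>Sources and the contour\<close>

text \<open>In logarithms, \<open>p \<le> b powr s\<close> is a lower bound on s, so it passes to
  the infimum without a minimising cover. The case \<open>p \<le> 1\<close> is split off because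
  otherwise b cannot be 1 and may be used as base of the logarithm.\<close>

lemma card_le_powr_Inf:
  fixes S :: "real set"
  assumes b: "1 \<le> b" and S: "S \<noteq> {}" "\<And>s. s \<in> S \<Longrightarrow> 0 \<le> s" and p: "\<And>s. s \<in> S \<Longrightarrow> p \<le> b powr s"
  shows "p \<le> b powr (Inf S)"
proof (cases "p \<le> 1")
  case True
  have "0 \<le> Inf S" using S by (intro cInf_greatest) auto
  then have "1 \<le> b powr Inf S" using b by (simp add: ge_one_powr_ge_zero)
  then show ?thesis using True by linarith
next
  case False
  have "b \<noteq> 1" using False p S(1) by fastforce
  then have lb: "0 < ln b" using b by simp
  have "ln p / ln b \<le> s" if "s \<in> S" for s
  proof -
    have "ln p \<le> ln (b powr s)" using p[OF that] False b by (subst ln_le_cancel_iff) auto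
    then show ?thesis using lb b by (simp add: ln_powr divide_le_eq)
  qed
  then have "ln p / ln b \<le> Inf S" using S(1) by (intro cInf_greatest) auto
  then have "ln p \<le> Inf S * ln b" using lb by (simp add: divide_le_eq)
  then have "exp (ln p) \<le> exp (Inf S * ln b)" by simp
  then show ?thesis using False b by (simp add: powr_def)
qed

context pattern_host
begin

lemma reachable_iff: "u \<rightarrow>\<^sup>*\<^bsub>with_proj H\<^esub> v \<longleftrightarrow> u < h \<and> (u, v) \<in> EH\<^sup>*"
proof
  interpret H: wf_digraph "with_proj H" by (rule wfH)
  assume "u \<rightarrow>\<^sup>*\<^bsub>with_proj H\<^esub> v"
  then show "u < h \<and> (u, v) \<in> EH\<^sup>*"
    using reachable_rtranclI[of "with_proj H" u v] H.reachable_in_verts(1)[of u v] by (simp add: vH)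
next
  interpret H: wf_digraph "with_proj H" by (rule wfH)
  assume "u < h \<and> (u, v) \<in> EH\<^sup>*"
  then have "(u, v) \<in> EH\<^sup>*" and u: "u < h" by auto
  then show "u \<rightarrow>\<^sup>*\<^bsub>with_proj H\<^esub> v"
  proof (induction rule: rtrancl_induct)
    case base
    then show ?case by (simp add: vH)
  next
    case (step y z)
    then show ?case by (auto intro: H.reachable_adj_trans)
  qed
qed

lemma scc_iff:
  "S \<in> pre_digraph.sccs_verts (with_proj H) \<longleftrightarrow>
    S \<noteq> {} \<and> S \<subseteq> {..<h} \<and> (\<forall>u\<in>S. \<forall>v. v \<in> S \<longleftrightarrow> (u, v) \<in> EH\<^sup>* \<and> (v, u) \<in> EH\<^sup>*)" (is "?L \<longleftrightarrow> ?R")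
proof
  assume ?L
  then have S: "S \<noteq> {}" "\<And>u v. u \<in> S \<Longrightarrow> v \<in> S \<Longrightarrow> u < h \<and> (u, v) \<in> EH\<^sup>*"
    "\<And>u v. u \<in> S \<Longrightarrow> v \<notin> S \<Longrightarrow> \<not> (u < h \<and> (u, v) \<in> EH\<^sup>*) \<or> \<not> (v < h \<and> (v, u) \<in> EH\<^sup>*)"
    unfolding pre_digraph.sccs_verts_def reachable_iff by auto
  then show ?R using rtranclH_less by blast
next
  assume ?R
  then show ?L unfolding pre_digraph.sccs_verts_def reachable_iff by blast
qed

lemma finite_sccs: "finite (pre_digraph.sccs_verts (with_proj H))"
  by (rule finite_subset[of _ "Pow {..<h}"]) (use scc_iff in auto)

text \<open>Both conditions say that the component is closed under in-neighbours in H.\<close>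

lemma sources_iff:
  "S \<in> sources H \<longleftrightarrow> S \<in> pre_digraph.sccs_verts (with_proj H) \<and> S \<subseteq> U"
proof -
  let ?\<C> = "pre_digraph.sccs_verts (with_proj H)"
  \<comment> \<open>The indegree is a cardinality, and infinite sets have cardinality 0; finiteness
    turns indegree 0 into the absence of arcs.\<close>
  have fin: "finite {e \<in> parcs (condensation H). snd e = S}"
    by (rule finite_subset[of _ "?\<C> \<times> ?\<C>"]) (use finite_sccs in \<open>auto simp: condensation_def\<close>)
  have "S \<in> sources H \<longleftrightarrow> S \<in> ?\<C> \<and> (\<forall>T. (T, S) \<notin> parcs (condensation H))"
    using fin by (auto simp: sources_def in_degree_def in_arcs_def condensation_def)
  also have "\<dots> \<longleftrightarrow> S \<in> ?\<C> \<and> (\<forall>x y. y \<in> S \<longrightarrow> (x, y) \<in> EH \<longrightarrow> x \<in> S)"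
  proof (intro conj_cong refl iffI allI impI)
    fix x y assume S: "S \<in> ?\<C>" and no: "\<forall>T. (T, S) \<notin> parcs (condensation H)" and xy: "y \<in> S" "(x, y) \<in> EH"
    let ?T = "{w. (x, w) \<in> EH\<^sup>* \<and> (w, x) \<in> EH\<^sup>*}"
    have x: "x < h" using xy EH_sub by auto
    have T: "?T \<in> ?\<C>" unfolding scc_iff using x rtranclH_less by (auto intro: rtrancl_trans)
    show "x \<in> S"
    proof (rule ccontr)
      assume "x \<notin> S"
      then have "?T \<noteq> S" by blast
      then have "(?T, S) \<in> parcs (condensation H)" using S T xy by (auto simp: condensation_def)
      then show False using no by blast
    qed
  next
    fix T assume S: "S \<in> ?\<C>" and closed: "\<forall>x y. y \<in> S \<longrightarrow> (x, y) \<in> EH \<longrightarrow> x \<in> S"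
    show "(T, S) \<notin> parcs (condensation H)"
    proof
      assume "(T, S) \<in> parcs (condensation H)"
      then obtain x y where "T \<in> ?\<C>" "T \<noteq> S" "x \<in> T" "y \<in> S" "(x, y) \<in> EH" by (auto simp: condensation_def)
      then have "x \<in> S" "x \<in> T" using closed by auto
      then have "T = S" using \<open>T \<in> ?\<C>\<close> S unfolding scc_iff by blast
      then show False using \<open>T \<noteq> S\<close> by simp
    qed
  qed
  also have "\<dots> \<longleftrightarrow> S \<in> ?\<C> \<and> S \<subseteq> U"
  proof (intro conj_cong refl iffI subsetI allI impI)
    fix v assume S: "S \<in> ?\<C>" and closed: "\<forall>x y. y \<in> S \<longrightarrow> (x, y) \<in> EH \<longrightarrow> x \<in> S" and v: "v \<in> S"
    have vh: "v < h" using S v unfolding scc_iff by blast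
    have "u \<in> S" if "(u, v) \<in> EH\<^sup>*" for u
      using that v by (induction rule: converse_rtrancl_induct) (use closed in auto)
    then have "(v, u) \<in> EH\<^sup>*" if "(u, v) \<in> EH\<^sup>*" for u using that S v unfolding scc_iff by blast
    then show "v \<in> U" using vh inU_iff by (auto simp: U_def)
  next
    fix x y assume S: "S \<in> ?\<C>" and SU: "S \<subseteq> U" and xy: "y \<in> S" "(x, y) \<in> EH"
    then have "(y, x) \<in> EH\<^sup>*" "(x, y) \<in> EH\<^sup>*" using U_pred by auto
    then show "x \<in> S" using S xy(1) unfolding scc_iff by blast
  qed
  finally show ?thesis .
qed

lemma Union_sources: "(\<Union>S\<in>sources H. S) = U"
proof
  show "(\<Union>S\<in>sources H. S) \<subseteq> U" using sources_iff by auto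
  show "U \<subseteq> (\<Union>S\<in>sources H. S)"
  proof
    fix v assume v: "v \<in> U"
    let ?S = "{w. (v, w) \<in> EH\<^sup>* \<and> (w, v) \<in> EH\<^sup>*}"
    have vh: "v < h" using v by (simp add: U_def)
    have "?S \<in> pre_digraph.sccs_verts (with_proj H)"
      unfolding scc_iff using vh rtranclH_less by (auto intro: rtrancl_trans)
    moreover have "?S \<subseteq> U" using EH_rtrancl_ST[OF _ v] by blast
    ultimately have "?S \<in> sources H" by (simp add: sources_iff)
    moreover have "v \<in> ?S" by simp
    ultimately show "v \<in> (\<Union>S\<in>sources H. S)" by blast
  qed
qed

text \<open>The same choice of representative as in \<open>reachability_hypergraph\<close>.\<close>

definition root :: "nat set \<Rightarrow> nat" where "root S = (SOME s. s \<in> S)"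

lemma root_in: "S \<in> sources H \<Longrightarrow> root S \<in> S"
  unfolding root_def using sources_iff scc_iff by (metis some_in_eq)

lemma root_less: "S \<in> sources H \<Longrightarrow> root S < h"
  using root_in sources_iff U_sub by fastforce

lemma finite_sources: "finite (sources H)"
  by (rule finite_subset[OF _ finite_sccs]) (use sources_iff in auto)

lemma alpha_s_le: "alpha_s H \<le> h"
proof -
  have "inj_on root (sources H)"
  proof (rule inj_onI)
    fix S T assume ST: "S \<in> sources H" "T \<in> sources H" "root S = root T"
    then have "root S \<in> S" "root S \<in> T" using root_in by metis+
    then show "S = T" using ST(1,2) unfolding sources_iff scc_iff by blast
  qed
  then have "card (sources H) \<le> card {..<h}" using root_less by (intro card_inj_on_le) auto
  then show ?thesis by (simp add: alpha_s_def)
qed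

text \<open>Among the vertices that reach v take u with the fewest ancestors. An ancestor x of u has
  no ancestors besides those of u, so by minimality it has all of them, u included; thus u reaches
  x, and u lies in a source component.\<close>

lemma exists_source:
  assumes "v < h" shows "\<exists>S\<in>sources H. (root S, v) \<in> EH\<^sup>*"
proof -
  have fin: "finite {w. (w, u) \<in> EH\<^sup>*}" for u
  proof (rule finite_subset)
    show "{w. (w, u) \<in> EH\<^sup>*} \<subseteq> insert u {..<h}"
    proof
      fix w assume "w \<in> {w. (w, u) \<in> EH\<^sup>*}"
      then have "(w, u) \<in> EH\<^sup>*" by simp
      then show "w \<in> insert u {..<h}" by (cases rule: converse_rtranclE) (use EH_sub in auto)
    qed
  qed simp
  define u where "u = (ARG_MIN (\<lambda>u. card {w. (w, u) \<in> EH\<^sup>*}) u. (u, v) \<in> EH\<^sup>*)"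
  have uv: "(u, v) \<in> EH\<^sup>*" unfolding u_def by (rule arg_min_natI[of _ v]) simp
  have min: "card {w. (w, u) \<in> EH\<^sup>*} \<le> card {w. (w, x) \<in> EH\<^sup>*}" if "(x, v) \<in> EH\<^sup>*" for x
    unfolding u_def using that by (rule arg_min_nat_le)
  have uh: "u < h" using uv assms EH_sub by (cases rule: converse_rtranclE) auto
  have "(u, x) \<in> EH\<^sup>*" if x: "(x, u) \<in> EH\<^sup>*" for x
  proof -
    have "{w. (w, x) \<in> EH\<^sup>*} \<subseteq> {w. (w, u) \<in> EH\<^sup>*}" using x by (auto intro: rtrancl_trans)
    moreover have "card {w. (w, u) \<in> EH\<^sup>*} \<le> card {w. (w, x) \<in> EH\<^sup>*}"
      using x uv by (intro min) (rule rtrancl_trans)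
    ultimately have "{w. (w, x) \<in> EH\<^sup>*} = {w. (w, u) \<in> EH\<^sup>*}" using fin by (intro card_seteq) auto
    then show ?thesis by blast
  qed
  then have "u \<in> U" using uh inU_iff by (auto simp: U_def)
  then obtain S where S: "S \<in> sources H" "u \<in> S" using Union_sources by blast
  then have "(root S, u) \<in> EH\<^sup>*" using root_in[OF S(1)] unfolding sources_iff scc_iff by blast
  then show ?thesis using S(1) uv by (meson rtrancl_trans)
qed

lemma reachable_from_root: "S \<in> sources H \<Longrightarrow> reachable_from H (SOME s. s \<in> S) = {v. (root S, v) \<in> EH\<^sup>*}"
  using root_less by (auto simp: reachable_from_def reachable_iff root_def)

abbreviation "E0 \<equiv> (\<lambda>S. {v. (root S, v) \<in> EH\<^sup>*}) ` sources H"
abbreviation "E1 \<equiv> (\<lambda>e. e - U) ` E0"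

lemma contour_eq: "contour H = ({..<h} - U, E1)"
proof -
  have "(\<lambda>S. reachable_from H (SOME s. s \<in> S)) ` sources H = E0"
    by (intro image_cong refl reachable_from_root)
  then show ?thesis
    unfolding contour_def delete_vertices_def reachability_hypergraph_def Union_sources by (simp add: vH)
qed

lemma card_E0: "card E0 \<le> alpha_s H"
  unfolding alpha_s_def by (rule card_image_le[OF finite_sources])

lemma card_E1: "card E1 \<le> h"
  using card_image_le[of E0 "\<lambda>e. e - U"] finite_sources card_E0 alpha_s_le by force

lemma sum_ones_ge: "finite E \<Longrightarrow> e \<in> E \<Longrightarrow> v \<in> e \<Longrightarrow> 1 \<le> (\<Sum>e | e \<in> E \<and> v \<in> e. 1 :: real)"
  using member_le_sum[of e "{e \<in> E. v \<in> e}" "\<lambda>_. 1 :: real"] by simp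

lemma one_le_base: "1 \<le> N \<Longrightarrow> 1 \<le> real (N * ballmax ^ h)"
proof -
  assume "1 \<le> N"
  then have "1 \<le> N * ballmax ^ h" by (simp add: Suc_le_eq)
  then have "real 1 \<le> real (N * ballmax ^ h)" by (rule of_nat_mono)
  then show ?thesis by (simp only: of_nat_1)
qed

text \<open>Constant weight 1 is a cover of at most h edges. So the infimum is over a nonempty set
  and at most h, which keeps the ball sizes raised to it within \<open>fpt\<close>. The bound on
  prefixes holds for each cover and passes to the infimum.\<close>

lemma rho_star_props:
  fixes N :: nat
  assumes N: "n \<le> N" "1 \<le> N"
  shows "0 \<le> rho_star H" "rho_star H \<le> h"
    "k \<le> h \<Longrightarrow> real (card (Pre (\<lambda>I v. \<not> in_source I v) k)) \<le> real (N * ballmax ^ h) powr rho_star H"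
proof -
  let ?S = "{\<Sum>e\<in>E1. \<gamma> e | \<gamma>. fractional_cover (contour H) \<gamma>}"
  have rho: "rho_star H = Inf ?S" by (simp add: rho_star_def fractional_cover_number_def contour_eq)
  have fin: "finite E1" using finite_sources by simp
  have cov: "fractional_cover (contour H) \<gamma> \<longleftrightarrow> (\<forall>e\<in>E1. 0 \<le> \<gamma> e) \<and> (\<forall>v\<in>{..<h} - U. 1 \<le> (\<Sum>e | e \<in> E1 \<and> v \<in> e. \<gamma> e))" for \<gamma>
    unfolding fractional_cover_def contour_eq by simp
  have "fractional_cover (contour H) (\<lambda>_. 1)" unfolding cov
  proof (intro conjI ballI)
    fix v assume v: "v \<in> {..<h} - U"
    then obtain S where "S \<in> sources H" "(root S, v) \<in> EH\<^sup>*" using exists_source by auto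
    then have "{v. (root S, v) \<in> EH\<^sup>*} - U \<in> E1" "v \<in> {v. (root S, v) \<in> EH\<^sup>*} - U" using v by auto
    then show "1 \<le> (\<Sum>e | e \<in> E1 \<and> v \<in> e. 1 :: real)" by (rule sum_ones_ge[OF fin])
  qed simp
  then have one: "(\<Sum>e\<in>E1. 1) \<in> ?S" by blast
  have nn: "0 \<le> s" if "s \<in> ?S" for s using that cov by (auto intro!: sum_nonneg)
  show "0 \<le> rho_star H" unfolding rho using one nn by (intro cInf_greatest) auto
  have "Inf ?S \<le> (\<Sum>e\<in>E1. 1)" using one nn by (intro cInf_lower) (auto simp: bdd_below_def)
  then show "rho_star H \<le> h" unfolding rho using card_E1 by simp
  show "real (card (Pre (\<lambda>I v. \<not> in_source I v) k)) \<le> real (N * ballmax ^ h) powr rho_star H" if k: "k \<le> h"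
    unfolding rho
  proof (rule card_le_powr_Inf)
    show "1 \<le> real (N * ballmax ^ h)" using N(2) by (rule one_le_base)
    show "?S \<noteq> {}" using one by blast
    fix s assume s: "s \<in> ?S"
    then show "0 \<le> s" by (rule nn)
    obtain \<gamma> where \<gamma>: "s = (\<Sum>e\<in>E1. \<gamma> e)" "fractional_cover (contour H) \<gamma>" using s by blast
    show "real (card (Pre (\<lambda>I v. \<not> in_source I v) k)) \<le> real (N * ballmax ^ h) powr s"
      unfolding \<gamma>(1)
    proof (rule card_Pre_le[OF k fin _ _ _ N])
      fix e assume "e \<in> E1"
      then show "\<exists>s<h. \<forall>v\<in>e. v < h \<longrightarrow> \<not> in_source I v \<longrightarrow> (s, v) \<in> EH\<^sup>*" using root_less by auto
    qed (use \<gamma>(2) cov in \<open>auto simp: U_def\<close>)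
  qed
qed

lemma alpha_s_props:
  fixes N :: nat
  assumes N: "n \<le> N" "1 \<le> N" and k: "k \<le> h"
  shows "real (card (Pre (\<lambda>I v. True) k)) \<le> real (N * ballmax ^ h) powr alpha_s H"
proof -
  have fin: "finite E0" using finite_sources by simp
  have "real (card (Pre (\<lambda>I v. True) k)) \<le> real (N * ballmax ^ h) powr (\<Sum>e\<in>E0. 1)"
  proof (rule card_Pre_le[OF k fin _ _ _ N])
    fix e assume "e \<in> E0"
    then show "\<exists>s<h. \<forall>v\<in>e. v < h \<longrightarrow> True \<longrightarrow> (s, v) \<in> EH\<^sup>*" using root_less by auto
  next
    fix v assume "v < h"
    then obtain S where "S \<in> sources H" "(root S, v) \<in> EH\<^sup>*" using exists_source by auto
    then show "1 \<le> (\<Sum>e | e \<in> E0 \<and> v \<in> e. 1 :: real)"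
      by (intro sum_ones_ge[OF fin, of "{v. (root S, v) \<in> EH\<^sup>*}"]) auto
  qed simp
  also have "\<dots> \<le> real (N * ballmax ^ h) powr alpha_s H"
    using card_E0 one_le_base[OF N(2)] by (intro powr_mono) simp_all
  finally show ?thesis .
qed

end

section \<open>Running time\<close>

text \<open>With first argument at least h and second the maximum outdegree d, the exponent comes
  from \<open>(ballmax ^ h) ^ h\<close>, a power of d + 1 with exponent
  \<open>h * h * h * h\<close>: radius h * h, maps on up to h vertices, and a cover weight up to h.
  The summand 2 leaves room for the factor \<open>2 * (h + 1)\<close>.\<close>

definition fpt :: "nat \<Rightarrow> nat \<Rightarrow> nat" where
  "fpt a b = (a + b + 2) ^ (a * a * a * a + 2)"

context pattern_host
begin

abbreviation "L \<equiv> length xs"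
abbreviation "N \<equiv> length ys"
abbreviation "d \<equiv> max_outdegree G"

lemma fpt_ge: "x \<le> (L + d + 2) ^ j \<Longrightarrow> j \<le> L * L * L * L + 2 \<Longrightarrow> x \<le> fpt L d"
  unfolding fpt_def by (erule order_trans) (rule power_increasing, auto)

lemma h_pow_le: "h * h * h * h \<le> L * L * L * L"
  using h_less by (intro mult_le_mono) auto

lemma fpt_bounds:
  shows "2 * (h + 1) \<le> fpt L d" "ballmax ^ h \<le> fpt L d" "(ballmax ^ h) ^ h \<le> fpt L d"
    "2 ^ (h * h) \<le> fpt L d" "h ^ h \<le> fpt L d" "L + 1 \<le> fpt L d"
proof -
  let ?b = "L + d + 2"
  have b2: "?b * ?b = ?b ^ 2" by (simp add: power2_eq_square)
  have "2 * (h + 1) \<le> ?b * ?b" using h_less by (intro mult_le_mono) auto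
  then show "2 * (h + 1) \<le> fpt L d" unfolding b2 by (rule fpt_ge) simp
  have "L + 1 \<le> ?b ^ 1" by simp
  then show "L + 1 \<le> fpt L d" by (rule fpt_ge) simp
  have db: "d + 1 \<le> ?b" by simp
  have hhhh: "j \<le> L * L * L * L + 2" if "j \<le> h * h * h * h" for j using that h_pow_le by linarith
  have h3: "h * h * h \<le> h * h * h * h" "h * h \<le> h * h * h * h" "h \<le> h * h * h * h" by (cases h; simp)+
  have "ballmax ^ h = (d + 1) ^ (h * h * h)" by (simp add: power_mult)
  also have "\<dots> \<le> ?b ^ (h * h * h)" using db by (rule power_mono) simp
  finally show "ballmax ^ h \<le> fpt L d" by (rule fpt_ge) (rule hhhh[OF h3(1)])
  have "(ballmax ^ h) ^ h = (d + 1) ^ (h * h * h * h)" by (simp add: power_mult)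
  also have "\<dots> \<le> ?b ^ (h * h * h * h)" using db by (rule power_mono) simp
  finally show "(ballmax ^ h) ^ h \<le> fpt L d" by (rule fpt_ge) (rule hhhh[OF order_refl])
  have "(2::nat) ^ (h * h) \<le> ?b ^ (h * h)" by (rule power_mono) auto
  then show "2 ^ (h * h) \<le> fpt L d" by (rule fpt_ge) (rule hhhh[OF h3(2)])
  have "h ^ h \<le> ?b ^ h" using h_less by (intro power_mono) auto
  then show "h ^ h \<le> fpt L d" by (rule fpt_ge) (rule hhhh[OF h3(3)])
qed

text \<open>Of the \<open>D + 2\<close> factors \<open>fpt L d\<close>, one absorbs
  \<open>2 * (h + 1)\<close>, one the ball sizes raised to \<rho>, and D come from the cost of a
  round. Beyond \<rho>, the exponent of N has 1 for the digit following a prefix and D for the cost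
  of a round.\<close>

lemma time_bound:
  fixes \<rho> :: real
  assumes \<rho>: "0 \<le> \<rho>" "\<rho> \<le> h" and Pre: "\<And>k. k \<le> h \<Longrightarrow> real (card (Pre C k)) \<le> real (N * ballmax ^ h) powr \<rho>"
  shows "real ((iters C + 1) * (N * fpt L d) ^ D) \<le> real (fpt L d ^ (D + 2)) * real N powr (\<rho> + real (D + 1))"
proof -
  let ?F = "fpt L d" and ?B = "ballmax ^ h"
  let ?M = "real (N * ?B) powr \<rho>"
  have N1: "1 \<le> N" and nN: "n + 1 \<le> N" using n_less by auto
  have B1: "1 \<le> ?B" by simp
  have M1: "1 \<le> ?M" using one_le_base[OF N1] \<rho>(1) by (rule ge_one_powr_ge_zero)
  have "real (iters C) \<le> real (h + 1) * (?M * real (n + 1))"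
  proof -
    \<comment> \<open>The bound on the number of rounds takes a natural number, hence the floor of
      the real bound.\<close>
    have "card (Pre C k) \<le> nat \<lfloor>?M\<rfloor>" if "k \<le> h" for k using Pre[OF that] by (simp add: le_nat_floor)
    then have "iters C \<le> (h + 1) * (nat \<lfloor>?M\<rfloor> * (n + 1))" by (rule iters_le)
    then have "real (iters C) \<le> real ((h + 1) * (nat \<lfloor>?M\<rfloor> * (n + 1)))" by (rule of_nat_mono)
    also have "\<dots> = real (h + 1) * (real (nat \<lfloor>?M\<rfloor>) * real (n + 1))" by (simp only: of_nat_mult)
    also have "\<dots> \<le> real (h + 1) * (?M * real (n + 1))"
      using M1 by (intro mult_left_mono mult_right_mono of_nat_floor) auto
    finally show ?thesis .
  qed
  also have "\<dots> \<le> real (h + 1) * (?M * real N)" using nN M1 by (intro mult_left_mono) auto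
  finally have it: "real (iters C) \<le> real (h + 1) * (?M * real N)" .
  have "1 \<le> real (h + 1) * (?M * real N)"
  proof -
    have "1 * (1 * 1) \<le> real (h + 1) * (?M * real N)" using M1 N1 by (intro mult_mono) auto
    then show ?thesis by simp
  qed
  then have "real (iters C + 1) \<le> 2 * (real (h + 1) * (?M * real N))" using it by simp
  also have "\<dots> = real (2 * (h + 1)) * (?M * real N)" by simp
  also have "\<dots> \<le> real ?F * (?M * real N)"
    using fpt_bounds(1) M1 by (intro mult_right_mono of_nat_mono) auto
  also have "?M = real N powr \<rho> * real ?B powr \<rho>" by (simp add: powr_mult)
  also have "real ?F * (real N powr \<rho> * real ?B powr \<rho> * real N) = real ?F * (real N powr \<rho> * real N) * real ?B powr \<rho>" by simp
  also have "\<dots> \<le> real ?F * (real N powr \<rho> * real N) * real ?F"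
  proof (rule mult_left_mono)
    have "real ?B powr \<rho> \<le> real ?B powr real h" using B1 \<rho>(2) by (intro powr_mono) auto
    also have "\<dots> = real (?B ^ h)" using B1 by (simp add: powr_realpow)
    also have "\<dots> \<le> real ?F" using fpt_bounds(3) by (rule of_nat_mono)
    finally show "real ?B powr \<rho> \<le> real ?F" .
  qed auto
  finally have "real (iters C + 1) \<le> real ?F * real ?F * (real N powr \<rho> * real N)" by (simp add: mult.commute mult.left_commute)
  then have "real (iters C + 1) * real ((N * ?F) ^ D) \<le> real ?F * real ?F * (real N powr \<rho> * real N) * real ((N * ?F) ^ D)"
    by (rule mult_right_mono) simp
  also have "\<dots> = real (?F ^ (D + 2)) * (real N powr \<rho> * real N ^ (D + 1))"
    by (simp add: power_mult_distrib power_add power2_eq_square algebra_simps)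
  also have "real N powr \<rho> * real N ^ (D + 1) = real N powr (\<rho> + real (D + 1))"
    using N1 powr_realpow[of "real N" "D + 1"] by (simp only: powr_add)
  finally show ?thesis by (simp only: of_nat_mult)
qed

end

section \<open>Assembling the two algorithms\<close>

definition counting_input :: "nat list list \<Rightarrow> nat \<Rightarrow> bool" where
  "counting_input I X \<longleftrightarrow> (\<exists>H G xs ys. adjacency_encoding H xs \<and> adjacency_encoding G ys \<and> I = [xs, ys] \<and>
     X = length ys * fpt (length xs) (max_outdegree G))"

interpretation counting_input: ram_pattern counting_input
proof
  fix I X assume "counting_input I X"
  then obtain H G xs ys where e: "adjacency_encoding H xs" "adjacency_encoding G ys" "I = [xs, ys]"
    and X: "X = length ys * fpt (length xs) (max_outdegree G)" by (auto simp: counting_input_def)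
  interpret pattern_host H G xs ys I "num_verts I 0" "num_verts I 1" by unfold_locales (use e in auto)
  have N1: "1 \<le> N" using n_less by simp
  have F: "fpt L d \<le> X" unfolding X using N1 by simp
  have L1: "1 \<le> L" using h_less by simp
  \<comment> \<open>The product of the lengths dominates their sum, so X bounds every entry of both
    inputs.\<close>
  have "N + L \<le> N * (L + 1)" using N1 L1 by (cases N) (auto simp: algebra_simps)
  also have "\<dots> \<le> X" unfolding X using fpt_bounds(6) by (intro mult_left_mono) auto
  finally have NL: "N + L \<le> X" .
  show "2 \<le> X" using NL N1 L1 by linarith
  show "input_memory I a i \<le> X" for a i using input_le[of a i] NL by linarith
  show "2 ^ (num_verts I 0 * num_verts I 0) \<le> X" using fpt_bounds(4) F by linarith
  show "num_verts I 0 ^ num_verts I 0 \<le> X" using fpt_bounds(5) F by linarith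
  have "ball_size I g ^ num_verts I 0 \<le> ballmax ^ num_verts I 0" for g by (intro power_mono bsz_le) simp
  then show "ball_size I g ^ num_verts I 0 \<le> X" for g using fpt_bounds(2) F by (meson le_trans)
qed

text \<open>The frame common to both counts: \<open>C\<close> selects the vertices searched,
  \<open>ct\<close> weighs a code, and the total is \<open>result\<close> times the number of
  automorphisms, by which the program divides in the end.\<close>

lemma algorithm:
  fixes ct :: "nat list list \<Rightarrow> nat \<Rightarrow> nat" and result :: "nat pair_pre_digraph \<Rightarrow> nat pair_pre_digraph \<Rightarrow> nat"
    and \<rho> :: "nat pair_pre_digraph \<Rightarrow> real"
  assumes C: "\<And>v. counting_input.impl v \<Longrightarrow> counting_input.impl (\<lambda>I s. of_bool (C I (v I s)))"
    and ct: "\<And>q. counting_input.impl q \<Longrightarrow> counting_input.impl (\<lambda>I s. ct I (q I s))"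
    and correct: "\<And>H G xs ys I. pattern_host H G xs ys I \<Longrightarrow>
      (\<Sum>Q | Q < num_verts I 1 ^ num_verts I 0 \<and> good C I (num_verts I 0) Q. ct I Q) = result H G * automorphism_count I \<and>
      result H G * automorphism_count I \<le> num_verts I 1 ^ num_verts I 0"
    and time: "\<And>H G xs ys I k. pattern_host H G xs ys I \<Longrightarrow> 0 \<le> \<rho> H \<and> \<rho> H \<le> num_verts I 0 \<and>
      (k \<le> num_verts I 0 \<longrightarrow> real (card (pattern_host.Pre I C k)) \<le>
        real (length ys * ((max_outdegree G + 1) ^ (num_verts I 0 * num_verts I 0)) ^ num_verts I 0) powr \<rho> H)"
  shows "\<exists>p D. \<forall>H G xs ys. adjacency_encoding H xs \<longrightarrow> adjacency_encoding G ys \<longrightarrow>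
    computes_in_time p [xs, ys] (result H G)
      (real (fpt (length xs) (max_outdegree G) ^ (D + 2)) * real (length ys) powr (\<rho> H + real (D + 1)))"
proof -
  \<comment> \<open>Bad codes are visited as well and must contribute 0.\<close>
  let ?ct = "\<lambda>I Q. if good C I (num_verts I 0) Q then ct I Q else 0"
  have nx: "counting_input.impl (\<lambda>I s. next_code C I (hd s))" by (intro counting_input.impl_next_code counting_input.impl_hd C)
  have ct': "counting_input.impl (\<lambda>I s. ?ct I (hd s))"
    by (intro counting_input.impl_if counting_input.impl_good counting_input.impl_hd counting_input.impl_const counting_input.impl_num_verts C ct) auto
  have T: "counting_input.impl (\<lambda>I s. num_verts I 1 ^ num_verts I 0)"
    by (intro counting_input.impl_power counting_input.impl_num_verts counting_input.loopb_num_verts) auto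
  have fin: "counting_input.impl (\<lambda>I s. hd s div automorphism_count I)" by (intro counting_input.impl_div counting_input.impl_hd counting_input.impl_automorphism_count)
  \<comment> \<open>The exponent 2 suffices for codes and totals: both are at most n to the power h,
    which is at most \<open>2 ^ (n * h)\<close>, and n and h are at most X.\<close>
  note while = counting_input.impl_while[OF nx ct' T fin, of 2]
  obtain p D where p: "\<forall>I X K. counting_input I X \<longrightarrow> (\<forall>i<K. (next_code C I ^^ i) 0 < num_verts I 1 ^ num_verts I 0) \<longrightarrow> num_verts I 1 ^ num_verts I 0 \<le> (next_code C I ^^ K) 0 \<longrightarrow>
    (\<forall>i\<le>K. (next_code C I ^^ i) 0 \<le> 2 ^ (X ^ 2)) \<longrightarrow> (\<forall>i\<le>K. (\<Sum>l<i. ?ct I ((next_code C I ^^ l) 0)) \<le> 2 ^ (X ^ 2)) \<longrightarrow>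
    runs p (input_memory I) ((K + 1) * X ^ D) (\<lambda>m. m 0 0 = (\<Sum>l<K. ?ct I ((next_code C I ^^ l) 0)) div automorphism_count I)"
    using while by (elim exE) (rule that)
  have "computes_in_time p [xs, ys] (result H G)
      (real (fpt (length xs) (max_outdegree G) ^ (D + 2)) * real (length ys) powr (\<rho> H + real (D + 1)))"
    if e: "adjacency_encoding H xs" "adjacency_encoding G ys" for H G xs ys
  proof -
    define I where "I = [xs, ys]"
    interpret pattern_host H G xs ys I "num_verts I 0" "num_verts I 1" by unfold_locales (use e in \<open>auto simp: I_def\<close>)
    note ph = pattern_host_axioms
    define X where "X = N * fpt L d"
    have V: "counting_input I X" unfolding counting_input_def X_def I_def using e by blast
    let ?K = "iters C"
    have small: "num_verts I 1 ^ num_verts I 0 \<le> 2 ^ (X ^ 2)"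
    proof -
      have le: "num_verts I 1 \<le> X" "num_verts I 0 \<le> X" using counting_input.V_input[OF V] by (simp_all add: num_verts_def)
      have "num_verts I 1 ^ num_verts I 0 \<le> (2 ^ num_verts I 1) ^ num_verts I 0" by (rule power_mono[OF less_imp_le[OF less_exp]]) simp
      also have "\<dots> = 2 ^ (num_verts I 1 * num_verts I 0)" by (simp add: power_mult)
      also have "\<dots> \<le> 2 ^ (X ^ 2)"
        by (rule power_increasing) (use mult_le_mono[OF le] in \<open>auto simp: power2_eq_square\<close>)
      finally show ?thesis .
    qed
    have s: "(next_code C I ^^ i) 0 = seq C i" for i by (simp add: seq_def)
    have sum: "(\<Sum>l<?K. ?ct I (seq C l)) = result H G * automorphism_count I"
    proof -
      have "(\<Sum>l<?K. ?ct I (seq C l)) = (\<Sum>Q | Q < num_verts I 1 ^ num_verts I 0 \<and> good C I (num_verts I 0) Q. ?ct I Q)"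
        by (rule sum_seq) simp
      also have "\<dots> = (\<Sum>Q | Q < num_verts I 1 ^ num_verts I 0 \<and> good C I (num_verts I 0) Q. ct I Q)" by (rule sum.cong) auto
      finally show ?thesis using correct[OF ph] by simp
    qed
    have "runs p (input_memory I) ((?K + 1) * X ^ D) (\<lambda>m. m 0 0 = (\<Sum>l<?K. ?ct I ((next_code C I ^^ l) 0)) div automorphism_count I)"
    proof (rule p[THEN spec[of _ I], THEN spec[of _ X], THEN spec[of _ ?K], THEN mp, OF V, THEN mp, THEN mp, THEN mp, THEN mp]; unfold s)
      show "\<forall>i<?K. seq C i < num_verts I 1 ^ num_verts I 0" "num_verts I 1 ^ num_verts I 0 \<le> seq C ?K" using iters_props by auto
      show "\<forall>i\<le>?K. seq C i \<le> 2 ^ X ^ 2" using iters_props(3) small le_trans by blast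
      show "\<forall>i\<le>?K. (\<Sum>l<i. ?ct I (seq C l)) \<le> 2 ^ X ^ 2"
      proof (intro allI impI)
        fix i assume "i \<le> ?K"
        then have "(\<Sum>l<i. ?ct I (seq C l)) \<le> (\<Sum>l<?K. ?ct I (seq C l))" by (intro sum_mono2) auto
        also have "\<dots> \<le> 2 ^ X ^ 2" unfolding sum using correct[OF ph] small by linarith
        finally show "(\<Sum>l<i. ?ct I (seq C l)) \<le> 2 ^ X ^ 2" .
      qed
    qed
    then have "runs p (input_memory I) ((?K + 1) * X ^ D) (\<lambda>m. m 0 0 = result H G)"
      unfolding s sum using aut_pos by simp
    then obtain t m' where t: "exec p (input_memory I) t m'" "t \<le> (?K + 1) * X ^ D" "m' 0 0 = result H G"
      unfolding runs_def by blast
    have "real t \<le> real ((?K + 1) * X ^ D)" using t(2) by (rule of_nat_mono)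
    also have "\<dots> \<le> real (fpt L d ^ (D + 2)) * real N powr (\<rho> H + real (D + 1))"
      unfolding X_def by (rule time_bound) (use time[OF ph] in auto)
    finally show ?thesis unfolding computes_in_time_def using t(1,3) unfolding I_def by blast
  qed
  then show ?thesis by blast
qed

definition parameter_input :: "nat list list \<Rightarrow> nat \<Rightarrow> bool" where
  "parameter_input I X \<longleftrightarrow> (\<exists>a b. I = [[a], [b]] \<and> X = a + b + 2)"

interpretation parameter_input: ram parameter_input
proof
  fix I X assume "parameter_input I X"
  then show "2 \<le> X" "input_memory I a i \<le> X" for a i
    by (auto simp: parameter_input_def input_memory_def nth_Cons split: nat.split)
qed

text \<open>The compiler of expressions is reused, with the size X chosen as the sum of the two
  arguments plus 2.\<close>

lemma computable2_fpt_power: "computable2 (\<lambda>a b. fpt a b ^ k)"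
proof -
  let ?a = "\<lambda>I. input_memory I 0 0" and ?b = "\<lambda>I. input_memory I 1 0"
  let ?f = "\<lambda>I. fpt (?a I) (?b I) ^ k"
  have "parameter_input.impl (\<lambda>I s. ?f I)" unfolding fpt_def
    by (intro parameter_input.impl_power parameter_input.impl_plus parameter_input.impl_times parameter_input.impl_input parameter_input.impl_const parameter_input.loopb_intros) auto
  then obtain p D where p: "parameter_input.cpt (\<lambda>I s. ?f I) [] 2 0 p D" by (rule parameter_input.implE[of _ 2 "[]"]) auto
  \<comment> \<open>The compiled program leaves its value in array 2, while results are read from
    array 0.\<close>
  have "computes (Seq p (Store 0 (Const 0) (Cell 2 (Const 0)))) [[a], [b]] (fpt a b ^ k)" for a b
  proof -
    let ?I = "[[a], [b]]"
    have "parameter_input ?I (a + b + 2)" by (simp add: parameter_input_def)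
    then have "runs p (input_memory ?I) ((a + b + 2) ^ D) (\<lambda>m'. m' 2 0 = ?f ?I \<and> (\<forall>a<2. m' a = input_memory ?I a))"
      using parameter_input.cptD[OF p, of ?I "a + b + 2" "input_memory ?I"] by (simp add: parameter_input.inp_def)
    then obtain t m where m: "exec p (input_memory ?I) t m" "m 2 0 = ?f ?I" by (auto simp: runs_def)
    have "exec (Seq p (Store 0 (Const 0) (Cell 2 (Const 0)))) (input_memory ?I)
      (t + (cost (Const 0) m + cost (Cell 2 (Const 0)) m + len (val (Const 0) m) + len (val (Cell 2 (Const 0)) m)))
      (m(0 := (m 0)(val (Const 0) m := val (Cell 2 (Const 0)) m)))"
      by (rule exec.Seq[OF m(1) exec.Store])
    moreover have "?f ?I = fpt a b ^ k" by (simp add: input_memory_def)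
    ultimately show ?thesis unfolding computes_def using m(2) by fastforce
  qed
  then show ?thesis unfolding computable2_def by blast
qed

lemma (in pattern_host) card_hom_le: "S \<subseteq> hom \<Longrightarrow> card S \<le> n ^ h"
proof -
  assume "S \<subseteq> hom"
  then have "card S \<le> card ({..<h} \<rightarrow>\<^sub>E {..<n})"
    by (intro card_mono finite_PiE) (auto simp: hom_def)
  then show ?thesis by (simp add: card_PiE)
qed

theorem theorem2:
  shows "(\<exists>(f :: nat \<Rightarrow> nat \<Rightarrow> nat) (p :: com) (c :: nat). computable2 f \<and>
           (\<forall>(H :: nat pair_pre_digraph) (G :: nat pair_pre_digraph) xs ys.
              adjacency_encoding H xs \<longrightarrow> adjacency_encoding G ys \<longrightarrow>
              computes_in_time p [xs, ys] (card (subgraph_copies H G))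
                (real (f (length xs) (max_outdegree G)) *
                 real (length ys) powr (rho_star H + real c)))) \<and>
         (\<exists>(f :: nat \<Rightarrow> nat \<Rightarrow> nat) (p :: com) (c :: nat). computable2 f \<and>
           (\<forall>(H :: nat pair_pre_digraph) (G :: nat pair_pre_digraph) xs ys.
              adjacency_encoding H xs \<longrightarrow> adjacency_encoding G ys \<longrightarrow>
              computes_in_time p [xs, ys] (card (induced_copies H G))
                (real (f (length xs) (max_outdegree G)) *
                 real (length ys) powr (real (alpha_s H) + real c))))"
proof (intro conjI)
  have "\<exists>p D. \<forall>H G xs ys. adjacency_encoding H xs \<longrightarrow> adjacency_encoding G ys \<longrightarrow>
    computes_in_time p [xs, ys] (card (subgraph_copies H G))
      (real (fpt (length xs) (max_outdegree G) ^ (D + 2)) * real (length ys) powr (rho_star H + real (D + 1)))"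
  proof (rule algorithm[where C = "\<lambda>I v. \<not> in_source I v" and ct = embedding_count])
    fix H G xs ys I assume "pattern_host H G xs ys I"
    then interpret pattern_host H G xs ys I "num_verts I 0" "num_verts I 1" .
    show "(\<Sum>Q | Q < num_verts I 1 ^ num_verts I 0 \<and> good (\<lambda>I v. \<not> in_source I v) I (num_verts I 0) Q. embedding_count I Q) = card (subgraph_copies H G) * automorphism_count I \<and>
      card (subgraph_copies H G) * automorphism_count I \<le> num_verts I 1 ^ num_verts I 0"
      unfolding sum_good_con card_subgraph_copies[symmetric] by (intro conjI refl card_hom_le) auto
    show "0 \<le> rho_star H \<and> rho_star H \<le> num_verts I 0 \<and>
      (k \<le> num_verts I 0 \<longrightarrow> real (card (Pre (\<lambda>I v. \<not> in_source I v) k)) \<le> real (length ys * ballmax ^ num_verts I 0) powr rho_star H)" for k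
      using rho_star_props[where N = N] n_less by auto
  qed (intro counting_input.impl_of_bool_not counting_input.impl_in_source counting_input.impl_embedding_count; assumption)+
  then obtain p D where "\<forall>H G xs ys. adjacency_encoding H xs \<longrightarrow> adjacency_encoding G ys \<longrightarrow>
    computes_in_time p [xs, ys] (card (subgraph_copies H G))
      (real (fpt (length xs) (max_outdegree G) ^ (D + 2)) * real (length ys) powr (rho_star H + real (D + 1)))" by blast
  then show "\<exists>(f :: nat \<Rightarrow> nat \<Rightarrow> nat) (p :: com) (c :: nat). computable2 f \<and>
           (\<forall>(H :: nat pair_pre_digraph) (G :: nat pair_pre_digraph) xs ys.
              adjacency_encoding H xs \<longrightarrow> adjacency_encoding G ys \<longrightarrow>
              computes_in_time p [xs, ys] (card (subgraph_copies H G))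
                (real (f (length xs) (max_outdegree G)) *
                 real (length ys) powr (rho_star H + real c)))"
    \<comment> \<open>The witnesses are the power of \<open>fpt\<close> with exponent
      \<open>D + 2\<close> for f, and \<open>D + 1\<close> for c.\<close>
    using computable2_fpt_power by blast
  have "\<exists>p D. \<forall>H G xs ys. adjacency_encoding H xs \<longrightarrow> adjacency_encoding G ys \<longrightarrow>
    computes_in_time p [xs, ys] (card (induced_copies H G))
      (real (fpt (length xs) (max_outdegree G) ^ (D + 2)) * real (length ys) powr (real (alpha_s H) + real (D + 1)))"
  proof (rule algorithm[where C = "\<lambda>I v. True" and ct = "\<lambda>I Q. of_bool (induced_embedding I 1 (num_verts I 1) Q)"])
    fix H G xs ys I assume "pattern_host H G xs ys I"
    then interpret pattern_host H G xs ys I "num_verts I 0" "num_verts I 1" .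
    show "(\<Sum>Q | Q < num_verts I 1 ^ num_verts I 0 \<and> good (\<lambda>I v. True) I (num_verts I 0) Q. of_bool (induced_embedding I 1 (num_verts I 1) Q)) = card (induced_copies H G) * automorphism_count I \<and>
      card (induced_copies H G) * automorphism_count I \<le> num_verts I 1 ^ num_verts I 0"
      unfolding sum_good_ind card_induced_copies[symmetric] by (intro conjI refl card_hom_le iemb_hom)
    show "0 \<le> real (alpha_s H) \<and> real (alpha_s H) \<le> num_verts I 0 \<and>
      (k \<le> num_verts I 0 \<longrightarrow> real (card (Pre (\<lambda>I v. True) k)) \<le> real (length ys * ballmax ^ num_verts I 0) powr real (alpha_s H))" for k
      using alpha_s_props[where N = N and k = k] alpha_s_le n_less by auto
  next
    show "counting_input.impl (\<lambda>I s. of_bool True)" using counting_input.impl_const[of 1] by simp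
    show "counting_input.impl (\<lambda>I s. of_bool (induced_embedding I 1 (num_verts I 1) (q I s)))" if "counting_input.impl q" for q
      by (intro counting_input.impl_induced_embedding counting_input.impl_num_verts that) auto
  qed
  then obtain p D where "\<forall>H G xs ys. adjacency_encoding H xs \<longrightarrow> adjacency_encoding G ys \<longrightarrow>
    computes_in_time p [xs, ys] (card (induced_copies H G))
      (real (fpt (length xs) (max_outdegree G) ^ (D + 2)) * real (length ys) powr (real (alpha_s H) + real (D + 1)))" by blast
  then show "\<exists>(f :: nat \<Rightarrow> nat \<Rightarrow> nat) (p :: com) (c :: nat). computable2 f \<and>
           (\<forall>(H :: nat pair_pre_digraph) (G :: nat pair_pre_digraph) xs ys.
              adjacency_encoding H xs \<longrightarrow> adjacency_encoding G ys \<longrightarrow>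
              computes_in_time p [xs, ys] (card (induced_copies H G))
                (real (f (length xs) (max_outdegree G)) *
                 real (length ys) powr (real (alpha_s H) + real c)))"
    using computable2_fpt_power by blast
qed

end
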